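(* Let $1\le k\le n$ be integers and let $F\subseteq\mathbb{R}^n$ be a set with optimal oracles. Then for almost every $V\in\mathcal{G}(n,k)$, $$\dim_H(p_VF)=\min\{\dim_H(F),k\}.$$
   Context: $\mathcal{G}(n,k)$ is the Grassmannian of $k$-dimensional linear subspaces of $\mathbb{R}^n$; "almost every" is with respect to its rotation-invariant measure. $p_V$ is the orthogonal projection of $\mathbb{R}^n$ onto $V$, and $\dim_H$ is Hausdorff dimension. Kolmogorov complexity. Fix a universal prefix-free oracle Turing machine $U$. For an oracle $B\subseteq\mathbb{N}$ and finite binary strings $\sigma,\tau$, $K^B(\sigma\mid\tau)=\min\{\ell(\pi):\pi\in\{0,1\}^*,\ U^B(\pi,\tau)=\sigma\}$, where $\ell$ is length, and $K^B(\sigma)$ is the case where $\tau$ is the empty string. Via a fixed standard encoding of rational vectors as binary strings, $K^B(p)$ is defined for $p\in\mathbb{Q}^n$. For $x\in\mathbb{R}^n$ and $r\in\mathbb{N}$, $K^B_r(x)=\min\{K^B(p):p\in B_{2^{-r}}(x)\cap\mathbb{Q}^n\}$, where $B_\delta(x)$ is the ball of radius $\delta$ about $x$. A superscript $A,B$ means access to both oracles (their join). The effective dimension of $x$ relative to $A$ is $\dim^A(x)=\liminf_{r\to\infty}K^A_r(x)/r$. Optimal oracles. $A\subseteq\mathbb{N}$ is a Hausdorff oracle for $E\subseteq\mathbb{R}^n$ if $\dim_H(E)=\sup_{x\in E}\dim^A(x)$. $A$ is Hausdorff optimal for $E$ if (1) $A$ is a Hausdorff oracle for $E$, and (2) for every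 $B\subseteq\mathbb{N}$ and every $\varepsilon>0$ there is a point $x\in E$ such that $\dim^{A,B}(x)\ge\dim_H(E)-\varepsilon$ and, for every sufficiently large $r\in\mathbb{N}$, $K^{A,B}_r(x)\ge K^A_r(x)-\varepsilon r$. A set $E$ has optimal oracles if there is an $A\subseteq\mathbb{N}$ that is Hausdorff optimal for $E$. *)

theory Defs
  imports "HOL-Probability.Probability" "HOL-Library.Nat_Bijection"
begin

section \<open>Oracle Turing machines\<close>

text \<open>
  A deterministic multi-tape machine with two-way infinite tapes. States and symbols are initial
  segments of the natural numbers. State 0 is initial and state 1 halts. Symbol 0 is the blank,
  symbols 1 and 2 are the bits 0 and 1, all further symbols are auxiliary. Tape 0 holds the
  program, tape 1 the condition, tape 2 the characteristic sequence of the oracle (read-only),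
  tape 3 receives the output; further tapes are work tapes. \<open>trans M s xs\<close> is the action in
  state \<open>s\<close> when the scanned symbols are \<open>xs\<close>: the next state and, for each tape, the symbol to be
  written and the head movement.
\<close>

record otm =
  num_tapes :: nat
  num_states :: nat
  num_symbols :: nat
  trans :: "nat \<Rightarrow> nat list \<Rightarrow> nat \<times> (nat \<times> int) list"

definition otm_wf :: "otm \<Rightarrow> bool" where
  "otm_wf M \<longleftrightarrow>
     4 \<le> num_tapes M \<and> 2 \<le> num_states M \<and> 3 \<le> num_symbols M \<and>
     (\<forall>s xs. s < num_states M \<and> length xs = num_tapes M \<and> set xs \<subseteq> {..<num_symbols M} \<longrightarrow>
        (case trans M s xs of (s', as) \<Rightarrow>
           s' < num_states M \<and> length as = num_tapes M \<and>
           (\<forall>i<num_tapes M. fst (as ! i) < num_symbols M \<and> snd (as ! i) \<in> {-1, 0, 1}) \<and>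
           fst (as ! 2) = xs ! 2))"

record config =
  state :: nat
  cell_symbol :: "nat \<Rightarrow> int \<Rightarrow> nat"
  head :: "nat \<Rightarrow> int"

definition bit_symbol :: "bool \<Rightarrow> nat" where
  "bit_symbol b = (if b then 2 else 1)"

definition string_tape :: "bool list \<Rightarrow> int \<Rightarrow> nat" where
  "string_tape \<sigma> z = (if 0 \<le> z \<and> z < int (length \<sigma>) then bit_symbol (\<sigma> ! nat z) else 0)"

definition oracle_tape :: "nat set \<Rightarrow> int \<Rightarrow> nat" where
  "oracle_tape B z = (if 0 \<le> z then bit_symbol (nat z \<in> B) else 0)"

definition init_config :: "nat set \<Rightarrow> bool list \<Rightarrow> bool list \<Rightarrow> config" where
  "init_config B \<pi> \<tau> =
     \<lparr>state = 0,
      cell_symbol = (\<lambda>i. if i = 0 then string_tape \<pi> else if i = 1 then string_tape \<tau>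
                     else if i = 2 then oracle_tape B else (\<lambda>_. 0)),
      head = (\<lambda>_. 0)\<rparr>"

definition step :: "otm \<Rightarrow> config \<Rightarrow> config" where
  "step M c =
     (if state c = 1 then c
      else case trans M (state c) (map (\<lambda>i. cell_symbol c i (head c i)) [0..<num_tapes M]) of
        (s', as) \<Rightarrow>
          \<lparr>state = s',
           cell_symbol = (\<lambda>i. if i < num_tapes M then (cell_symbol c i)(head c i := fst (as ! i))
                          else cell_symbol c i),
           head = (\<lambda>i. if i < num_tapes M then head c i + snd (as ! i) else head c i)\<rparr>)"

text \<open>The output is the maximal block of bits that starts at cell 0 of the output tape.\<close>

definition has_output :: "config \<Rightarrow> bool list \<Rightarrow> bool" where
  "has_output c \<sigma> \<longleftrightarrow>
     (\<forall>i<length \<sigma>. cell_symbol c 3 (int i) = bit_symbol (\<sigma> ! i)) \<and>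
     cell_symbol c 3 (int (length \<sigma>)) \<notin> range bit_symbol"

definition computes :: "otm \<Rightarrow> nat set \<Rightarrow> bool list \<Rightarrow> bool list \<Rightarrow> bool list \<Rightarrow> bool" where
  "computes M B \<pi> \<tau> \<sigma> \<longleftrightarrow>
     (\<exists>t. state ((step M ^^ t) (init_config B \<pi> \<tau>)) = 1 \<and>
          has_output ((step M ^^ t) (init_config B \<pi> \<tau>)) \<sigma>)"

definition prefix_free :: "otm \<Rightarrow> bool" where
  "prefix_free M \<longleftrightarrow>
     (\<forall>B \<tau> \<pi> \<rho> \<sigma> \<sigma>'. computes M B \<pi> \<tau> \<sigma> \<and> computes M B (\<pi> @ \<rho>) \<tau> \<sigma>' \<longrightarrow> \<rho> = [])"

definition universal_prefix_free :: "otm \<Rightarrow> bool" where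
  "universal_prefix_free U \<longleftrightarrow>
     otm_wf U \<and> prefix_free U \<and>
     (\<forall>M. otm_wf M \<and> prefix_free M \<longrightarrow>
        (\<exists>\<rho>. \<forall>B \<pi> \<tau> \<sigma>. computes U B (\<rho> @ \<pi>) \<tau> \<sigma> \<longleftrightarrow> computes M B \<pi> \<tau> \<sigma>))"

section \<open>Kolmogorov complexity and effective dimension\<close>

definition cond_complexity :: "otm \<Rightarrow> nat set \<Rightarrow> bool list \<Rightarrow> bool list \<Rightarrow> nat" where
  "cond_complexity U B \<sigma> \<tau> = (LEAST l. \<exists>\<pi>. length \<pi> = l \<and> computes U B \<pi> \<tau> \<sigma>)"

definition complexity :: "otm \<Rightarrow> nat set \<Rightarrow> bool list \<Rightarrow> nat" where
  "complexity U B \<sigma> = cond_complexity U B \<sigma> []"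

text \<open>The length-lexicographic bijection between natural numbers and strings.\<close>

fun string_of_nat :: "nat \<Rightarrow> bool list" where
  "string_of_nat 0 = []"
| "string_of_nat (Suc m) = string_of_nat (m div 2) @ [odd m]"

definition rat_code :: "rat \<Rightarrow> nat" where
  "rat_code q = (case quotient_of q of (a, b) \<Rightarrow> prod_encode (int_encode a, nat b))"

text \<open>
  \<^term>\<open>from_nat_into (UNIV :: 'n set)\<close> restricts to a bijection from \<open>{..<CARD('n)}\<close> to \<open>'n\<close>;
  it fixes the order in which the coordinates are listed.
\<close>

definition vec_code :: "rat ^ 'n \<Rightarrow> bool list" where
  "vec_code p =
     string_of_nat
       (list_encode (map (\<lambda>i. rat_code (p $ from_nat_into (UNIV :: 'n set) i)) [0..<CARD('n)]))"

definition real_vec :: "rat ^ 'n \<Rightarrow> real ^ 'n" where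
  "real_vec p = (\<chi> i. of_rat (p $ i))"

definition complexity_at :: "otm \<Rightarrow> nat set \<Rightarrow> nat \<Rightarrow> real ^ 'n \<Rightarrow> nat" where
  "complexity_at U B r x =
     (LEAST l. \<exists>p :: rat ^ 'n. real_vec p \<in> ball x ((1/2) ^ r) \<and> complexity U B (vec_code p) = l)"

definition effective_dim :: "otm \<Rightarrow> nat set \<Rightarrow> real ^ 'n \<Rightarrow> ennreal" where
  "effective_dim U A x = liminf (\<lambda>r. ennreal (real (complexity_at U A r x) / real r))"

definition oracle_join :: "nat set \<Rightarrow> nat set \<Rightarrow> nat set" where
  "oracle_join A B = (\<lambda>m. 2 * m) ` A \<union> (\<lambda>m. 2 * m + 1) ` B"

section \<open>Hausdorff dimension\<close>

text \<open>
  \<^const>\<open>diameter\<close> is meaningful only for bounded sets, hence the explicit boundedness condition.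
  As \<open>0 powr 0 = 0\<close>, these are the usual Hausdorff measures only for \<open>s > 0\<close>; this suffices for
  the dimension.
\<close>

definition hausdorff_premeasure :: "real \<Rightarrow> real \<Rightarrow> 'a::metric_space set \<Rightarrow> ennreal" where
  "hausdorff_premeasure s \<delta> E =
     (INF C \<in> {C :: nat \<Rightarrow> 'a set. E \<subseteq> (\<Union>i. C i) \<and> (\<forall>i. bounded (C i) \<and> diameter (C i) \<le> \<delta>)}.
        \<Sum>i. ennreal (diameter (C i) powr s))"

definition hausdorff_measure :: "real \<Rightarrow> 'a::metric_space set \<Rightarrow> ennreal" where
  "hausdorff_measure s E = (SUP \<delta> \<in> {0<..}. hausdorff_premeasure s \<delta> E)"

definition hausdorff_dim :: "'a::metric_space set \<Rightarrow> ennreal" where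
  "hausdorff_dim E = (INF s \<in> {s. 0 < s \<and> hausdorff_measure s E = 0}. ennreal s)"

section \<open>Optimal oracles\<close>

definition hausdorff_oracle :: "otm \<Rightarrow> nat set \<Rightarrow> (real ^ 'n) set \<Rightarrow> bool" where
  "hausdorff_oracle U A E \<longleftrightarrow> hausdorff_dim E = (SUP x\<in>E. effective_dim U A x)"

definition hausdorff_optimal :: "otm \<Rightarrow> nat set \<Rightarrow> (real ^ 'n) set \<Rightarrow> bool" where
  "hausdorff_optimal U A E \<longleftrightarrow>
     hausdorff_oracle U A E \<and>
     (\<forall>B. \<forall>\<epsilon>>0. \<exists>x\<in>E.
        effective_dim U (oracle_join A B) x \<ge> hausdorff_dim E - ennreal \<epsilon> \<and>
        (\<forall>\<^sub>F r in sequentially.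
           real (complexity_at U (oracle_join A B) r x)
             \<ge> real (complexity_at U A r x) - \<epsilon> * real r))"

definition has_optimal_oracles :: "otm \<Rightarrow> (real ^ 'n) set \<Rightarrow> bool" where
  "has_optimal_oracles U E \<longleftrightarrow> (\<exists>A. hausdorff_optimal U A E)"

section \<open>The Grassmannian\<close>

definition grassmannian :: "nat \<Rightarrow> (real ^ 'n) set set" where
  "grassmannian k = {V. subspace V \<and> dim V = k}"

definition orth_proj :: "(real ^ 'n) set \<Rightarrow> real ^ 'n \<Rightarrow> real ^ 'n" where
  "orth_proj V x = (THE y. y \<in> V \<and> (\<forall>v\<in>V. orthogonal (x - y) v))"

text \<open>
  The Borel sets of the Grassmannian for its usual topology, which is induced by the embedding
  that sends a subspace to the matrix of its orthogonal projection.
\<close>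

definition grassmannian_borel :: "nat \<Rightarrow> (real ^ 'n) set measure" where
  "grassmannian_borel k =
     vimage_algebra (grassmannian k) (\<lambda>V. matrix (orth_proj V)) (borel :: (real ^ 'n ^ 'n) measure)"

text \<open>
  For \<open>k \<le> CARD('n)\<close> there is exactly one rotation-invariant Borel probability measure on the
  Grassmannian; the following predicate characterises it.
\<close>

definition rotation_invariant_measure :: "nat \<Rightarrow> (real ^ 'n) set measure \<Rightarrow> bool" where
  "rotation_invariant_measure k \<gamma> \<longleftrightarrow>
     prob_space \<gamma> \<and> space \<gamma> = grassmannian k \<and> sets \<gamma> = sets (grassmannian_borel k) \<and>
     (\<forall>f. orthogonal_transformation f \<and> det (matrix f) = 1 \<longrightarrow>
        (\<forall>\<A>\<in>sets \<gamma>. emeasure \<gamma> ((\<lambda>V. f ` V) ` \<A>) = emeasure \<gamma> \<A>))"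

end

theory Submission
  imports Defs "HOL-Real_Asymp.Real_Asymp"
begin

text \<open>
  Fix an optimal oracle \<open>A\<close> for \<open>F\<close> and \<open>s < h < min (dim F) k\<close>. Let \<open>N \<kappa>\<close> be the set of rational points of
  complexity at most \<open>\<kappa>\<close> relative to \<open>A\<close>. A transversality estimate on the Grassmannian and the Borel--Cantelli
  lemma show that for almost every \<open>V\<close>, at every sufficiently small scale \<open>2 ^ (- r)\<close>, only a small
  proportion of the points \<open>q\<close> of \<open>N \<kappa>\<close> has low energy and yet more than about \<open>2 powr (\<kappa> - h * r)\<close> points of
  \<open>N \<kappa>\<close> projecting to the \<open>2 ^ (- r)\<close>-neighbourhood of its projection to \<open>V\<close>. If the projection of \<open>F\<close> to such a \<open>V\<close> had
  dimension less than \<open>s\<close>, then every point of \<open>F\<close> would, at suitable scales, be described by naming a member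
  of an efficient cover of the projection and a point in the fibre over it, which saves about \<open>(h - s) * r\<close> bits.
  An oracle \<open>B\<close> can store the cover, the fibres and all other finite sets involved, so this contradicts
  the optimality of \<open>A\<close>. Since \<open>B\<close> is arbitrary, the only computation that is needed is to look up a table
  in the oracle.
\<close>

text \<open>The exceptional null set must be fixed before \<open>B\<close>, which is built from
  \<open>V\<close> and covers of its projection. This works because \<open>N \<kappa>\<close> refers
  to \<open>A\<close> alone; optimality of \<open>A\<close> then supplies, for every
  \<open>B\<close>, a point whose complexity relative to both oracles stays above
  \<open>\<kappa> - \<epsilon> * r\<close>. The obstacle is that \<open>N \<kappa>\<close> may be
  clustered, and transversality cannot separate the points of a cluster. But a point
  \<open>x\<close> of complexity at least about \<open>h * t\<close> at every large scale
  \<open>t\<close>, even relative to \<open>B\<close>, does not lie in a cluster: a spot with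
  \<open>2 ^ l\<close> points of \<open>N \<kappa>\<close> near it could be named by about
  \<open>\<kappa> - l\<close> bits, since there are few such spots. Hence \<open>l\<close> is at
  most about \<open>\<kappa> - h * t\<close>, and as \<open>h \<le> k\<close>, every scale
  contributes at most about \<open>2 powr (\<kappa> - h * r)\<close> to the energy. The points of
  low energy on which the given \<open>V\<close> still fails are so few that an index into their
  list is again too short a description. So \<open>x\<close>, though chosen after \<open>V\<close>,
  avoids both kinds of exception.\<close>

section \<open>Machines that scan program and oracle\<close>

text \<open>State, positions of the heads on the program and the oracle tape, output so far.\<close>

type_synonym scan_state = "nat \<times> int \<times> int \<times> bool list"

text \<open>All scanned symbols except the one on the output tape are written back and the head on
  the condition tape never moves, so a run is determined by the four components of
  \<open>scan_state\<close>.\<close>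

definition scanner :: "nat \<Rightarrow> (nat \<Rightarrow> nat \<Rightarrow> nat \<Rightarrow> nat \<times> int \<times> int \<times> bool option) \<Rightarrow> otm" where
  "scanner N core =
     \<lparr>num_tapes = 4, num_states = N, num_symbols = 3,
      trans = (\<lambda>s xs. case core s (xs ! 0) (xs ! 2) of (s', dp, dq, w) \<Rightarrow>
        (s', [(xs ! 0, dp), (xs ! 1, 0), (xs ! 2, dq),
              (case w of None \<Rightarrow> (xs ! 3, 0) | Some b \<Rightarrow> (bit_symbol b, 1))]))\<rparr>"

definition scan_step ::
  "(nat \<Rightarrow> nat \<Rightarrow> nat \<Rightarrow> nat \<times> int \<times> int \<times> bool option) \<Rightarrow> nat set \<Rightarrow> bool list \<Rightarrow>
     scan_state \<Rightarrow> scan_state" where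
  "scan_step core B \<pi> c = (case c of (s, hp, hq, out) \<Rightarrow>
     if s = 1 then c
     else case core s (string_tape \<pi> hp) (oracle_tape B hq) of (s', dp, dq, w) \<Rightarrow>
       (s', hp + dp, hq + dq, (case w of None \<Rightarrow> out | Some b \<Rightarrow> out @ [b])))"

definition scan_config :: "nat set \<Rightarrow> bool list \<Rightarrow> bool list \<Rightarrow> scan_state \<Rightarrow> config" where
  "scan_config B \<pi> \<tau> c = (case c of (s, hp, hq, out) \<Rightarrow>
     \<lparr>state = s,
      cell_symbol = (\<lambda>i. if i = 0 then string_tape \<pi> else if i = 1 then string_tape \<tau>
                     else if i = 2 then oracle_tape B else if i = 3 then string_tape out
                     else (\<lambda>_. 0)),
      head = (\<lambda>i. if i = 0 then hp else if i = 2 then hq else if i = 3 then int (length out)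
              else 0)\<rparr>)"

lemma string_tape_snoc:
  "string_tape (out @ [b]) = (string_tape out)(int (length out) := bit_symbol b)"
  by (rule ext) (auto simp: string_tape_def nth_append split: if_splits)

lemma step_scan_config:
  "step (scanner N core) (scan_config B \<pi> \<tau> c) = scan_config B \<pi> \<tau> (scan_step core B \<pi> c)"
proof -
  obtain s hp hq out where c: "c = (s, hp, hq, out)" by (cases c)
  obtain s' dp dq w where k: "core s (string_tape \<pi> hp) (oracle_tape B hq) = (s', dp, dq, w)"
    by (metis prod_cases4)
  have upt: "[0..<4] = [0, 1, 2, 3::nat]" by (simp add: upt_rec)
  show ?thesis
  proof (cases "s = 1")
    case True
    then show ?thesis by (simp add: c scan_step_def step_def scan_config_def)
  next
    case False
    have lt4: "i < 4 \<longleftrightarrow> i = 0 \<or> i = 1 \<or> i = 2 \<or> i = 3" for i :: nat by auto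
    show ?thesis
      using False k
      by (cases w) (auto simp: c scan_step_def step_def scan_config_def scanner_def upt
          lt4 string_tape_snoc intro!: ext)
  qed
qed

lemma run_scan_config:
  "(step (scanner N core) ^^ t) (init_config B \<pi> \<tau>) =
     scan_config B \<pi> \<tau> ((scan_step core B \<pi> ^^ t) (0, 0, 0, []))"
proof (induction t)
  case 0
  show ?case
    by (auto simp: init_config_def scan_config_def string_tape_def intro!: ext)
next
  case (Suc t)
  then show ?case by (simp add: step_scan_config)
qed

lemma bit_symbol_inj: "bit_symbol a = bit_symbol b \<longleftrightarrow> a = b"
  by (auto simp: bit_symbol_def)

lemma bit_symbol_neq: "bit_symbol b \<noteq> 0"
  by (simp add: bit_symbol_def)

text \<open>Of two outputs of different length, the longer demands a bit in the cell where the
  shorter demands a non-bit.\<close>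

lemma has_output_unique:
  assumes "has_output c \<sigma>" "has_output c \<sigma>'"
  shows "\<sigma> = \<sigma>'"
proof -
  have le: "length a \<le> length b" if "has_output c a" "has_output c b" for a b
  proof (rule ccontr)
    assume "\<not> length a \<le> length b"
    then have "cell_symbol c 3 (int (length b)) = bit_symbol (a ! length b)"
      using that(1) unfolding has_output_def by simp
    then show False using that(2) unfolding has_output_def by simp
  qed
  have "length \<sigma> = length \<sigma>'" using le assms by (simp add: le_antisym)
  then show ?thesis
    using assms by (auto simp: has_output_def bit_symbol_inj intro!: nth_equalityI)
qed

lemma has_output_scan_config: "has_output (scan_config B \<pi> \<tau> (s, hp, hq, out)) out"
  by (auto simp: has_output_def scan_config_def string_tape_def image_iff bit_symbol_def)

lemma computes_scanner:
  "computes (scanner N core) B \<pi> \<tau> \<sigma> \<longleftrightarrow>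
     (\<exists>t hp hq. (scan_step core B \<pi> ^^ t) (0, 0, 0, []) = (1, hp, hq, \<sigma>))"
proof -
  have "state (scan_config B \<pi> \<tau> c) = 1 \<and> has_output (scan_config B \<pi> \<tau> c) \<sigma> \<longleftrightarrow>
      (\<exists>hp hq. c = (1, hp, hq, \<sigma>))" for c
  proof -
    obtain s hp hq out where c: "c = (s, hp, hq, out)" by (cases c)
    have "state (scan_config B \<pi> \<tau> c) = s" by (simp add: c scan_config_def)
    moreover have "has_output (scan_config B \<pi> \<tau> c) \<sigma> \<longleftrightarrow> out = \<sigma>"
      using has_output_scan_config has_output_unique unfolding c by blast
    ultimately show ?thesis by (auto simp: c)
  qed
  then show ?thesis by (simp add: computes_def run_scan_config)
qed

lemma otm_wf_scanner:
  assumes "2 \<le> N"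
    and "\<And>s p q. s < N \<Longrightarrow> p < 3 \<Longrightarrow> q < 3 \<Longrightarrow>
      (case core s p q of (s', dp, dq, w) \<Rightarrow> s' < N \<and> dp \<in> {-1, 0, 1} \<and> dq \<in> {-1, 0, 1})"
  shows "otm_wf (scanner N core)"
proof -
  have four: "i < 4 \<longleftrightarrow> i = 0 \<or> i = 1 \<or> i = 2 \<or> i = 3" for i :: nat by auto
  show ?thesis
    unfolding otm_wf_def
  proof (intro conjI allI impI)
    fix s and xs :: "nat list"
    assume a: "s < num_states (scanner N core) \<and> length xs = num_tapes (scanner N core) \<and>
      set xs \<subseteq> {..<num_symbols (scanner N core)}"
    then have x: "xs ! i < 3" if "i < 4" for i
    proof -
      have "xs ! i \<in> set xs" "set xs \<subseteq> {..<3}" using that a by (simp_all add: scanner_def)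
      then show ?thesis by blast
    qed
    obtain s' dp dq w where k: "core s (xs ! 0) (xs ! 2) = (s', dp, dq, w)"
      by (metis prod_cases4)
    have "s' < N \<and> dp \<in> {-1, 0, 1} \<and> dq \<in> {-1, 0, 1}"
      using assms(2)[of s "xs ! 0" "xs ! 2"] a x k by (simp add: scanner_def)
    moreover obtain w' where
      "trans (scanner N core) s xs = (s', [(xs ! 0, dp), (xs ! 1, 0), (xs ! 2, dq), w'])"
      "fst w' < 3" "snd w' \<in> {-1, 0, 1}"
      using x[of 3] by (cases w) (auto simp: scanner_def k bit_symbol_def)
    ultimately show "case trans (scanner N core) s xs of (s', as) \<Rightarrow>
         s' < num_states (scanner N core) \<and> length as = num_tapes (scanner N core) \<and>
         (\<forall>i<num_tapes (scanner N core). fst (as ! i) < num_symbols (scanner N core) \<and>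
            snd (as ! i) \<in> {-1, 0, 1}) \<and> fst (as ! 2) = xs ! 2"
      using x[of 0] x[of 1] x[of 2] by (auto simp: scanner_def four)
  qed (use assms(1) in \<open>simp_all add: scanner_def\<close>)
qed

lemma scan_absorbing:
  assumes "(scan_step core B \<pi> ^^ t) c = c'" "fst c' = d"
    and "\<And>p q. fst (core d p q) = d"
  shows "fst ((scan_step core B \<pi> ^^ (t + u)) c) = d"
proof (induction u)
  case 0
  then show ?case using assms by simp
next
  case (Suc u)
  obtain s hp hq out where c: "(scan_step core B \<pi> ^^ (t + u)) c = (s, hp, hq, out)"
    by (metis prod_cases4)
  then have s: "s = d" using Suc by simp
  have "fst (core s (string_tape \<pi> hp) (oracle_tape B hq)) = d" using assms(3) s by simp
  then show ?case by (simp add: c s) (auto simp: scan_step_def split: prod.splits)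
qed

text \<open>State 1 is absorbing as well, so the two times \<open>t\<close> and \<open>u\<close> may
  come in either order.\<close>

lemma scan_dead:
  assumes "\<And>p q. fst (core d p q) = d" "d \<noteq> 1"
    and "fst ((scan_step core B \<pi> ^^ t) c) = d"
  shows "fst ((scan_step core B \<pi> ^^ u) c) \<noteq> 1"
proof (cases "t \<le> u")
  case True
  then show ?thesis using scan_absorbing[OF refl assms(3) assms(1), of "u - t"] assms(2) by simp
next
  case False
  show ?thesis
  proof
    assume a: "fst ((scan_step core B \<pi> ^^ u) c) = 1"
    have "(scan_step core B \<pi> ^^ (u + v)) c = (scan_step core B \<pi> ^^ u) c" for v
      using a by (induction v) (auto simp: scan_step_def split: prod.splits)
    from this[of "t - u"] False a assms show False by auto
  qed
qed

text \<open>
  Prefix-freeness by coupling the runs on \<open>\<pi>\<close> and \<open>\<pi> @ \<rho>\<close>: they proceed in lockstep, in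
  states satisfying \<open>I\<close>, until one of them enters the dead state \<open>d\<close>.
\<close>

lemma prefix_free_scanner:
  assumes dead: "\<And>p q. fst (core d p q) = d" "d \<noteq> 1"
    and init: "\<And>l. 0 \<le> l \<Longrightarrow> I l (0, 0, 0, [])"
    and halt: "\<And>l hp hq out. \<not> I l (1, hp, hq, out)"
    and coupling: "\<And>B \<pi> \<rho> c. I (int (length \<pi>)) c \<Longrightarrow> \<rho> \<noteq> [] \<Longrightarrow>
        fst (scan_step core B \<pi> c) = d \<or> fst (scan_step core B (\<pi> @ \<rho>) c) = d \<or>
        scan_step core B \<pi> c = scan_step core B (\<pi> @ \<rho>) c \<and> I (int (length \<pi>)) (scan_step core B \<pi> c)"
  shows "prefix_free (scanner N core)"
  unfolding prefix_free_def
proof (intro allI impI, rule ccontr)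
  fix B \<tau> \<pi> \<rho> \<sigma> \<sigma>'
  assume c: "computes (scanner N core) B \<pi> \<tau> \<sigma> \<and> computes (scanner N core) B (\<pi> @ \<rho>) \<tau> \<sigma>'"
    and ne: "\<rho> \<noteq> []"
  let ?c = "(0, 0, 0, []) :: scan_state"
  obtain t where t: "fst ((scan_step core B \<pi> ^^ t) ?c) = 1"
    using c unfolding computes_scanner by (metis fst_conv)
  obtain t' where t': "fst ((scan_step core B (\<pi> @ \<rho>) ^^ t') ?c) = 1"
    using c unfolding computes_scanner by (metis fst_conv)
  have nd: "fst ((scan_step core B \<pi> ^^ u) ?c) \<noteq> d" "fst ((scan_step core B (\<pi> @ \<rho>) ^^ u) ?c) \<noteq> d" for u
    using scan_dead[where core = core and d = d and c = ?c] dead t t'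
    by blast+
  have "(scan_step core B \<pi> ^^ u) ?c = (scan_step core B (\<pi> @ \<rho>) ^^ u) ?c \<and>
      I (int (length \<pi>)) ((scan_step core B \<pi> ^^ u) ?c)" for u
  proof (induction u)
    case 0
    then show ?case using init by simp
  next
    case (Suc u)
    let ?x = "(scan_step core B \<pi> ^^ u) ?c"
    have "fst (scan_step core B \<pi> ?x) \<noteq> d" "fst (scan_step core B (\<pi> @ \<rho>) ?x) \<noteq> d"
      using nd[of "Suc u"] Suc by auto
    then show ?case using coupling[of \<pi> ?x \<rho> B] Suc ne by auto
  qed
  \<comment> \<open>Neither of two halting runs is ever dead, so they remain coupled for ever,
    whereas \<open>I\<close> excludes the halting state.\<close>
  from this[of t] t halt show False by (metis prod.collapse)
qed

section \<open>Every string has a program\<close>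

text \<open>
  States: 0 reads a flag, 2 copies a bit, 3 expects the end of the program, 4 is dead.
\<close>

definition print_core :: "nat \<Rightarrow> nat \<Rightarrow> nat \<Rightarrow> nat \<times> int \<times> int \<times> bool option" where
  "print_core s p q =
     (if s = 0 then (if p = 2 then 2 else if p = 1 then 3 else 4, 1, 0, None)
      else if s = 2 then (if p = 0 then (4, 0, 0, None) else (0, 1, 0, Some (p = 2)))
      else if s = 3 then (if p = 0 then 1 else 4, 0, 0, None)
      else (4, 0, 0, None))"

text \<open>A prefix-free code of length \<open>2 * length xs + 1\<close>. It is the program format
  of the printing machine and also delimits keys, outputs and indices in the tables below.\<close>

definition flagged :: "bool list \<Rightarrow> bool list" where
  "flagged xs = concat (map (\<lambda>b. [True, b]) xs) @ [False]"

lemma flagged_simps: "flagged [] = [False]" "flagged (b # xs) = True # b # flagged xs"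
  by (simp_all add: flagged_def)

lemma string_tape_at: "i = int (length u) \<Longrightarrow> string_tape (u @ b # v) i = bit_symbol b"
  by (simp add: string_tape_def)

lemma string_tape_append:
  "i < int (length \<pi>) \<Longrightarrow> string_tape (\<pi> @ \<rho>) i = string_tape \<pi> i"
  by (auto simp: string_tape_def nth_append)

lemma string_tape_end:
  "string_tape \<pi> (int (length \<pi>)) = 0"
  "\<rho> \<noteq> [] \<Longrightarrow> string_tape (\<pi> @ \<rho>) (int (length \<pi>)) \<noteq> 0"
  by (auto simp: string_tape_def bit_symbol_neq)

text \<open>The runs can differ only with the head just behind \<open>\<pi>\<close>, where one reads
  a blank and the other a bit. In the states 0 and 2 the blank is fatal, in state 3 the bit.\<close>

lemma prefix_free_print: "prefix_free (scanner 5 print_core)"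
proof (rule prefix_free_scanner[where d = 4
      and I = "\<lambda>l (s, hp, hq, out). s \<in> {0, 2, 3} \<and> 0 \<le> hp \<and> hp \<le> l"])
  fix B and \<pi> \<rho> :: "bool list" and c :: scan_state
  assume I: "case c of (s, hp, hq, out) \<Rightarrow> s \<in> {0, 2, 3} \<and> 0 \<le> hp \<and> hp \<le> int (length \<pi>)"
    and ne: "\<rho> \<noteq> ([] :: bool list)"
  obtain s hp hq out where c: "c = (s, hp, hq, out)" by (cases c)
  show "fst (scan_step print_core B \<pi> c) = 4 \<or> fst (scan_step print_core B (\<pi> @ \<rho>) c) = 4 \<or>
        scan_step print_core B \<pi> c = scan_step print_core B (\<pi> @ \<rho>) c \<and>
        (case scan_step print_core B \<pi> c of (s, hp, hq, out) \<Rightarrow>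
          s \<in> {0, 2, 3} \<and> 0 \<le> hp \<and> hp \<le> int (length \<pi>))"
  proof (cases "hp = int (length \<pi>)")
    case True
    then show ?thesis using I string_tape_end[of \<pi>] string_tape_end(2)[OF ne, of \<pi>]
      by (auto simp: c scan_step_def print_core_def)
  next
    case False
    then have "string_tape (\<pi> @ \<rho>) hp = string_tape \<pi> hp"
      using I by (intro string_tape_append) (auto simp: c)
    moreover have "string_tape \<pi> hp \<noteq> 0"
      using I False by (auto simp: c string_tape_def bit_symbol_neq)
    ultimately show ?thesis using I False
      by (auto simp: c scan_step_def print_core_def)
  qed
qed (auto simp: print_core_def)

definition scan_reach ::
  "(nat \<Rightarrow> nat \<Rightarrow> nat \<Rightarrow> nat \<times> int \<times> int \<times> bool option) \<Rightarrow> nat set \<Rightarrow> bool list \<Rightarrow>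
     scan_state \<Rightarrow> scan_state \<Rightarrow> bool" where
  "scan_reach core B \<pi> c c' \<longleftrightarrow> (\<exists>t. (scan_step core B \<pi> ^^ t) c = c')"

lemma scan_reach_refl: "scan_reach core B \<pi> c c"
  unfolding scan_reach_def by (metis funpow_0)

lemma scan_reach_trans:
  "scan_reach core B \<pi> c c' \<Longrightarrow> scan_reach core B \<pi> c' c'' \<Longrightarrow> scan_reach core B \<pi> c c''"
  unfolding scan_reach_def by (metis funpow_add comp_apply)

lemma scan_reach_step:
  "scan_reach core B \<pi> (scan_step core B \<pi> c) c' \<Longrightarrow> scan_reach core B \<pi> c c'"
  by (rule scan_reach_trans[of _ _ _ _ "scan_step core B \<pi> c"])
     (auto simp: scan_reach_def intro: exI[of _ 1])

lemma computes_scanner_iff: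
  "computes (scanner N core) B \<pi> \<tau> \<sigma> \<longleftrightarrow>
     (\<exists>hp hq. scan_reach core B \<pi> (0, 0, 0, []) (1, hp, hq, \<sigma>))"
  unfolding computes_scanner scan_reach_def by blast

lemma print_run:
  "scan_reach print_core B (u @ flagged \<sigma>) (0, int (length u), 0, out)
     (1, int (length u + length (flagged \<sigma>)), 0, out @ \<sigma>)"
proof (induction \<sigma> arbitrary: u out)
  case Nil
  have "string_tape (u @ [False]) (int (length u)) = 1"
    by (simp add: string_tape_at bit_symbol_def)
  moreover have "string_tape (u @ [False]) (int (length u) + 1) = 0"
    using string_tape_end(1)[of "u @ [False]"] by (simp add: add.commute)
  ultimately have "scan_step print_core B (u @ [False]) (0, int (length u), 0, out) =
        (3, int (length u) + 1, 0, out)"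
      "scan_step print_core B (u @ [False]) (3, int (length u) + 1, 0, out) =
        (1, int (length u) + 1, 0, out)"
    by (simp_all add: scan_step_def print_core_def)
  then show ?case
    unfolding flagged_simps
    using scan_reach_step scan_reach_refl by (metis add.commute append_Nil2 length_Cons list.size(3) of_nat_1 of_nat_Suc of_nat_add One_nat_def)
next
  case (Cons b \<sigma>)
  have 1: "string_tape (u @ flagged (b # \<sigma>)) (int (length u)) = 2"
    by (simp add: string_tape_at bit_symbol_def flagged_simps)
  have 2: "string_tape (u @ flagged (b # \<sigma>)) (int (length u) + 1) = bit_symbol b"
    using string_tape_at[of "int (length u) + 1" "u @ [True]" b "flagged \<sigma>"]
    by (simp add: flagged_simps)
  have "scan_step print_core B (u @ flagged (b # \<sigma>)) (0, int (length u), 0, out) =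
        (2, int (length u) + 1, 0, out)"
      "scan_step print_core B (u @ flagged (b # \<sigma>)) (2, int (length u) + 1, 0, out) =
        (0, int (length u) + 1 + 1, 0, out @ [b])"
    by (simp_all add: scan_step_def print_core_def 1 2 bit_symbol_neq)
       (simp add: bit_symbol_def)
  then have 3: "scan_reach print_core B (u @ flagged (b # \<sigma>)) (0, int (length u), 0, out)
      (0, int (length u) + 1 + 1, 0, out @ [b])"
    using scan_reach_step scan_reach_refl by metis
  have "u @ flagged (b # \<sigma>) = (u @ [True, b]) @ flagged \<sigma>" by (simp add: flagged_simps)
  then show ?case
    using scan_reach_trans[OF 3] Cons.IH[of "u @ [True, b]" "out @ [b]"]
    by (simp add: flagged_simps add_ac)
qed

text \<open>Guarantees that the \<open>LEAST\<close> in \<open>cond_complexity\<close> is attained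
  and is no unspecified value.\<close>

lemma ex_program:
  assumes "universal_prefix_free U"
  shows "\<exists>\<pi>. computes U B \<pi> \<tau> \<sigma>"
proof -
  have "otm_wf (scanner 5 print_core)"
    by (rule otm_wf_scanner) (auto simp: print_core_def)
  then obtain \<rho> where "\<forall>B \<pi> \<tau> \<sigma>. computes U B (\<rho> @ \<pi>) \<tau> \<sigma> \<longleftrightarrow>
      computes (scanner 5 print_core) B \<pi> \<tau> \<sigma>"
    using assms prefix_free_print unfolding universal_prefix_free_def by blast
  moreover have "computes (scanner 5 print_core) B (flagged \<sigma>) \<tau> \<sigma>"
    unfolding computes_scanner_iff using print_run[of B "[]" \<sigma> "[]"] by force
  ultimately show ?thesis by blast
qed

section \<open>Shortest programs and the number of strings of low complexity\<close>

lemma computes_unique: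
  assumes "computes M B \<pi> \<tau> \<sigma>" "computes M B \<pi> \<tau> \<sigma>'"
  shows "\<sigma> = \<sigma>'"
proof -
  let ?c = "\<lambda>t. (step M ^^ t) (init_config B \<pi> \<tau>)"
  obtain t t' where t: "state (?c t) = 1" "has_output (?c t) \<sigma>"
    "state (?c t') = 1" "has_output (?c t') \<sigma>'"
    using assms unfolding computes_def by blast
  have fix_point: "?c (t + u) = ?c t" if "state (?c t) = 1" for t u
    using that by (induction u) (auto simp: step_def)
  have "?c t = ?c t'"
    using fix_point[of t "t' - t"] fix_point[of t' "t - t'"] t by (cases "t \<le> t'") auto
  then show ?thesis using t has_output_unique by metis
qed

lemma complexity_program:
  assumes "universal_prefix_free U"
  shows "\<exists>\<pi>. length \<pi> = complexity U B \<sigma> \<and> computes U B \<pi> [] \<sigma>"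
  unfolding complexity_def cond_complexity_def
  by (rule LeastI_ex) (use ex_program[OF assms] in blast)

lemma complexity_le: "computes U B \<pi> [] \<sigma> \<Longrightarrow> complexity U B \<sigma> \<le> length \<pi>"
  unfolding complexity_def cond_complexity_def by (rule Least_le) blast

text \<open>A program has only one output, so choosing a shortest program for each string is
  injective.\<close>

lemma card_complexity_le:
  assumes "universal_prefix_free U"
  shows "finite {\<sigma>. complexity U B \<sigma> \<le> l} \<and> card {\<sigma>. complexity U B \<sigma> \<le> l} \<le> 2 ^ (l + 1)"
proof -
  let ?P = "{\<pi> :: bool list. set \<pi> \<subseteq> UNIV \<and> length \<pi> \<le> l}"
  let ?S = "{\<sigma>. complexity U B \<sigma> \<le> l}"
  have "\<forall>\<sigma>. \<exists>\<pi>. length \<pi> = complexity U B \<sigma> \<and> computes U B \<pi> [] \<sigma>"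
    using complexity_program[OF assms] by blast
  then obtain g where g: "length (g \<sigma>) = complexity U B \<sigma>" "computes U B (g \<sigma>) [] \<sigma>" for \<sigma>
    by metis
  have inj: "inj_on g ?S"
  proof (rule inj_onI)
    fix a b assume "g a = g b"
    then show "a = b" using g(2)[of a] g(2)[of b] computes_unique by simp
  qed
  have sub: "g ` ?S \<subseteq> ?P" using g by auto
  have fin: "finite ?P" by (rule finite_lists_length_le) simp
  have "card ?P = (\<Sum>i\<le>l. 2 ^ i)" using card_lists_length_le[of "UNIV :: bool set" l] by simp
  also have "\<dots> \<le> 2 ^ (l + 1)" by (induction l) auto
  finally have "card ?P \<le> 2 ^ (l + 1)" .
  moreover have "card ?S \<le> card ?P" by (rule card_inj_on_le[OF inj sub fin])
  moreover have "finite ?S" using inj sub fin by (meson finite_imageD finite_subset)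
  ultimately show ?thesis by simp
qed

section \<open>Table lookup\<close>

text \<open>
  The odd cells of the oracle tape hold records \<open>flagged d @ flagged o\<close>, the even ones are skipped.
  The machine outputs \<open>o\<close> for the first record whose key \<open>d\<close> agrees with the program as far as the
  shorter of the two reaches, and halts only if the program equals \<open>d\<close>; hence it is prefix-free
  for every oracle. States 0, 2, 3, 5 compare, 6, 7, 8, 10 skip the rest of a key,
  9, 11, 12, 13 skip an output, 14 rewinds the program head, 4, 15, 16, 17 print, 18 is dead.
\<close>

definition table_core :: "nat \<Rightarrow> nat \<Rightarrow> nat \<Rightarrow> nat \<times> int \<times> int \<times> bool option" where
  "table_core s p q =
     (if s = 0 then (2, 0, 1, None)
      else if s = 2 then
        (if q = 2 then (3, 0, 1, None) else if p = 0 then (4, 0, 1, None) else (18, 0, 0, None))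
      else if s = 3 then (5, 0, 1, None)
      else if s = 5 then
        (if p = 0 then (18, 0, 0, None) else if p = q then (0, 1, 1, None) else (6, - 1, 1, None))
      else if s = 6 then (7, 0, 1, None)
      else if s = 7 then (if q = 2 then 8 else 9, 0, 1, None)
      else if s = 8 then (10, 0, 1, None)
      else if s = 10 then (6, 0, 1, None)
      else if s = 9 then (11, 0, 1, None)
      else if s = 11 then (if q = 2 then 12 else 14, 0, 1, None)
      else if s = 12 then (13, 0, 1, None)
      else if s = 13 then (9, 0, 1, None)
      else if s = 14 then (if p = 0 then (0, 1, 0, None) else (14, - 1, 0, None))
      else if s = 4 then (15, 0, 1, None)
      else if s = 15 then (if q = 2 then 16 else 1, 0, 1, None)
      else if s = 16 then (17, 0, 1, None)
      else if s = 17 then (4, 0, 1, Some (q = 2))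
      else (18, 0, 0, None))"

lemma otm_wf_table: "otm_wf (scanner 19 table_core)"
  by (rule otm_wf_scanner) (auto simp: table_core_def)

text \<open>The runs can differ only with the head just behind \<open>\<pi>\<close>. If the key goes
  on there, the blank kills the run on \<open>\<pi>\<close> in state 5; if the key ends there, the
  additional bit kills the run on \<open>\<pi> @ \<rho>\<close> in state 2. While skipping and
  rewinding, the head stays strictly before the end of \<open>\<pi>\<close>.\<close>

lemma prefix_free_table: "prefix_free (scanner 19 table_core)"
proof (rule prefix_free_scanner[where d = 18
      and I = "\<lambda>l (s, hp, hq, out). s \<in> {0, 2, 3, 5} \<and> 0 \<le> hp \<and> hp \<le> l \<or>
        s \<in> {6, 7, 8, 9, 10, 11, 12, 13, 14} \<and> - 1 \<le> hp \<and> hp < l"])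
  fix B and \<pi> \<rho> :: "bool list" and c :: scan_state
  let ?I = "\<lambda>l (s, hp, hq, out). s \<in> {0, 2, 3, 5} \<and> 0 \<le> hp \<and> hp \<le> l \<or>
        s \<in> {6, 7, 8, 9, 10, 11, 12, 13, 14 :: nat} \<and> - 1 \<le> hp \<and> hp < (l :: int)"
  assume I: "?I (int (length \<pi>)) c" and ne: "\<rho> \<noteq> ([] :: bool list)"
  obtain s hp hq out where c: "c = (s, hp, hq, out)" by (cases c)
  show "fst (scan_step table_core B \<pi> c) = 18 \<or> fst (scan_step table_core B (\<pi> @ \<rho>) c) = 18 \<or>
        scan_step table_core B \<pi> c = scan_step table_core B (\<pi> @ \<rho>) c \<and>
        ?I (int (length \<pi>)) (scan_step table_core B \<pi> c)"
  proof (cases "hp = int (length \<pi>)")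
    case True
    then show ?thesis using I string_tape_end[of \<pi>] string_tape_end(2)[OF ne, of \<pi>]
      by (auto simp: c scan_step_def table_core_def)
  next
    case False
    then have "string_tape (\<pi> @ \<rho>) hp = string_tape \<pi> hp"
      using I by (intro string_tape_append) (auto simp: c)
    moreover have "string_tape \<pi> hp = 0 \<longleftrightarrow> hp = - 1"
      using I False by (auto simp: c string_tape_def bit_symbol_neq)
    moreover have "hp < int (length \<pi>)" "- 1 \<le> hp"
      and "s \<in> {0, 2, 3, 5} \<Longrightarrow> 0 \<le> hp"
      using I False by (auto simp: c)
    moreover have "s = 0 \<or> s = 2 \<or> s = 3 \<or> s = 5 \<or> s = 6 \<or> s = 7 \<or> s = 8 \<or> s = 9 \<or> s = 10 \<or>
        s = 11 \<or> s = 12 \<or> s = 13 \<or> s = 14"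
      using I by (auto simp: c)
    ultimately show ?thesis
      by (elim disjE) (simp_all add: c scan_step_def table_core_def)
  qed
qed (auto simp: table_core_def)

section \<open>Runs of the table machine\<close>

definition reads :: "nat set \<Rightarrow> nat \<Rightarrow> bool list \<Rightarrow> bool" where
  "reads B m xs \<longleftrightarrow> (\<forall>k<length xs. 2 * (m + k) + 1 \<in> B \<longleftrightarrow> xs ! k)"

lemma reads_Nil: "reads B m []" by (simp add: reads_def)

lemma reads_Cons: "reads B m (x # xs) \<longleftrightarrow> (2 * m + 1 \<in> B \<longleftrightarrow> x) \<and> reads B (Suc m) xs"
  by (auto simp: reads_def nth_Cons split: nat.splits)

lemma reads_append: "reads B m (xs @ ys) \<longleftrightarrow> reads B m xs \<and> reads B (m + length xs) ys"
  by (induction xs arbitrary: m) (auto simp: reads_Nil reads_Cons)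

lemma oracle_tape_odd: "oracle_tape B (1 + 2 * int m) = bit_symbol (2 * m + 1 \<in> B)"
proof -
  have "nat (1 + 2 * int m) = 2 * m + 1" by linarith
  then show ?thesis by (simp add: oracle_tape_def)
qed

lemma oracle_tape_odd': "oracle_tape B (3 + 2 * int m) = bit_symbol (2 * Suc m + 1 \<in> B)"
  using oracle_tape_odd[of B "Suc m"] by (simp add: algebra_simps)

lemma scan_reachI: "(scan_step core B \<pi> ^^ t) c = c' \<Longrightarrow> scan_reach core B \<pi> c c'"
  unfolding scan_reach_def by blast

text \<open>The states 0, 4, 6 and 9 stand on the even cell in front of the odd cell to be read;
  thus the head position \<open>2 * int m\<close> belongs to entry \<open>m\<close> of the second
  component of a join.\<close>

lemma skip_key:
  "reads B m (flagged d) \<Longrightarrow> scan_reach table_core B \<pi> (6, hp, 2 * int m, out)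
     (9, hp, 2 * int (m + length (flagged d)), out)"
proof (induction d arbitrary: m)
  case Nil
  then have "(scan_step table_core B \<pi> ^^ Suc (Suc 0)) (6, hp, 2 * int m, out) =
      (9, hp, 2 * int (m + length (flagged [])), out)"
    by (simp add: flagged_simps reads_Cons scan_step_def table_core_def oracle_tape_odd
        bit_symbol_def add.commute)
  then show ?case by (rule scan_reachI)
next
  case (Cons b d)
  then have "(scan_step table_core B \<pi> ^^ Suc (Suc (Suc (Suc 0)))) (6, hp, 2 * int m, out) =
      (6, hp, 2 * int (Suc (Suc m)), out)"
    by (simp add: flagged_simps reads_Cons scan_step_def table_core_def oracle_tape_odd
        bit_symbol_def add.commute)
  from scan_reach_trans[OF scan_reachI[OF this] Cons.IH[of "Suc (Suc m)"]] Cons.prems show ?case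
    by (simp add: flagged_simps reads_Cons)
qed

lemma skip_output:
  "reads B m (flagged d) \<Longrightarrow> scan_reach table_core B \<pi> (9, hp, 2 * int m, out)
     (14, hp, 2 * int (m + length (flagged d)), out)"
proof (induction d arbitrary: m)
  case Nil
  then have "(scan_step table_core B \<pi> ^^ Suc (Suc 0)) (9, hp, 2 * int m, out) =
      (14, hp, 2 * int (m + length (flagged [])), out)"
    by (simp add: flagged_simps reads_Cons scan_step_def table_core_def oracle_tape_odd
        bit_symbol_def add.commute)
  then show ?case by (rule scan_reachI)
next
  case (Cons b d)
  then have "(scan_step table_core B \<pi> ^^ Suc (Suc (Suc (Suc 0)))) (9, hp, 2 * int m, out) =
      (9, hp, 2 * int (Suc (Suc m)), out)"
    by (simp add: flagged_simps reads_Cons scan_step_def table_core_def oracle_tape_odd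
        bit_symbol_def add.commute)
  from scan_reach_trans[OF scan_reachI[OF this] Cons.IH[of "Suc (Suc m)"]] Cons.prems show ?case
    by (simp add: flagged_simps reads_Cons)
qed

lemma print_output:
  "reads B m (flagged d) \<Longrightarrow> scan_reach table_core B \<pi> (4, hp, 2 * int m, out)
     (1, hp, 2 * int (m + length (flagged d)), out @ d)"
proof (induction d arbitrary: m out)
  case Nil
  then have "(scan_step table_core B \<pi> ^^ Suc (Suc 0)) (4, hp, 2 * int m, out) =
      (1, hp, 2 * int (m + length (flagged [])), out @ [])"
    by (simp add: flagged_simps reads_Cons scan_step_def table_core_def oracle_tape_odd
        bit_symbol_def add.commute)
  then show ?case by (rule scan_reachI)
next
  case (Cons b d)
  then have "(scan_step table_core B \<pi> ^^ Suc (Suc (Suc (Suc 0)))) (4, hp, 2 * int m, out) =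
      (4, hp, 2 * int (Suc (Suc m)), out @ [b])"
    by (simp add: flagged_simps reads_Cons scan_step_def table_core_def oracle_tape_odd
        oracle_tape_odd' bit_symbol_def add.commute)
  from scan_reach_trans[OF scan_reachI[OF this] Cons.IH[of "Suc (Suc m)" "out @ [b]"]] Cons.prems show ?case
    by (simp add: flagged_simps reads_Cons)
qed

text \<open>The position may be -1: the blank to the left of the program is where the head turns
  round.\<close>

lemma rewind_program:
  "n \<le> length \<pi> \<Longrightarrow> scan_reach table_core B \<pi> (14, int n - 1, hq, out) (0, 0, hq, out)"
proof (induction n)
  case 0
  then have "(scan_step table_core B \<pi> ^^ Suc 0) (14, int 0 - 1, hq, out) = (0, 0, hq, out)"
    by (simp add: scan_step_def table_core_def string_tape_def)
  then show ?case by (rule scan_reachI)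
next
  case (Suc n)
  then have "(scan_step table_core B \<pi> ^^ Suc 0) (14, int (Suc n) - 1, hq, out) =
      (14, int n - 1, hq, out)"
    by (simp add: scan_step_def table_core_def string_tape_def bit_symbol_neq)
  from scan_reach_trans[OF scan_reachI[OF this] Suc.IH] Suc.prems show ?case by simp
qed

lemma match_key:
  "reads B m (flagged v) \<Longrightarrow>
     scan_reach table_core B (u @ v) (0, int (length u), 2 * int m, out)
       (4, int (length (u @ v)), 2 * int (m + length (flagged v)), out)"
proof (induction v arbitrary: u m)
  case Nil
  then have "(scan_step table_core B (u @ []) ^^ Suc (Suc 0)) (0, int (length u), 2 * int m, out) =
      (4, int (length (u @ [])), 2 * int (m + length (flagged [])), out)"
    by (simp add: flagged_simps reads_Cons scan_step_def table_core_def oracle_tape_odd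
        bit_symbol_def add.commute string_tape_end)
  then show ?case by (rule scan_reachI)
next
  case (Cons b v)
  then have "(scan_step table_core B (u @ b # v) ^^ Suc (Suc (Suc (Suc 0))))
        (0, int (length u), 2 * int m, out) =
      (0, int (length (u @ [b])), 2 * int (Suc (Suc m)), out)"
    by (simp add: flagged_simps reads_Cons scan_step_def table_core_def oracle_tape_odd
        oracle_tape_odd' bit_symbol_def add.commute string_tape_at)
  from scan_reach_trans[OF scan_reachI[OF this] Cons.IH[of "Suc (Suc m)" "u @ [b]",
        unfolded append_assoc append_Cons append_Nil]] Cons.prems show ?case
    by (simp add: flagged_simps reads_Cons)
qed

definition incomparable :: "bool list \<Rightarrow> bool list \<Rightarrow> bool" where
  "incomparable u v \<longleftrightarrow> (\<nexists>w. v = u @ w) \<and> (\<nexists>w. u = v @ w)"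

lemma incomparable_Cons:
  "incomparable (a # u) (b # v) \<longleftrightarrow> a \<noteq> b \<or> incomparable u v"
  by (auto simp: incomparable_def)

lemma incomparable_Nil: "\<not> incomparable [] v" "\<not> incomparable v []"
  by (auto simp: incomparable_def)

text \<open>Incomparable strings differ in a bit before either of them ends, so the comparison
  leaves for the skipping states without meeting the end of program or key. In the induction,
  \<open>u\<close> is the part of the program already matched.\<close>

lemma mismatch_key:
  "reads B m (flagged d @ flagged e) \<Longrightarrow> incomparable v d \<Longrightarrow>
     scan_reach table_core B (u @ v) (0, int (length u), 2 * int m, out)
       (0, 0, 2 * int (m + length (flagged d @ flagged e)), out)"
proof (induction v arbitrary: u m d)
  case Nil
  then show ?case by (simp add: incomparable_Nil)
next
  case (Cons b v)
  then obtain a d' where d: "d = a # d'" by (cases d) (auto simp: incomparable_Nil)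
  show ?case
  proof (cases "a = b")
    case True
    then have 1: "(scan_step table_core B (u @ b # v) ^^ Suc (Suc (Suc (Suc 0))))
          (0, int (length u), 2 * int m, out) =
        (0, int (length (u @ [b])), 2 * int (Suc (Suc m)), out)"
      using Cons.prems(1)
      by (simp add: d flagged_simps reads_Cons scan_step_def table_core_def oracle_tape_odd
          oracle_tape_odd' bit_symbol_def add.commute string_tape_at)
    have "incomparable v d'" using True Cons.prems(2) by (simp add: d incomparable_Cons)
    with scan_reach_trans[OF scan_reachI[OF 1] Cons.IH[of "Suc (Suc m)" d' "u @ [b]",
        unfolded append_assoc append_Cons append_Nil]] Cons.prems(1)
    show ?thesis by (simp add: d flagged_simps reads_Cons)
  next
    case False
    then have 1: "(scan_step table_core B (u @ b # v) ^^ Suc (Suc (Suc (Suc 0))))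
          (0, int (length u), 2 * int m, out) =
        (6, int (length u) - 1, 2 * int (Suc (Suc m)), out)"
      using Cons.prems(1)
      by (simp add: d flagged_simps reads_Cons scan_step_def table_core_def oracle_tape_odd
          oracle_tape_odd' bit_symbol_def add.commute string_tape_at)
    have 2: "reads B (Suc (Suc m)) (flagged d')"
      and 3: "reads B (Suc (Suc m) + length (flagged d')) (flagged e)"
      using Cons.prems(1) by (simp_all add: d flagged_simps reads_Cons reads_append)
    show ?thesis
      using scan_reach_trans[OF scan_reach_trans[OF scan_reach_trans[OF scan_reachI[OF 1]
          skip_key[OF 2]] skip_output[OF 3]] rewind_program[of "length u" "u @ b # v"]]
      by (simp add: d flagged_simps algebra_simps)
  qed
qed

text \<open>Each earlier record mismatches and moves the oracle head to the next record.
  Incomparability is asked only of earlier records, so an enumeration may repeat records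
  later.\<close>

lemma table_run:
  fixes e :: "nat \<Rightarrow> bool list \<times> bool list"
  defines "rec \<equiv> \<lambda>k. flagged (fst (e k)) @ flagged (snd (e k))"
  assumes reads: "\<And>k. reads B (\<Sum>j<k. length (rec j)) (rec k)"
    and inc: "\<And>j. j < k \<Longrightarrow> incomparable (fst (e k)) (fst (e j))"
  shows "computes (scanner 19 table_core) B (fst (e k)) \<tau> (snd (e k))"
proof -
  let ?\<pi> = "fst (e k)"
  have "scan_reach table_core B ?\<pi> (0, 0, 0, []) (0, 0, 2 * int (\<Sum>j<i. length (rec j)), [])"
    if "i \<le> k" for i
    using that
  proof (induction i)
    case 0
    then show ?case by (simp add: scan_reach_refl)
  next
    case (Suc i)
    have "scan_reach table_core B ?\<pi> (0, 0, 2 * int (\<Sum>j<i. length (rec j)), [])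
        (0, 0, 2 * int (\<Sum>j<Suc i. length (rec j)), [])"
      using mismatch_key[of B "\<Sum>j<i. length (rec j)" "fst (e i)" "snd (e i)" ?\<pi> "[]" "[]"]
        reads[of i] inc[of i] Suc.prems
      by (simp add: rec_def)
    from scan_reach_trans[OF Suc.IH this] Suc.prems show ?case by simp
  qed
  note 1 = this[OF order_refl]
  have 2: "reads B (\<Sum>j<k. length (rec j)) (flagged ?\<pi>)"
    and 3: "reads B ((\<Sum>j<k. length (rec j)) + length (flagged ?\<pi>)) (flagged (snd (e k)))"
    using reads[of k] by (simp_all add: rec_def reads_append)
  have "scan_reach table_core B ?\<pi> (0, 0, 2 * int (\<Sum>j<k. length (rec j)), [])
      (4, int (length ?\<pi>), 2 * int ((\<Sum>j<k. length (rec j)) + length (flagged ?\<pi>)), [])"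
    using match_key[OF 2, of "[]" "[]"] by simp
  from scan_reach_trans[OF scan_reach_trans[OF 1 this] print_output[OF 3]]
  show ?thesis unfolding computes_scanner_iff by auto
qed

section \<open>Tables of finite sets as oracles, and codes of indices and rational vectors\<close>

lemma flagged_append_eq:
  "flagged x @ u = flagged y @ v \<longleftrightarrow> x = y \<and> u = v"
proof (induction x arbitrary: y)
  case Nil
  then show ?case by (cases y) (auto simp: flagged_simps)
next
  case (Cons a x)
  then show ?case by (cases y) (auto simp: flagged_simps)
qed

lemma length_flagged: "length (flagged x) = 2 * length x + 1"
  by (induction x) (auto simp: flagged_simps)

lemma length_string_of_nat: "2 ^ length (string_of_nat i) \<le> i + 1"
proof (induction i rule: less_induct)
  case (less i)
  show ?case
  proof (cases i)
    case (Suc m)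
    then have "2 ^ length (string_of_nat (m div 2)) \<le> m div 2 + 1" using less[of "m div 2"] by simp
    then have "2 * 2 ^ length (string_of_nat (m div 2)) \<le> 2 * (m div 2 + 1)" by simp
    also have "\<dots> \<le> m + 2" by simp
    finally show ?thesis using Suc by simp
  qed simp
qed

lemma string_of_nat_inj: "string_of_nat i = string_of_nat j \<longleftrightarrow> i = j"
proof (induction i arbitrary: j rule: less_induct)
  case (less i)
  show ?case
  proof (cases i; cases j)
    fix m n assume mn: "i = Suc m" "j = Suc n"
    have "m = n \<longleftrightarrow> m div 2 = n div 2 \<and> odd m = odd n"
      by (metis dvd_mult_div_cancel odd_two_times_div_two_succ)
    then show ?thesis using less[of "m div 2" "n div 2"] mn by auto
  qed simp_all
qed

lemma oracle_join_odd: "2 * m + 1 \<in> oracle_join A B \<longleftrightarrow> m \<in> B"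
  by (auto simp: oracle_join_def) presburger

text \<open>\<open>B\<close> is the concatenation of all records. No computability is required of
  it, so any sequence of records is admissible.\<close>

lemma reads_layout:
  fixes rec :: "nat \<Rightarrow> bool list"
  shows "\<exists>B. \<forall>k. reads (oracle_join A B) (\<Sum>j<k. length (rec j)) (rec k)"
proof -
  define off where "off k = (\<Sum>j<k. length (rec j))" for k
  define B where "B = {m. \<exists>k i. m = off k + i \<and> i < length (rec k) \<and> rec k ! i}"
  have mono: "off k + length (rec k) \<le> off k'" if "k < k'" for k k'
    using that
  proof (induction k')
    case (Suc k')
    then show ?case by (cases "k = k'") (auto simp: off_def)
  qed simp
  have "off k + i \<in> B \<longleftrightarrow> rec k ! i" if "i < length (rec k)" for k i
  proof -
    have "k = k' \<and> i = i'" if "off k + i = off k' + i'" "i' < length (rec k')" for k' i'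
      using that \<open>i < length (rec k)\<close> mono[of k k'] mono[of k' k]
      by (cases k k' rule: linorder_cases) auto
    then show ?thesis using that by (auto simp: B_def)
  qed
  then have "\<forall>k. reads (oracle_join A B) (off k) (rec k)"
    unfolding reads_def oracle_join_odd by blast
  then show ?thesis unfolding off_def by blast
qed

text \<open>The key of \<open>s\<close> in \<open>L i\<close> is the self-delimiting index
  \<open>i\<close> followed by a number of fixed length \<open>w i\<close>, about
  \<open>log 2\<close> of the cardinality. Keys with different indices differ inside the index, keys
  with the same index have equal length, so distinct keys are incomparable. The constant
  \<open>c\<close> pays for simulating the table machine on \<open>U\<close>, the end flag of the
  index and rounding up.\<close>

lemma table_oracle:
  fixes L :: "nat \<Rightarrow> bool list set"
  assumes U: "universal_prefix_free U" and fin: "\<And>i. finite (L i)"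
  shows "\<exists>B c. \<forall>i. \<forall>s\<in>L i. real (complexity U (oracle_join A B) s) \<le>
    log 2 (real (card (L i))) + 2 * log 2 (real i + 1) + c"
proof (cases "\<exists>i. L i \<noteq> {}")
  case ne: True
  define w where "w i = nat \<lceil>log 2 (real (card (L i)))\<rceil>" for i
  have "\<exists>g. inj_on g (L i) \<and> g ` L i \<subseteq> {v :: bool list. length v = w i}" for i
  proof (cases "L i = {}")
    case False
    have "card {v :: bool list. length v = w i} = 2 ^ w i"
      using card_lists_length_eq[of "UNIV :: bool set" "w i"] by simp
    moreover have "real (card (L i)) \<le> 2 ^ w i"
    proof -
      have "0 < real (card (L i))" using False fin by (simp add: card_gt_0_iff)
      then have "real (card (L i)) = 2 powr log 2 (real (card (L i)))" by simp
      also have "\<dots> \<le> 2 powr real (w i)" by (rule powr_mono) (auto simp: w_def real_nat_ceiling_ge)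
      finally show ?thesis by (simp add: powr_realpow)
    qed
    moreover have "finite {v :: bool list. length v = w i}"
      using finite_lists_length_eq[of "UNIV :: bool set" "w i"] by simp
    ultimately show ?thesis using fin by (metis card_le_inj of_nat_le_iff of_nat_numeral of_nat_power)
  qed simp
  then obtain g :: "nat \<Rightarrow> bool list \<Rightarrow> bool list"
    where g: "\<And>i. inj_on (g i) (L i)" "\<And>i s. s \<in> L i \<Longrightarrow> length (g i s) = w i"
    by (metis (mono_tags, lifting) image_subset_iff mem_Collect_eq)
  define key where "key i s = flagged (string_of_nat i) @ g i s" for i s
  define P where "P = (SIGMA i:UNIV. L i)"
  have P: "P \<noteq> {}" "countable P"
    using ne by (auto simp: P_def intro!: countable_SIGMA countable_finite fin)
  define e where "e k = (case from_nat_into P k of (i, s) \<Rightarrow> (key i s, s))" for k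
  have incomp: "incomparable (key i s) (key j s')"
    if "s \<in> L i" "s' \<in> L j" "(i, s) \<noteq> (j, s')" for i j s s'
    using that g(1)[of i] g(2)[of s i] g(2)[of s' j]
    unfolding incomparable_def key_def
    by (auto simp: flagged_append_eq string_of_nat_inj inj_on_eq_iff)
  obtain B where B: "\<And>k. reads (oracle_join A B)
      (\<Sum>j<k. length (flagged (fst (e j)) @ flagged (snd (e j))))
      (flagged (fst (e k)) @ flagged (snd (e k)))"
    using reads_layout[of A "\<lambda>k. flagged (fst (e k)) @ flagged (snd (e k))"] by blast
  obtain \<rho> where \<rho>: "\<And>B \<pi> \<tau> \<sigma>. computes U B (\<rho> @ \<pi>) \<tau> \<sigma> \<longleftrightarrow>
      computes (scanner 19 table_core) B \<pi> \<tau> \<sigma>"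
    using U otm_wf_table prefix_free_table unfolding universal_prefix_free_def by blast
  have "real (complexity U (oracle_join A B) s) \<le>
      log 2 (real (card (L i))) + 2 * log 2 (real i + 1) + (real (length \<rho>) + 2)"
    if s: "s \<in> L i" for i s
  proof -
    have "(i, s) \<in> range (from_nat_into P)"
      using s unfolding range_from_nat_into[OF P] by (simp add: P_def)
    then obtain k0 where k0: "from_nat_into P k0 = (i, s)" by auto
    \<comment> \<open>\<open>from_nat_into\<close> may hit a pair repeatedly; at the first
      occurrence all earlier keys are different.\<close>
    define k where "k = (LEAST k. from_nat_into P k = (i, s))"
    have k: "from_nat_into P k = (i, s)" unfolding k_def by (rule LeastI[of _ k0]) (rule k0)
    have "incomparable (fst (e k)) (fst (e j))" if "j < k" for j
    proof -
      have ne: "from_nat_into P j \<noteq> (i, s)" using that unfolding k_def by (rule not_less_Least)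
      obtain j' s' where j': "from_nat_into P j = (j', s')" by (cases "from_nat_into P j")
      then have "s' \<in> L j'" using from_nat_into[OF P(1), of j] by (simp add: P_def)
      then show ?thesis using incomp[of s i s' j'] s ne j' by (auto simp: e_def k)
    qed
    then have "computes (scanner 19 table_core) (oracle_join A B) (fst (e k)) [] (snd (e k))"
      using table_run[of "oracle_join A B" e k] B by blast
    then have "computes U (oracle_join A B) (\<rho> @ key i s) [] s"
      by (simp add: \<rho> e_def k)
    then have "complexity U (oracle_join A B) s \<le> length (\<rho> @ key i s)" by (rule complexity_le)
    also have "\<dots> = length \<rho> + 2 * length (string_of_nat i) + 1 + w i"
      by (simp add: key_def length_flagged g(2)[OF s])
    finally have 1: "real (complexity U (oracle_join A B) s) \<le>
        real (length \<rho> + 2 * length (string_of_nat i) + 1 + w i)" by (rule of_nat_mono)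
    have "1 \<le> card (L i)" using s fin card_gt_0_iff[of "L i"] by (auto simp: Suc_le_eq)
    then have "0 \<le> log 2 (real (card (L i)))" by simp
    then have 2: "real (w i) \<le> log 2 (real (card (L i))) + 1" unfolding w_def by linarith
    have "(2::real) ^ length (string_of_nat i) \<le> real i + 1"
      using of_nat_mono[OF length_string_of_nat[of i], where 'a = real] by (simp add: add.commute)
    then have 3: "real (length (string_of_nat i)) \<le> log 2 (real i + 1)"
      by (simp add: le_log_iff powr_realpow)
    show ?thesis using 1 2 3 by simp
  qed
  then show ?thesis by blast
qed auto

text \<open>The pairing function is bounded by a square. Nested pairing starting from exponent 1
  thus gives the exponents 4, 10, 22 and 46.\<close>

lemma prod_encode_bound:
  assumes "x + 1 \<le> M ^ i" "y + 1 \<le> M ^ i" "2 \<le> M"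
  shows "prod_encode (x, y) + 1 \<le> M ^ (2 * i + 2)"
proof -
  have "x + y + 1 \<le> 2 * M ^ i" using assms by linarith
  also have "\<dots> \<le> M * M ^ i" using assms(3) by simp
  finally have le: "x + y + 1 \<le> M ^ (i + 1)" by simp
  have "triangle n \<le> n * n" for n by (induction n) auto
  then have "prod_encode (x, y) + 1 \<le> (x + y) * (x + y) + x + 1"
    by (simp add: prod_encode_def)
  also have "\<dots> \<le> (x + y + 1) * (x + y + 1)" by (simp add: algebra_simps)
  also have "\<dots> \<le> M ^ (i + 1) * M ^ (i + 1)"
    by (intro mult_le_mono le)
  also have "\<dots> = M ^ (2 * i + 2)" by (simp flip: power_add add: mult_2)
  finally show ?thesis .
qed

lemma vec_code_inj: "inj (vec_code :: rat ^ 'n \<Rightarrow> bool list)"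
proof (rule injI)
  fix p q :: "rat ^ 'n"
  assume "vec_code p = vec_code q"
  then have eq: "map (\<lambda>i. rat_code (p $ from_nat_into (UNIV :: 'n set) i)) [0..<CARD('n)] =
      map (\<lambda>i. rat_code (q $ from_nat_into (UNIV :: 'n set) i)) [0..<CARD('n)]"
    by (simp only: vec_code_def string_of_nat_inj list_encode_eq)
  \<comment> \<open>Denominators are positive, so \<open>nat\<close> loses no information about
    them.\<close>
  have rat_code_inj: "a = b" if "rat_code a = rat_code b" for a b
  proof -
    obtain a1 a2 where a: "quotient_of a = (a1, a2)" by (cases "quotient_of a")
    obtain b1 b2 where b: "quotient_of b = (b1, b2)" by (cases "quotient_of b")
    have "a1 = b1" "nat a2 = nat b2" using that by (auto simp: rat_code_def a b int_encode_eq)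
    moreover have "0 < a2" "0 < b2" using quotient_of_denom_pos a b by blast+
    ultimately show ?thesis using a b quotient_of_inject by fastforce
  qed
  show "p = q"
  proof (rule vec_eq_iff[THEN iffD2], rule allI)
    fix x :: 'n
    have "x \<in> from_nat_into UNIV ` {..<CARD('n)}"
      using bij_betw_from_nat_into_finite[of "UNIV :: 'n set"] by (simp add: bij_betw_def)
    then obtain i where "i < CARD('n)" "x = from_nat_into UNIV i" by auto
    then show "p $ x = q $ x" using eq rat_code_inj by (auto simp: map_eq_conv)
  qed
qed

text \<open>
  An index made of five numbers at most \<open>N\<close> is at most \<open>(N + 2) ^ 46\<close>, and the self-delimiting code of
  an index costs twice its length, hence the constant 92.
\<close>

lemma table_oracle_vec:
  fixes L :: "nat \<Rightarrow> nat \<Rightarrow> nat \<Rightarrow> nat \<Rightarrow> nat \<Rightarrow> (rat ^ 'n) set"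
  assumes U: "universal_prefix_free U" and fin: "\<And>f a b d e. finite (L f a b d e)"
  obtains B c where "\<And>f a b d e N p. p \<in> L f a b d e \<Longrightarrow>
    f \<le> N \<Longrightarrow> a \<le> N \<Longrightarrow> b \<le> N \<Longrightarrow> d \<le> N \<Longrightarrow> e \<le> N \<Longrightarrow>
    real (complexity U (oracle_join A B) (vec_code p)) \<le>
      log 2 (real (card (L f a b d e))) + 92 * log 2 (real N + 2) + c"
proof -
  define L' where "L' i = (case prod_decode i of (f, i) \<Rightarrow> case prod_decode i of (a, i) \<Rightarrow>
      case prod_decode i of (b, i) \<Rightarrow> case prod_decode i of (d, e) \<Rightarrow>
      vec_code ` L f a b d e)" for i
  have "finite (L' i)" for i by (auto simp: L'_def fin split: prod.splits)
  from table_oracle[where L = L', OF U this] obtain B c where Bc: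
    "\<And>i s. s \<in> L' i \<Longrightarrow> real (complexity U (oracle_join A B) s) \<le>
       log 2 (real (card (L' i))) + 2 * log 2 (real i + 1) + c" by metis
  show ?thesis
  proof (rule that[of B c])
    fix f a b d e N p
    assume p: "p \<in> L f a b d e" and N: "f \<le> N" "a \<le> N" "b \<le> N" "d \<le> N" "e \<le> N"
    define i where "i = prod_encode (f, prod_encode (a, prod_encode (b, prod_encode (d, e))))"
    have L': "L' i = vec_code ` L f a b d e" by (simp add: L'_def i_def)
    have pow: "x + 1 \<le> (N + 2) ^ k" if "x \<le> N" "1 \<le> k" for x k
    proof -
      have "x + 1 \<le> (N + 2) ^ 1" using that by simp
      also have "\<dots> \<le> (N + 2) ^ k" using that by (intro power_increasing) auto
      finally show ?thesis .
    qed
    have "prod_encode (d, e) + 1 \<le> (N + 2) ^ 4"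
      using prod_encode_bound[of d "N + 2" 1 e] pow[of _ 1] N by simp
    then have "prod_encode (b, prod_encode (d, e)) + 1 \<le> (N + 2) ^ 10"
      using prod_encode_bound[of b "N + 2" 4 "prod_encode (d, e)"] pow[of _ 4] N by simp
    then have "prod_encode (a, prod_encode (b, prod_encode (d, e))) + 1 \<le> (N + 2) ^ 22"
      using prod_encode_bound[of a "N + 2" 10 "prod_encode (b, prod_encode (d, e))"] pow[of _ 10] N
      by simp
    then have "i + 1 \<le> (N + 2) ^ 46"
      using prod_encode_bound[of f "N + 2" 22 "prod_encode (a, prod_encode (b, prod_encode (d, e)))"]
        pow[of _ 22] N by (simp add: i_def)
    then have "real (i + 1) \<le> real ((N + 2) ^ 46)" by (rule of_nat_mono)
    then have "real i + 1 \<le> (real N + 2) ^ 46" by (simp add: add.commute)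
    then have "log 2 (real i + 1) \<le> log 2 ((real N + 2) ^ 46)" by simp
    also have "\<dots> = 46 * log 2 (real N + 2)" by (simp add: log_nat_power)
    finally have "2 * log 2 (real i + 1) \<le> 92 * log 2 (real N + 2)" by simp
    moreover have "card (L' i) = card (L f a b d e)"
      unfolding L' using vec_code_inj by (metis card_image inj_on_subset subset_UNIV)
    moreover have "vec_code p \<in> L' i" using p by (simp add: L')
    ultimately show "real (complexity U (oracle_join A B) (vec_code p)) \<le>
        log 2 (real (card (L f a b d e))) + 92 * log 2 (real N + 2) + c"
      using Bc[of "vec_code p" i] by simp
  qed
qed

section \<open>Orthogonal projections\<close>

lemma orth_proj_eqI:
  assumes "subspace V" "y \<in> V" "\<And>v. v \<in> V \<Longrightarrow> orthogonal (x - y) v"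
  shows "orth_proj V x = y"
  unfolding orth_proj_def
proof (rule the_equality)
  fix z assume z: "z \<in> V \<and> (\<forall>v\<in>V. orthogonal (x - z) v)"
  have "z - y \<in> V" using assms z by (simp add: subspace_diff)
  then have "(x - y) \<bullet> (z - y) = 0" "(x - z) \<bullet> (z - y) = 0"
    using assms z by (auto simp: orthogonal_def)
  then have "(z - y) \<bullet> (z - y) = 0" by (simp add: inner_diff_left)
  then show "z = y" by simp
qed (use assms in auto)

lemma orth_proj:
  assumes "subspace V"
  shows orth_proj_in: "orth_proj V x \<in> V"
    and orthogonal_orth_proj: "v \<in> V \<Longrightarrow> orthogonal (x - orth_proj V x) v"
proof -
  obtain y z where yz: "y \<in> span V" "\<And>w. w \<in> span V \<Longrightarrow> orthogonal z w" "x = y + z"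
    using orthogonal_subspace_decomp_exists by metis
  have "span V = V" using assms by (simp add: span_eq_iff)
  with yz have y: "y \<in> V" "\<And>v. v \<in> V \<Longrightarrow> orthogonal (x - y) v" by auto
  from orth_proj_eqI[OF assms this] have "orth_proj V x = y" .
  with y show "orth_proj V x \<in> V" "v \<in> V \<Longrightarrow> orthogonal (x - orth_proj V x) v" by auto
qed

lemma linear_orth_proj:
  assumes "subspace V"
  shows "linear (orth_proj V)"
proof (rule linearI)
  fix x y c
  show "orth_proj V (x + y) = orth_proj V x + orth_proj V y"
  proof (rule orth_proj_eqI[OF assms])
    show "orthogonal (x + y - (orth_proj V x + orth_proj V y)) v" if "v \<in> V" for v
      using orthogonal_orth_proj[OF assms that, of x] orthogonal_orth_proj[OF assms that, of y]
      by (simp add: orthogonal_def inner_diff_left inner_add_left)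
  qed (intro subspace_add orth_proj_in assms)
  show "orth_proj V (c *\<^sub>R x) = c *\<^sub>R orth_proj V x"
  proof (rule orth_proj_eqI[OF assms])
    show "orthogonal (c *\<^sub>R x - c *\<^sub>R orth_proj V x) v" if "v \<in> V" for v
      using orthogonal_orth_proj[OF assms that, of x]
      by (simp add: orthogonal_def inner_diff_left inner_diff_right flip: scaleR_diff_right)
  qed (intro subspace_scale orth_proj_in assms)
qed

lemma norm_orth_proj_Pythagoras:
  assumes "subspace V"
  shows "(norm x)\<^sup>2 = (norm (orth_proj V x))\<^sup>2 + (norm (x - orth_proj V x))\<^sup>2"
proof -
  have "orthogonal (orth_proj V x) (x - orth_proj V x)"
    using orthogonal_orth_proj[OF assms orth_proj_in[OF assms]] by (simp add: orthogonal_commute)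
  from norm_add_Pythagorean[OF this] show ?thesis by simp
qed

lemma norm_orth_proj_le:
  assumes "subspace V"
  shows "norm (orth_proj V x) \<le> norm x"
  using norm_orth_proj_Pythagoras[OF assms, of x]
  by (metis le_add_same_cancel1 norm_ge_zero power2_le_imp_le zero_le_power2)

lemma dist_orth_proj_le:
  assumes "subspace V"
  shows "dist (orth_proj V x) (orth_proj V y) \<le> dist x y"
  using norm_orth_proj_le[OF assms, of "x - y"] linear_orth_proj[OF assms]
  by (simp add: dist_norm linear_diff)

lemma orth_proj_image:
  assumes "subspace V" "orthogonal_transformation f"
  shows "orth_proj (f ` V) (f x) = f (orth_proj V x)"
proof (rule orth_proj_eqI)
  have lin: "linear f" using assms by (simp add: orthogonal_transformation_linear)
  show "subspace (f ` V)" using assms lin by (simp add: linear_subspace_image)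
  show "f (orth_proj V x) \<in> f ` V" using orth_proj_in[OF assms(1)] by blast
  fix v assume "v \<in> f ` V"
  then show "orthogonal (f x - f (orth_proj V x)) v"
    using orthogonal_orth_proj[OF assms(1), of _ x] assms(2) lin
    by (auto simp: orthogonal_def orthogonal_transformation_def simp flip: linear_diff)
qed

section \<open>Coverings of balls and the volume of slabs\<close>

lemma subspace_ball_cover:
  fixes S :: "'a :: euclidean_space set" and N :: nat
  assumes S: "subspace S" and N: "0 < N"
  obtains Z where "finite Z" "Z \<subseteq> S" "card Z \<le> N ^ dim S"
    "\<And>x. x \<in> S \<Longrightarrow> norm x \<le> 1 \<Longrightarrow> \<exists>z\<in>Z. norm (x - z) \<le> 2 * DIM('a) / N"
proof -
  \<comment> \<open>A coordinate subspace \<open>W\<close> with free coordinates \<open>D\<close> is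
    isometric to \<open>S\<close>. A grid in its cube has only \<open>N ^ dim S\<close> points;
    coordinate errors of \<open>2 / N\<close> add up to the stated radius by the bound of the norm
    by the l1-norm.\<close>
  obtain D :: "'a set" where D: "D \<subseteq> Basis" "card D = dim S"
    by (metis obtain_subset_with_card_n dim_subset_UNIV)
  have finD: "finite D" using D finite_Basis finite_subset by blast
  define W where "W = {x :: 'a. \<forall>i\<in>Basis. i \<notin> D \<longrightarrow> x \<bullet> i = 0}"
  have W: "subspace W" "dim W = dim S"
    using dim_substandard[OF D(1)] D(2) by (auto simp: W_def subspace_def inner_add_left)
  obtain g where g: "linear g" "g ` W = S" "\<And>x. x \<in> W \<Longrightarrow> norm (g x) = norm x"
    by (rule isometry_subspaces[OF W(1) S W(2)]) blast
  define c where "c a = (\<Sum>b\<in>D. (2 * real (a b) / N - 1) *\<^sub>R b)" for a :: "'a \<Rightarrow> nat"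
  have inner_c: "c a \<bullet> i = (if i \<in> D then 2 * real (a i) / N - 1 else 0)" if "i \<in> Basis" for a i
  proof -
    have "c a \<bullet> i = (\<Sum>b\<in>D. (2 * real (a b) / N - 1) * (if b = i then 1 else 0))"
      using D that by (auto simp: c_def inner_sum_left inner_Basis intro!: sum.cong)
    also have "\<dots> = (\<Sum>b\<in>D. if b = i then 2 * real (a b) / N - 1 else 0)"
      by (intro sum.cong) auto
    finally show ?thesis using finD by simp
  qed
  then have c_W: "c a \<in> W" for a by (auto simp: W_def)
  define A where "A = (D \<rightarrow>\<^sub>E {..<N})"
  have finA: "finite A" using finD by (simp add: A_def finite_PiE)
  have cardA: "card A = N ^ dim S" using finD D(2) by (simp add: A_def card_PiE)
  show ?thesis
  proof (rule that[of "g ` c ` A"])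
    show "finite (g ` c ` A)" using finA by simp
    show "g ` c ` A \<subseteq> S" using c_W g(2) by auto
    show "card (g ` c ` A) \<le> N ^ dim S"
      unfolding cardA[symmetric] image_image by (rule card_image_le[OF finA])
    fix x assume x: "x \<in> S" "norm x \<le> 1"
    then obtain w where w: "w \<in> W" "x = g w" using g(2) by blast
    then have "norm w \<le> 1" using g(3) x by metis
    \<comment> \<open>The minimum treats the right endpoint: coordinate 1 would give the index
      \<open>N\<close>, outside the grid.\<close>
    define a where "a = (\<lambda>b\<in>D. min (N - 1) (nat \<lfloor>N * (w \<bullet> b + 1) / 2\<rfloor>))"
    have "a \<in> A" using N by (auto simp: a_def A_def)
    have le: "\<bar>(w - c a) \<bullet> i\<bar> \<le> 2 / N" if i: "i \<in> Basis" for i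
    proof (cases "i \<in> D")
      case True
      have wi: "\<bar>w \<bullet> i\<bar> \<le> 1" using Basis_le_norm[OF i, of w] \<open>norm w \<le> 1\<close> by linarith
      define t where "t = N * (w \<bullet> i + 1) / 2"
      have t0: "0 \<le> t" using wi by (simp add: t_def)
      have "real N * (w \<bullet> i + 1) \<le> real N * 2" using wi by (intro mult_left_mono) auto
      then have t1: "t \<le> N" by (simp add: t_def)
      have f: "real (nat \<lfloor>t\<rfloor>) \<le> t" "t \<le> real (nat \<lfloor>t\<rfloor>) + 1" using t0 by linarith+
      then have "\<bar>t - real (a i)\<bar> \<le> 1"
      proof -
        have "real (a i) = min (real N - 1) (real (nat \<lfloor>t\<rfloor>))"
          using True N by (simp add: a_def t_def[symmetric] of_nat_diff min_def) (simp add: le_diff_conv)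
        then show ?thesis using f t1 by linarith
      qed
      moreover have "(w - c a) \<bullet> i = 2 / N * (t - real (a i))"
        using i True N by (simp add: inner_diff_left inner_c t_def field_simps)
      ultimately show ?thesis by (simp add: abs_mult divide_right_mono)
    next
      case False
      then show ?thesis using i w(1) by (simp add: inner_diff_left inner_c W_def)
    qed
    have "norm (x - g (c a)) = norm (g (w - c a))" using g(1) w by (simp add: linear_diff)
    also have "\<dots> = norm (w - c a)" using W(1) c_W w(1) by (intro g(3) subspace_diff) auto
    also have "\<dots> \<le> (\<Sum>i\<in>Basis. \<bar>(w - c a) \<bullet> i\<bar>)" by (rule norm_le_l1)
    also have "\<dots> \<le> (\<Sum>i\<in>(Basis :: 'a set). 2 / N)" by (intro sum_mono le)
    also have "\<dots> = 2 * DIM('a) / N" by simp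
    finally show "\<exists>z\<in>g ` c ` A. norm (x - z) \<le> 2 * DIM('a) / N" using \<open>a \<in> A\<close> by auto
  qed
qed

lemma emeasure_cball_le:
  fixes c :: "'a :: euclidean_space"
  assumes "0 \<le> \<rho>"
  shows "emeasure lborel (cball c \<rho>) \<le> ennreal ((2 * \<rho>) ^ DIM('a))"
proof -
  let ?l = "c - \<rho> *\<^sub>R One" and ?u = "c + \<rho> *\<^sub>R One"
  have "cball c \<rho> \<subseteq> cbox ?l ?u"
  proof
    fix x assume "x \<in> cball c \<rho>"
    then have "\<bar>(c - x) \<bullet> i\<bar> \<le> \<rho>" if "i \<in> Basis" for i
      using Basis_le_norm[OF that, of "c - x"] by (simp add: dist_norm)
    then show "x \<in> cbox ?l ?u"
      by (fastforce simp: mem_box inner_diff_left inner_add_left abs_le_iff)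
  qed
  then have "emeasure lborel (cball c \<rho>) \<le> emeasure lborel (cbox ?l ?u)"
    by (intro emeasure_mono) auto
  also have "\<dots> = ennreal (\<Prod>b\<in>Basis. (?u - ?l) \<bullet> b)"
    using assms by (intro emeasure_lborel_cbox) (simp add: inner_diff_left inner_add_left)
  also have "(\<Prod>b\<in>Basis. (?u - ?l) \<bullet> b) = (\<Prod>b\<in>(Basis :: 'a set). 2 * \<rho>)"
    by (intro prod.cong) (auto simp: inner_diff_left inner_add_left)
  finally show ?thesis by simp
qed

text \<open>For \<open>\<delta> < 1\<close> the slab is covered by at most
  \<open>(2 / \<delta>) ^ (n - k)\<close> balls, each inside a cube of side
  \<open>(4 * n + 2) * \<delta>\<close>; the factors other than \<open>\<delta> ^ k\<close> are
  bounded by this constant.\<close>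

definition slab_const :: "nat \<Rightarrow> real" where
  "slab_const n = 2 ^ n * (4 * real n + 2) ^ n"

text \<open>
  The slab lies within \<open>\<delta>\<close> of the orthogonal complement of \<open>V\<close>, whose unit ball is covered by about
  \<open>\<delta> ^ (k - n)\<close> balls of radius \<open>\<delta>\<close>.
\<close>

lemma slab_volume:
  fixes V :: "(real ^ 'n) set"
  assumes V: "subspace V" "dim V = k" and \<delta>: "0 < \<delta>"
  shows "emeasure lborel {z \<in> cball 0 1. norm (orth_proj V z) \<le> \<delta>} \<le>
    ennreal (slab_const CARD('n) * \<delta> ^ k)"
proof (cases "\<delta> < 1")
  case True
  let ?n = "CARD('n)"
  define N where "N = nat \<lceil>1 / \<delta>\<rceil>"
  have N: "1 / \<delta> \<le> N" "N \<le> 1 / \<delta> + 1" using \<delta> by (simp_all add: N_def)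
  then have N0: "0 < N" using \<delta> by (metis less_le_trans of_nat_0_less_iff zero_less_divide_1_iff)
  define T where "T = {y. \<forall>v\<in>V. orthogonal v y}"
  have T: "subspace T" by (simp add: T_def subspace_orthogonal_to_vectors)
  have "dim T + dim V = ?n"
    using dim_subspace_orthogonal_to_vectors[OF V(1) subspace_UNIV] by (simp add: T_def)
  then have dimT: "dim T = ?n - k" and k: "k \<le> ?n" using V by simp_all
  obtain Z where Z: "finite Z" "card Z \<le> N ^ (?n - k)"
    "\<And>x. x \<in> T \<Longrightarrow> norm x \<le> 1 \<Longrightarrow> \<exists>z\<in>Z. norm (x - z) \<le> 2 * real ?n / N"
    by (rule subspace_ball_cover[OF T N0]) (auto simp: dimT)
  let ?\<rho> = "(2 * real ?n + 1) * \<delta>"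
  have sub: "{z \<in> cball 0 1. norm (orth_proj V z) \<le> \<delta>} \<subseteq> (\<Union>\<zeta>\<in>Z. cball \<zeta> ?\<rho>)"
  proof
    fix z assume "z \<in> {z \<in> cball 0 1. norm (orth_proj V z) \<le> \<delta>}"
    then have z: "norm z \<le> 1" "norm (orth_proj V z) \<le> \<delta>" by auto
    have "z - orth_proj V z \<in> T"
      using orthogonal_orth_proj[OF V(1), of _ z] by (auto simp: T_def orthogonal_commute)
    moreover have "norm (z - orth_proj V z) \<le> 1"
    proof -
      have "(norm (z - orth_proj V z))\<^sup>2 \<le> (norm z)\<^sup>2"
        using norm_orth_proj_Pythagoras[OF V(1), of z] by simp
      then show ?thesis using z(1) power2_le_imp_le norm_ge_zero order_trans by blast
    qed
    ultimately obtain \<zeta> where \<zeta>: "\<zeta> \<in> Z" "norm (z - orth_proj V z - \<zeta>) \<le> 2 * real ?n / N"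
      using Z(3) by blast
    have "1 / N \<le> \<delta>" using N(1) \<delta> N0 by (simp add: field_simps)
    then have "2 * real ?n / N \<le> 2 * real ?n * \<delta>"
      using mult_left_mono[of "1 / N" \<delta> "2 * real ?n"] by simp
    moreover have "norm (z - \<zeta>) \<le> norm (z - orth_proj V z - \<zeta>) + norm (orth_proj V z)"
      using norm_triangle_ineq[of "z - orth_proj V z - \<zeta>" "orth_proj V z"] by simp
    ultimately have "norm (z - \<zeta>) \<le> ?\<rho>" using \<zeta>(2) z(2) by (simp add: algebra_simps)
    then show "z \<in> (\<Union>\<zeta>\<in>Z. cball \<zeta> ?\<rho>)" using \<zeta>(1) by (auto simp: dist_norm norm_minus_commute)
  qed
  have "emeasure lborel {z \<in> cball 0 1. norm (orth_proj V z) \<le> \<delta>} \<le>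
      emeasure lborel (\<Union>\<zeta>\<in>Z. cball \<zeta> ?\<rho>)"
    using Z(1) by (intro emeasure_mono sub) auto
  also have "\<dots> \<le> (\<Sum>\<zeta>\<in>Z. emeasure lborel (cball \<zeta> ?\<rho>))"
    using Z(1) by (intro emeasure_subadditive_finite) auto
  also have "\<dots> \<le> (\<Sum>\<zeta>\<in>Z. ennreal ((2 * ?\<rho>) ^ ?n))"
    using \<delta> by (intro sum_mono) (use emeasure_cball_le[of ?\<rho>, where 'a = "real ^ 'n"] in auto)
  also have "\<dots> = ennreal (card Z * (2 * ?\<rho>) ^ ?n)"
    using \<delta> by (simp add: ennreal_mult ennreal_of_nat_eq_real_of_nat)
  also have "\<dots> \<le> ennreal (slab_const ?n * \<delta> ^ k)"
  proof (rule ennreal_leI)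
    have "N \<le> 2 / \<delta>" using N(2) True \<delta> by (simp add: field_simps)
    then have "real (card Z) \<le> (2 / \<delta>) ^ (?n - k)"
      using Z(2) by (meson of_nat_0_le_iff of_nat_mono order_trans power_mono of_nat_power_le_of_nat_cancel_iff)
    then have "card Z * (2 * ?\<rho>) ^ ?n \<le> (2 / \<delta>) ^ (?n - k) * (2 * ?\<rho>) ^ ?n"
      using \<delta> by (intro mult_right_mono) auto
    also have "\<dots> = 2 ^ (?n - k) * (4 * real ?n + 2) ^ ?n * (\<delta> ^ ?n / \<delta> ^ (?n - k))"
    proof -
      have "2 * ?\<rho> = (4 * real ?n + 2) * \<delta>" by (simp add: algebra_simps)
      then show ?thesis by (simp only: power_mult_distrib power_divide) (simp add: field_simps)
    qed
    also have "\<delta> ^ ?n / \<delta> ^ (?n - k) = \<delta> ^ k"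
      using \<delta> k by (simp add: power_diff field_simps flip: power_add)
    also have "2 ^ (?n - k) * (4 * real ?n + 2) ^ ?n * \<delta> ^ k \<le> slab_const ?n * \<delta> ^ k"
      using \<delta> unfolding slab_const_def by (intro mult_right_mono power_increasing) auto
    finally show "card Z * (2 * ?\<rho>) ^ ?n \<le> slab_const ?n * \<delta> ^ k" .
  qed
  finally show ?thesis .
next
  case False
  let ?n = "CARD('n)"
  have "emeasure lborel {z \<in> cball 0 1. norm (orth_proj V z) \<le> \<delta>} \<le>
      emeasure lborel (cball (0 :: real ^ 'n) 1)"
    by (intro emeasure_mono) auto
  also have "\<dots> \<le> ennreal (2 ^ ?n)"
    using emeasure_cball_le[of 1 "0 :: real ^ 'n"] by simp
  also have "\<dots> \<le> ennreal (slab_const ?n * \<delta> ^ k)"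
  proof (rule ennreal_leI)
    have "2 ^ ?n * 1 * 1 \<le> 2 ^ ?n * (4 * real ?n + 2) ^ ?n * \<delta> ^ k"
      using False by (intro mult_mono mult_left_mono one_le_power) auto
    then show "2 ^ ?n \<le> slab_const ?n * \<delta> ^ k" by (simp add: slab_const_def)
  qed
  finally show ?thesis .
qed

section \<open>The invariant measure and transversality\<close>

lemma grassmannianD: "V \<in> grassmannian k \<Longrightarrow> subspace V" "V \<in> grassmannian k \<Longrightarrow> dim V = k"
  by (simp_all add: grassmannian_def)

lemma rotation_invariantD:
  assumes "rotation_invariant_measure k \<gamma>"
  shows "prob_space \<gamma>" "space \<gamma> = grassmannian k" "sets \<gamma> = sets (grassmannian_borel k)"
    "orthogonal_transformation f \<Longrightarrow> det (matrix f) = 1 \<Longrightarrow> \<A> \<in> sets \<gamma> \<Longrightarrow>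
      emeasure \<gamma> ((\<lambda>V. f ` V) ` \<A>) = emeasure \<gamma> \<A>"
  using assms unfolding rotation_invariant_measure_def by blast+

lemma matrix_orth_proj_measurable:
  fixes \<gamma> :: "(real ^ 'n) set measure"
  assumes "rotation_invariant_measure k \<gamma>"
  shows "(\<lambda>V. matrix (orth_proj V)) \<in> borel_measurable \<gamma>"
proof -
  have "(\<lambda>V :: (real ^ 'n) set. matrix (orth_proj V)) \<in> borel_measurable (grassmannian_borel k)"
    unfolding grassmannian_borel_def by (rule measurable_vimage_algebra1) simp
  then show ?thesis
    using rotation_invariantD(3)[OF assms] measurable_cong_sets by blast
qed

lemma borel_measurable_matrix_vector_mult:
  fixes f :: "'a \<Rightarrow> real ^ 'n ^ 'm"
  assumes "f \<in> borel_measurable M" "g \<in> borel_measurable M"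
  shows "(\<lambda>x. f x *v g x) \<in> borel_measurable M"
proof (rule borel_measurable_continuous_Pair[OF assms])
  show "continuous_on UNIV (\<lambda>x. fst x *v snd x :: real ^ 'm)"
    unfolding matrix_vector_mult_def
    by (intro continuous_intros continuous_on_vec_lambda)
qed

lemma matrix_orth_proj: "subspace V \<Longrightarrow> matrix (orth_proj V) *v y = orth_proj V y"
  by (simp add: matrix_works linear_orth_proj)

lemma orth_proj_measurable:
  fixes \<gamma> :: "(real ^ 'n) set measure"
  assumes "rotation_invariant_measure k \<gamma>"
  shows "{V \<in> space \<gamma>. norm (orth_proj V y) \<le> \<delta>} \<in> sets \<gamma>"
proof -
  have "(\<lambda>V. norm (matrix (orth_proj V) *v y)) \<in> borel_measurable \<gamma>"
    by (intro borel_measurable_norm measurable_compose[OF _ borel_measurable_norm]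
        borel_measurable_matrix_vector_mult matrix_orth_proj_measurable[OF assms]) auto
  then have "{V \<in> space \<gamma>. norm (matrix (orth_proj V) *v y) \<le> \<delta>} \<in> sets \<gamma>"
    by measurable
  also have "{V \<in> space \<gamma>. norm (matrix (orth_proj V) *v y) \<le> \<delta>} =
      {V \<in> space \<gamma>. norm (orth_proj V y) \<le> \<delta>}"
    using rotation_invariantD(2)[OF assms]
    by (auto simp: matrix_orth_proj grassmannianD(1)[of _ k])
  finally show ?thesis .
qed

lemma orth_proj_UNIV: "orth_proj UNIV x = x"
  by (rule orth_proj_eqI) (auto simp: orthogonal_def)

text \<open>A rotation that carries \<open>y\<close> to \<open>y'\<close> maps the first event onto
  the second. On the line no rotation carries \<open>y\<close> to its negative, but there
  \<open>1 \<le> k\<close> forces \<open>V = UNIV\<close>.\<close>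

lemma orth_proj_prob_norm_cong:
  fixes \<gamma> :: "(real ^ 'n) set measure"
  assumes \<gamma>: "rotation_invariant_measure k \<gamma>" and k: "1 \<le> k" and eq: "norm y = norm y'"
  shows "emeasure \<gamma> {V \<in> space \<gamma>. norm (orth_proj V y) \<le> \<delta>} =
    emeasure \<gamma> {V \<in> space \<gamma>. norm (orth_proj V y') \<le> \<delta>}"
proof (cases "2 \<le> CARD('n)")
  case True
  from rotation_exists[OF True eq] obtain f
    where f: "orthogonal_transformation f" "det (matrix f) = 1" "f y = y'" by blast
  have lin: "linear f" and bij: "bij f" and nf: "norm (f x) = norm x" for x
    using f(1) by (auto simp: orthogonal_transformation_linear orthogonal_transformation_bij
        orthogonal_transformation_norm)
  have inv: "orthogonal_transformation (inv f)" by (rule orthogonal_transformation_inv[OF f(1)])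
  have gr: "g ` V \<in> grassmannian k" if "V \<in> grassmannian k" "orthogonal_transformation g"
    for g :: "real ^ 'n \<Rightarrow> real ^ 'n" and V
  proof -
    have "linear g" "inj g" using that(2)
      by (auto simp: orthogonal_transformation_linear orthogonal_transformation_inj)
    then show ?thesis using that(1) dim_image_eq[of g V]
      by (auto simp: grassmannian_def linear_subspace_image intro: inj_on_subset)
  qed
  have "(\<lambda>V. f ` V) ` {V \<in> space \<gamma>. norm (orth_proj V y) \<le> \<delta>} =
      {V \<in> space \<gamma>. norm (orth_proj V y') \<le> \<delta>}" (is "?F ` ?A = ?B")
  proof (intro equalityI subsetI)
    fix W assume "W \<in> ?F ` ?A"
    then show "W \<in> ?B"
      using gr[OF _ f(1)] orth_proj_image[OF grassmannianD(1) f(1), of _ k y] f(3) nf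
      by (auto simp: rotation_invariantD(2)[OF \<gamma>])
  next
    fix W assume W: "W \<in> ?B"
    define V where "V = inv f ` W"
    have WV: "W = f ` V" using bij by (simp add: V_def image_f_inv_f bij_is_surj)
    have V: "V \<in> grassmannian k"
      using gr[OF _ inv, of W] W by (simp add: V_def rotation_invariantD(2)[OF \<gamma>])
    then have "norm (orth_proj V y) \<le> \<delta>"
      using W orth_proj_image[OF grassmannianD(1)[OF V] f(1), of y] f(3) nf by (simp add: WV)
    then show "W \<in> ?F ` ?A" using V WV by (auto simp: rotation_invariantD(2)[OF \<gamma>])
  qed
  then show ?thesis
    using rotation_invariantD(4)[OF \<gamma> f(1,2) orth_proj_measurable[OF \<gamma>, of y \<delta>]] by simp
next
  case False
  have "V = UNIV" if "V \<in> space \<gamma>" for V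
  proof -
    have "subspace V" "dim V = k" using that by (auto simp: rotation_invariantD(2)[OF \<gamma>] grassmannian_def)
    moreover have "dim V \<le> CARD('n)" using dim_subset_UNIV[of V] by simp
    ultimately have "dim V = dim (UNIV :: (real ^ 'n) set)" using k False by simp
    then show ?thesis using \<open>subspace V\<close> by (metis dim_eq_full dim_UNIV span_eq_iff)
  qed
  then have "norm (orth_proj V y) = norm (orth_proj V y')" if "V \<in> space \<gamma>" for V
    using that eq orth_proj_UNIV by metis
  then show ?thesis by (metis (mono_tags, lifting) Collect_cong)
qed

text \<open>
  By rotation invariance the probability depends only on \<open>\<delta> / norm y\<close>, so it may be averaged over \<open>y\<close>
  in the unit ball; Fubini's theorem turns the average into the volume of slabs.
\<close>

lemma transversality:
  fixes \<gamma> :: "(real ^ 'n) set measure"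
  assumes \<gamma>: "rotation_invariant_measure k \<gamma>" and k: "1 \<le> k"
  obtains C where "0 < C" "\<And>y \<delta>. y \<noteq> 0 \<Longrightarrow> 0 < \<delta> \<Longrightarrow>
    measure \<gamma> {V \<in> space \<gamma>. norm (orth_proj V y) \<le> \<delta>} \<le> C * (\<delta> / norm y) ^ k"
proof -
  interpret prob_space \<gamma> by (rule rotation_invariantD(1)[OF \<gamma>])
  interpret pair_sigma_finite \<gamma> "lborel :: (real ^ 'n) measure" ..
  define vol where "vol = measure lborel (cball (0 :: real ^ 'n) 1)"
  have vol: "0 < vol" unfolding vol_def by (rule content_cball_pos) simp
  have sc: "0 < slab_const CARD('n)" by (simp add: slab_const_def)
  have unit: "vol * measure \<gamma> {V \<in> space \<gamma>. norm (orth_proj V y) \<le> \<delta>} \<le> slab_const CARD('n) * \<delta> ^ k"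
    if y: "norm y = 1" and \<delta>: "0 < \<delta>" for y \<delta>
  proof -
    define E where "E z = {V \<in> space \<gamma>. norm (orth_proj V z) \<le> \<delta>}" for z
    \<comment> \<open>Written with matrices, the condition is a continuous function of the matrix
      and the vector, hence jointly measurable.\<close>
    define Q where "Q = {x \<in> space (\<gamma> \<Otimes>\<^sub>M lborel). norm (snd x) \<le> 1 \<and>
      norm (matrix (orth_proj (fst x)) *v snd x) \<le> \<delta>}"
    have meas: "(\<lambda>x. norm (matrix (orth_proj (fst x)) *v snd x)) \<in>
        borel_measurable (\<gamma> \<Otimes>\<^sub>M (lborel :: (real ^ 'n) measure))"
      by (intro measurable_compose[OF _ borel_measurable_norm]
          borel_measurable_matrix_vector_mult
          measurable_compose[OF measurable_fst matrix_orth_proj_measurable[OF \<gamma>]]) auto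
    have Q: "Q \<in> sets (\<gamma> \<Otimes>\<^sub>M lborel)" 
      unfolding Q_def
      by (intro sets.sets_Collect_conj borel_measurable_le meas) simp_all
    have QV: "Pair V -` Q = {z \<in> cball 0 1. norm (orth_proj V z) \<le> \<delta>}" if "V \<in> space \<gamma>" for V
      using that rotation_invariantD(2)[OF \<gamma>]
      by (auto simp: Q_def space_pair_measure matrix_orth_proj grassmannianD(1)[of _ k])
    have Qz: "(\<lambda>V. (V, z)) -` Q = E z" if "z \<in> cball 0 1" for z
      using that rotation_invariantD(2)[OF \<gamma>]
      by (auto simp: Q_def E_def space_pair_measure matrix_orth_proj grassmannianD(1)[of _ k])
    \<comment> \<open>Compare \<open>y\<close> with the unit vector in the direction of
      \<open>z\<close>; shrinking that vector to \<open>z\<close> only enlarges the event. The point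
      0 has no direction, but its event is the whole space.\<close>
    have Ez: "emeasure \<gamma> (E y) \<le> emeasure \<gamma> (E z)" if z: "z \<in> cball 0 1" for z
    proof -
      have "emeasure \<gamma> (E y) = emeasure \<gamma> {V \<in> space \<gamma>. norm (orth_proj V (if z = 0 then y else z /\<^sub>R norm z)) \<le> \<delta>}"
        unfolding E_def using y by (intro orth_proj_prob_norm_cong[OF \<gamma> k]) auto
      also have "\<dots> \<le> emeasure \<gamma> (E z)"
      proof (intro emeasure_mono subsetI)
        fix V assume "V \<in> {V \<in> space \<gamma>. norm (orth_proj V (if z = 0 then y else z /\<^sub>R norm z)) \<le> \<delta>}"
        then have V: "V \<in> space \<gamma>" "norm (orth_proj V (if z = 0 then y else z /\<^sub>R norm z)) \<le> \<delta>" by auto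
        have lin: "linear (orth_proj V)"
          using V rotation_invariantD(2)[OF \<gamma>] grassmannianD(1) linear_orth_proj by blast
        show "V \<in> E z"
        proof (cases "z = 0")
          case True
          then show ?thesis using V \<delta> lin by (simp add: E_def linear_0)
        next
          case False
          then have "norm (orth_proj V z) \<le> \<delta> * norm z"
            using V lin by (simp add: linear_scale field_simps)
          also have "\<dots> \<le> \<delta>" using z \<delta> by (simp add: mult_left_le)
          finally show ?thesis using V by (simp add: E_def)
        qed
      qed (simp add: E_def orth_proj_measurable[OF \<gamma>])
      finally show ?thesis .
    qed
    have "ennreal vol * emeasure \<gamma> (E y) = emeasure \<gamma> (E y) * emeasure lborel (cball (0 :: real ^ 'n) 1)"
      unfolding vol_def 
      using emeasure_lborel_cball_finite[of "0 :: real ^ 'n" 1]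
      by (simp add: emeasure_eq_ennreal_measure mult.commute less_top)
    also have "\<dots> = (\<integral>\<^sup>+z. emeasure \<gamma> (E y) * indicator (cball 0 1) z \<partial>(lborel :: (real ^ 'n) measure))"
      by (simp add: nn_integral_cmult_indicator)
    also have "\<dots> \<le> (\<integral>\<^sup>+z. emeasure \<gamma> ((\<lambda>V. (V, z)) -` Q) \<partial>lborel)"
      using Ez Qz by (intro nn_integral_mono) (auto simp: indicator_def)
    also have "\<dots> = emeasure (\<gamma> \<Otimes>\<^sub>M lborel) Q" by (rule emeasure_pair_measure_alt2[OF Q, symmetric])
    also have "\<dots> = (\<integral>\<^sup>+V. emeasure lborel (Pair V -` Q) \<partial>\<gamma>)"
      by (rule lborel.emeasure_pair_measure_alt[OF Q])
    also have "\<dots> \<le> (\<integral>\<^sup>+V. ennreal (slab_const CARD('n) * \<delta> ^ k) \<partial>\<gamma>)"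
    proof (intro nn_integral_mono)
      fix V assume V: "V \<in> space \<gamma>"
      then have "subspace V" "dim V = k"
        by (auto simp: rotation_invariantD(2)[OF \<gamma>] grassmannian_def)
      then show "emeasure lborel (Pair V -` Q) \<le> ennreal (slab_const CARD('n) * \<delta> ^ k)"
        unfolding QV[OF V] using \<delta> by (rule slab_volume)
    qed
    also have "\<dots> = ennreal (slab_const CARD('n) * \<delta> ^ k)" by (simp add: emeasure_space_1)
    finally have "ennreal (vol * measure \<gamma> (E y)) \<le> ennreal (slab_const CARD('n) * \<delta> ^ k)"
      using vol by (simp add: emeasure_eq_measure ennreal_mult)
    then show ?thesis using sc \<delta> unfolding E_def
      by (subst (asm) ennreal_le_iff) auto
  qed
  show ?thesis
  proof (rule that[of "slab_const CARD('n) / vol"])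
    show "0 < slab_const CARD('n) / vol" using vol sc by simp
    fix y :: "real ^ 'n" and \<delta> :: real assume y: "y \<noteq> 0" and \<delta>: "0 < \<delta>"
    have "{V \<in> space \<gamma>. norm (orth_proj V y) \<le> \<delta>} =
        {V \<in> space \<gamma>. norm (orth_proj V (y /\<^sub>R norm y)) \<le> \<delta> / norm y}"
    proof (intro Collect_cong conj_cong refl)
      fix V assume "V \<in> space \<gamma>"
      then have lin: "linear (orth_proj V)"
        using rotation_invariantD(2)[OF \<gamma>] grassmannianD(1) linear_orth_proj by blast
      show "norm (orth_proj V y) \<le> \<delta> \<longleftrightarrow> norm (orth_proj V (y /\<^sub>R norm y)) \<le> \<delta> / norm y"
        using y by (simp add: linear_scale[OF lin] field_simps)
    qed
    then show "measure \<gamma> {V \<in> space \<gamma>. norm (orth_proj V y) \<le> \<delta>} \<le>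
        slab_const CARD('n) / vol * (\<delta> / norm y) ^ k"
      using unit[of "y /\<^sub>R norm y" "\<delta> / norm y"] y \<delta> vol by (simp add: field_simps)
  qed
qed

section \<open>Hausdorff dimension\<close>

lemma hausdorff_premeasure_image_le:
  fixes f :: "'a :: metric_space \<Rightarrow> 'b :: metric_space"
  assumes lip: "\<And>x y. dist (f x) (f y) \<le> dist x y" and s: "0 \<le> s"
  shows "hausdorff_premeasure s \<delta> (f ` E) \<le> hausdorff_premeasure s \<delta> E"
  unfolding hausdorff_premeasure_def
proof (rule INF_mono)
  fix C :: "nat \<Rightarrow> 'a set"
  assume C: "C \<in> {C. E \<subseteq> (\<Union>i. C i) \<and> (\<forall>i. bounded (C i) \<and> diameter (C i) \<le> \<delta>)}"
  have diam: "diameter (f ` C i) \<le> diameter (C i)" for i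
  proof (cases "C i = {}")
    case False
    have "(SUP (x, y)\<in>f ` C i \<times> f ` C i. dist x y) \<le> diameter (C i)"
    proof (rule cSUP_least)
      fix p assume "p \<in> f ` C i \<times> f ` C i"
      then obtain x y where xy: "p = (f x, f y)" "x \<in> C i" "y \<in> C i" by auto
      then have "dist x y \<le> diameter (C i)" using C diameter_bounded_bound[of "C i"] by blast
      then show "(case p of (x, y) \<Rightarrow> dist x y) \<le> diameter (C i)"
        using lip[of x y] by (simp add: xy(1))
    qed (use False in auto)
    then show ?thesis using False by (simp add: diameter_def[of "f ` C i"])
  qed simp
  have bdd: "bounded (f ` C i)" for i
  proof -
    obtain e where "\<forall>x\<in>C i. \<forall>y\<in>C i. dist x y \<le> e"
      using C unfolding bounded_two_points mem_Collect_eq by blast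
    then show ?thesis unfolding bounded_two_points using lip order_trans by blast
  qed
  show "\<exists>C'\<in>{C. f ` E \<subseteq> (\<Union>i. C i) \<and> (\<forall>i. bounded (C i) \<and> diameter (C i) \<le> \<delta>)}.
      (\<Sum>i. ennreal (diameter (C' i) powr s)) \<le> (\<Sum>i. ennreal (diameter (C i) powr s))"
  proof (rule bexI[of _ "\<lambda>i. f ` C i"])
    show "(\<Sum>i. ennreal (diameter (f ` C i) powr s)) \<le> (\<Sum>i. ennreal (diameter (C i) powr s))"
      using diam bdd s by (intro suminf_le ennreal_leI powr_mono2) (auto intro: diameter_ge_0)
    show "(\<lambda>i. f ` C i) \<in> {C. f ` E \<subseteq> (\<Union>i. C i) \<and> (\<forall>i. bounded (C i) \<and> diameter (C i) \<le> \<delta>)}"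
      using C diam bdd order_trans by (auto, blast+)
  qed
qed

lemma hausdorff_dim_image_le:
  fixes f :: "'a :: metric_space \<Rightarrow> 'b :: metric_space"
  assumes lip: "\<And>x y. dist (f x) (f y) \<le> dist x y"
  shows "hausdorff_dim (f ` E) \<le> hausdorff_dim E"
  unfolding hausdorff_dim_def
proof (rule INF_superset_mono)
  show "{s. 0 < s \<and> hausdorff_measure s E = 0} \<subseteq> {s. 0 < s \<and> hausdorff_measure s (f ` E) = 0}"
  proof safe
    fix s :: real assume s: "0 < s" "hausdorff_measure s E = 0"
    have "hausdorff_measure s (f ` E) \<le> hausdorff_measure s E"
      unfolding hausdorff_measure_def
      using hausdorff_premeasure_image_le[of f s] lip s by (intro SUP_mono) auto
    then show "hausdorff_measure s (f ` E) = 0" using s by simp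
  qed
qed simp

text \<open>The covers of the sets \<open>E R\<close> get the budgets
  \<open>\<eta> * (1/2) ^ Suc R\<close> and are merged along \<open>prod_decode\<close>.\<close>

lemma hausdorff_premeasure_UN_eq_0:
  fixes E :: "nat \<Rightarrow> 'a :: metric_space set"
  assumes "\<And>R. hausdorff_premeasure s \<delta> (E R) = 0"
  shows "hausdorff_premeasure s \<delta> (\<Union>R. E R) = 0"
proof -
  have "hausdorff_premeasure s \<delta> (\<Union>R. E R) \<le> 0 + ennreal \<eta>" if \<eta>: "0 < \<eta>" for \<eta> :: real
  proof -
    have "\<exists>C. E R \<subseteq> (\<Union>i. C i) \<and> (\<forall>i. bounded (C i) \<and> diameter (C i) \<le> \<delta>) \<and>
        (\<Sum>i. ennreal (diameter (C i) powr s)) < ennreal (\<eta> * (1/2) ^ Suc R)" for R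
    proof -
      have "hausdorff_premeasure s \<delta> (E R) < ennreal (\<eta> * (1/2) ^ Suc R)"
        using assms \<eta> by simp
      then show ?thesis unfolding hausdorff_premeasure_def INF_less_iff by blast
    qed
    then obtain C where C: "\<And>R. E R \<subseteq> (\<Union>i. C R i)"
      "\<And>R i. bounded (C R i) \<and> diameter (C R i) \<le> \<delta>"
      "\<And>R. (\<Sum>i. ennreal (diameter (C R i) powr s)) < ennreal (\<eta> * (1/2) ^ Suc R)"
      by metis
    define D where "D n = (case prod_decode n of (R, i) \<Rightarrow> C R i)" for n
    have "(\<Union>R. E R) \<subseteq> (\<Union>n. D n)"
    proof
      fix x assume "x \<in> (\<Union>R. E R)"
      then obtain R i where "x \<in> C R i" using C(1) by blast
      then have "x \<in> D (prod_encode (R, i))" by (simp add: D_def)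
      then show "x \<in> (\<Union>n. D n)" by blast
    qed
    then have "hausdorff_premeasure s \<delta> (\<Union>R. E R) \<le> (\<Sum>n. ennreal (diameter (D n) powr s))"
      unfolding hausdorff_premeasure_def using C(2)
      by (intro INF_lower) (auto simp: D_def split: prod.splits)
    also have "\<dots> = (\<Sum>R. \<Sum>i. ennreal (diameter (C R i) powr s))"
      using suminf_ennreal_2dimen[where f = "\<lambda>(R, i). ennreal (diameter (C R i) powr s)"]
      by (simp add: D_def case_prod_beta)
    also have "\<dots> \<le> (\<Sum>R. ennreal (\<eta> * (1/2) ^ Suc R))"
      using C(3) by (intro suminf_le) (auto intro: less_imp_le)
    also have "\<dots> = ennreal \<eta>"
    proof (rule suminf_ennreal_eq)
      show "(\<lambda>R. \<eta> * (1/2) ^ Suc R) sums \<eta>"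
        using sums_mult[OF power_half_series, of \<eta>] by simp
    qed (use \<eta> in simp)
    finally show ?thesis by simp
  qed
  then have "hausdorff_premeasure s \<delta> (\<Union>R. E R) \<le> 0"
    by (rule ennreal_le_epsilon) blast
  then show ?thesis by simp
qed

lemma hausdorff_premeasure_mono:
  "E \<subseteq> E' \<Longrightarrow> hausdorff_premeasure s \<delta> E \<le> hausdorff_premeasure s \<delta> E'"
  unfolding hausdorff_premeasure_def by (rule INF_superset_mono) auto

text \<open>A ball in \<open>V\<close> is covered by \<open>N ^ dim V\<close> balls of diameter
  \<open>c / N\<close>, whose sum for the exponent \<open>s\<close> is at most
  \<open>c powr s * N powr (dim V - s)\<close>; it tends to 0 when \<open>s\<close> exceeds
  \<open>dim V\<close>.\<close>

lemma hausdorff_dim_subspace_le: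
  fixes V :: "'a :: euclidean_space set"
  assumes V: "subspace V" and E: "E \<subseteq> V"
  shows "hausdorff_dim E \<le> of_nat (dim V)"
proof -
  let ?k = "dim V" and ?n = "DIM('a)"
  have zero: "hausdorff_measure s E = 0" if s: "real ?k < s" for s
  proof -
    have "hausdorff_premeasure s \<delta> (V \<inter> cball 0 (real (Suc R))) \<le> 0 + ennreal \<eta>"
      if \<delta>: "0 < \<delta>" and \<eta>: "0 < \<eta>" for \<delta> \<eta> R
    proof -
      let ?c = "4 * real ?n * real (Suc R)"
      have c: "0 < ?c" by simp
      have "(\<lambda>N. real (Suc N) powr (real ?k - s)) \<longlonglongrightarrow> 0"
        using s by real_asymp
      then have "(\<lambda>N. ?c powr s * real (Suc N) powr (real ?k - s)) \<longlonglongrightarrow> 0"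
        by (rule tendsto_mult_right_zero)
      then have 1: "\<forall>\<^sub>F N in sequentially. ?c powr s * real (Suc N) powr (real ?k - s) < \<eta>"
        using \<eta> by (rule order_tendstoD(2))
      have "(\<lambda>N. ?c / real (Suc N)) \<longlonglongrightarrow> 0" by real_asymp
      then have 2: "\<forall>\<^sub>F N in sequentially. ?c / real (Suc N) < \<delta>"
        using \<delta> by (rule order_tendstoD(2))
      obtain N' where "?c powr s * real (Suc N') powr (real ?k - s) < \<eta>" "?c / real (Suc N') < \<delta>"
        using eventually_conj[OF 1 2] by (auto simp: eventually_sequentially)
      then obtain N where N: "0 < N" "?c powr s * real N powr (real ?k - s) < \<eta>" "?c / real N < \<delta>"
        by blast
      obtain Z where Z: "finite Z" "card Z \<le> N ^ ?k"
        "\<And>x. x \<in> V \<Longrightarrow> norm x \<le> 1 \<Longrightarrow> \<exists>z\<in>Z. norm (x - z) \<le> 2 * real ?n / N"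
        by (rule subspace_ball_cover[OF V N(1)]) auto
      let ?r = "2 * real ?n * real (Suc R) / N"
      \<comment> \<open>The sequence is padded with empty sets, which contribute
        \<open>0 powr s = 0\<close>.\<close>
      define C where "C i = (if i < card Z then cball (real (Suc R) *\<^sub>R from_nat_into Z i) ?r else {})" for i
      have diam: "diameter (C i) \<le> ?c / N" for i
        by (simp add: C_def diameter_cball)
      have "V \<inter> cball 0 (real (Suc R)) \<subseteq> (\<Union>i. C i)"
      proof
        fix x assume "x \<in> V \<inter> cball 0 (real (Suc R))"
        then have x: "x \<in> V" "norm x \<le> real (Suc R)" by auto
        have "x /\<^sub>R real (Suc R) \<in> V" using V x(1) by (simp add: subspace_scale)
        moreover have "norm (x /\<^sub>R real (Suc R)) \<le> 1" using x(2) by (simp add: field_simps)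
        ultimately obtain z where z: "z \<in> Z" "norm (x /\<^sub>R real (Suc R) - z) \<le> 2 * real ?n / N"
          using Z(3) by blast
        have "x - real (Suc R) *\<^sub>R z = real (Suc R) *\<^sub>R (x /\<^sub>R real (Suc R) - z)"
          by (simp add: scaleR_diff_right)
        then have "norm (x - real (Suc R) *\<^sub>R z) = real (Suc R) * norm (x /\<^sub>R real (Suc R) - z)"
          by simp
        also have "\<dots> \<le> real (Suc R) * (2 * real ?n / N)"
          using z(2) by (rule mult_left_mono) simp
        finally have "norm (x - real (Suc R) *\<^sub>R z) \<le> ?r" by (simp add: mult_ac)
        moreover obtain i where "i < card Z" "from_nat_into Z i = z"
          using bij_betw_from_nat_into_finite[OF Z(1)] z(1)
          unfolding bij_betw_def by (metis imageE lessThan_iff)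
        ultimately have "x \<in> C i" by (simp add: C_def dist_norm norm_minus_commute)
        then show "x \<in> (\<Union>i. C i)" by blast
      qed
      moreover have "bounded (C i)" for i by (simp add: C_def)
      moreover have "diameter (C i) \<le> \<delta>" for i using diam[of i] N(3) by linarith
      ultimately have "hausdorff_premeasure s \<delta> (V \<inter> cball 0 (real (Suc R))) \<le>
          (\<Sum>i. ennreal (diameter (C i) powr s))"
        unfolding hausdorff_premeasure_def by (intro INF_lower) auto
      also have "\<dots> = (\<Sum>i<card Z. ennreal (diameter (C i) powr s))"
        by (intro suminf_finite) (auto simp: C_def)
      also have "\<dots> \<le> (\<Sum>i<card Z. ennreal ((?c / N) powr s))"
        using s \<open>\<And>i. bounded (C i)\<close> diam
        by (intro sum_mono ennreal_leI powr_mono2) (auto intro: diameter_ge_0 order_trans)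
      also have "\<dots> = ennreal (card Z * (?c / N) powr s)"
        by (simp add: ennreal_mult ennreal_of_nat_eq_real_of_nat)
      also have "\<dots> \<le> ennreal \<eta>"
      proof (rule ennreal_leI)
        have "card Z * (?c / N) powr s \<le> real (N ^ ?k) * (?c / N) powr s"
          using Z(2) by (intro mult_right_mono of_nat_mono) auto
        also have "\<dots> = ?c powr s * real N powr (real ?k - s)"
          using N(1) c by (simp add: powr_divide powr_diff powr_realpow)
        also have "\<dots> \<le> \<eta>" using N(2) by simp
        finally show "card Z * (?c / N) powr s \<le> \<eta>" .
      qed
      finally show ?thesis by simp
    qed
    then have "hausdorff_premeasure s \<delta> (V \<inter> cball 0 (real (Suc R))) \<le> 0" if "0 < \<delta>" for \<delta> R
      by (rule ennreal_le_epsilon) (use that in blast)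
    then have "hausdorff_premeasure s \<delta> (\<Union>R. V \<inter> cball 0 (real (Suc R))) = 0" if "0 < \<delta>" for \<delta>
      using that by (intro hausdorff_premeasure_UN_eq_0) simp
    moreover have "E \<subseteq> (\<Union>R. V \<inter> cball 0 (real (Suc R)))"
    proof
      fix x assume "x \<in> E"
      moreover obtain R :: nat where "norm x \<le> R" using real_arch_simple by blast
      ultimately show "x \<in> (\<Union>R. V \<inter> cball 0 (real (Suc R)))"
        using E by (auto intro!: exI[of _ R])
    qed
    ultimately have "hausdorff_premeasure s \<delta> E = 0" if "0 < \<delta>" for \<delta>
      using that hausdorff_premeasure_mono by (metis le_zero_eq)
    then show ?thesis by (simp add: hausdorff_measure_def)
  qed
  have "hausdorff_dim E \<le> of_nat ?k + ennreal \<eta>" if "0 < \<eta>" for \<eta>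
  proof -
    have "hausdorff_dim E \<le> ennreal (real ?k + \<eta>)"
      unfolding hausdorff_dim_def using that zero[of "real ?k + \<eta>"]
      by (intro INF_lower) (auto intro: add_nonneg_pos)
    then show ?thesis using that by (simp add: ennreal_of_nat_eq_real_of_nat)
  qed
  then show ?thesis by (rule ennreal_le_epsilon) blast
qed

lemma half_power: "(1/2 :: real) ^ m = 2 powr - real m"
  by (simp add: powr_minus powr_realpow power_one_over inverse_eq_divide)

text \<open>Each covering set is assigned a dyadic scale; sets of diameter 0 get pairwise different scales.\<close>

lemma hausdorff_dim_less_dyadic_cover:
  fixes E :: "'a :: metric_space set"
  assumes dim: "hausdorff_dim E < ennreal s" and s: "0 < s"
  obtains C :: "nat \<Rightarrow> 'a set" and t :: "nat \<Rightarrow> nat"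
  where "E \<subseteq> (\<Union>i. C i)" "\<And>i. bounded (C i)" "\<And>i. diameter (C i) \<le> (1/2) ^ t i" "\<And>i. T \<le> t i"
    "\<And>m. finite {i. t i = m}" "\<And>m. real (card {i. t i = m}) \<le> 2 powr (s * (real m + 1)) + 1"
proof -
  from dim obtain s' where s': "0 < s'" "hausdorff_measure s' E = 0" "ennreal s' < ennreal s"
    unfolding hausdorff_dim_def INF_less_iff by auto
  then have less: "s' < s" using ennreal_less_iff[of s' s] by simp
  have "hausdorff_premeasure s' ((1/2) ^ T) E \<le> hausdorff_measure s' E"
    unfolding hausdorff_measure_def by (rule SUP_upper) simp
  then have "hausdorff_premeasure s' ((1/2) ^ T) E < 1" using s'(2) by simp
  then obtain C where C: "E \<subseteq> (\<Union>i. C i)" "\<And>i. bounded (C i)" "\<And>i. diameter (C i) \<le> (1/2) ^ T"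
    "(\<Sum>i. ennreal (diameter (C i) powr s')) < 1"
    unfolding hausdorff_premeasure_def INF_less_iff by blast
  define d where "d i = diameter (C i)" for i
  have d0: "0 \<le> d i" for i unfolding d_def using C(2) by (rule diameter_ge_0)
  have dT: "d i \<le> (1/2) ^ T" for i unfolding d_def by (rule C(3))
  define t where "t i = (if d i = 0 then T + i else nat \<lfloor>- log 2 (d i)\<rfloor>)" for i
  have t: "d i \<le> (1/2) ^ t i \<and> T \<le> t i \<and> (1/2) ^ Suc (t i) < d i" if "d i \<noteq> 0" for i
  proof -
    have di: "0 < d i" using that d0[of i] by simp
    have "log 2 (d i) \<le> log 2 ((1/2) ^ T)" using di dT[of i] by simp
    also have "\<dots> = - real T" by (simp add: log_nat_power log_divide)
    finally have T: "real T \<le> - log 2 (d i)" by simp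
    then have ti: "real (t i) \<le> - log 2 (d i)" "- log 2 (d i) < real (t i) + 1"
      using that by (auto simp: t_def)
    have "2 powr log 2 (d i) \<le> 2 powr - real (t i)" "2 powr - real (Suc (t i)) < 2 powr log 2 (d i)"
      using ti by simp_all
    then have "d i \<le> (1/2) ^ t i" "(1/2) ^ Suc (t i) < d i"
      unfolding half_power using di by simp_all
    moreover have "T \<le> t i" using T ti(1) that by (simp add: t_def le_nat_floor)
    ultimately show ?thesis by simp
  qed
  define J where "J m = {i. d i \<noteq> 0 \<and> t i = m}" for m
  \<comment> \<open>A set of scale \<open>m\<close> with nonzero diameter has diameter above
    \<open>(1/2) ^ Suc m\<close> and thus contributes at least \<open>2 powr - (s * (m + 1))\<close>
    to a sum that is below 1.\<close>
  have J: "real (card G) \<le> 2 powr (s * (real m + 1))" if G: "finite G" "G \<subseteq> J m" for G m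
  proof -
    have "(\<Sum>i\<in>G. ennreal (2 powr - (s * (real m + 1)))) \<le> (\<Sum>i\<in>G. ennreal (d i powr s'))"
    proof (intro sum_mono ennreal_leI)
      fix i assume "i \<in> G"
      then have i: "d i \<noteq> 0" "t i = m" using G by (auto simp: J_def)
      have "2 powr - (real m + 1) \<le> d i"
        using t[OF i(1), unfolded half_power] i(2) by (simp add: add.commute)
      then have "(2 powr - (real m + 1)) powr s' \<le> d i powr s'" using s' by (intro powr_mono2) auto
      moreover have "2 powr - (s * (real m + 1)) \<le> 2 powr (- (real m + 1) * s')"
        using less by (intro powr_mono) (auto simp: algebra_simps intro!: add_mono mult_right_mono)
      ultimately show "2 powr - (s * (real m + 1)) \<le> d i powr s'"
        unfolding powr_powr by linarith
    qed
    also have "\<dots> \<le> (\<Sum>i. ennreal (d i powr s'))" using G(1) by (intro sum_le_suminf) auto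
    also have "\<dots> < 1" using C(4) by (simp add: d_def)
    finally have "ennreal (card G * 2 powr - (s * (real m + 1))) < ennreal 1"
      by (simp add: ennreal_mult ennreal_of_nat_eq_real_of_nat)
    then have "card G * 2 powr - (s * (real m + 1)) < 1" by (subst (asm) ennreal_less_iff) auto
    then show ?thesis unfolding powr_minus by (simp add: divide_less_eq flip: divide_inverse)
  qed
  have finJ: "finite (J m)" for m
  proof (rule ccontr)
    assume "infinite (J m)"
    then obtain G where "G \<subseteq> J m" "finite G" "card G = nat \<lceil>2 powr (s * (real m + 1))\<rceil> + 1"
      using infinite_arbitrarily_large by metis
    with J[of G m] show False by linarith
  qed
  \<comment> \<open>At most one set of diameter 0 has scale \<open>m\<close>, namely number
    \<open>m - T\<close>; it causes the summand 1 in the count.\<close>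
  have sub: "{i. t i = m} \<subseteq> J m \<union> {m - T}" for m by (auto simp: J_def t_def)
  show ?thesis
  proof (rule that[of C t])
    show "E \<subseteq> (\<Union>i. C i)" "\<And>i. bounded (C i)" by (fact C)+
    show "diameter (C i) \<le> (1/2) ^ t i" for i
      using t[of i] by (cases "d i = 0") (auto simp: d_def)
    show "T \<le> t i" for i using t[of i] by (cases "d i = 0") (auto simp: t_def)
    show "finite {i. t i = m}" for m using sub[of m] finJ[of m] by (meson finite.emptyI finite.insertI finite_UnI finite_subset)
    show "real (card {i. t i = m}) \<le> 2 powr (s * (real m + 1)) + 1" for m
    proof -
      have "card {i. t i = m} \<le> card (J m \<union> {m - T})" using sub finJ by (intro card_mono) auto
      also have "\<dots> \<le> card (J m) + card {m - T}" by (rule card_Un_le)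
      finally show ?thesis using J[OF finJ subset_refl, of m] by simp
    qed
  qed
qed

section \<open>Counting rational approximations\<close>

lemma (in prob_space) prob_card_ge:
  assumes "finite I" and E: "\<And>i. i \<in> I \<Longrightarrow> E i \<in> events" and c: "0 < c"
  shows "{x \<in> space M. c \<le> real (card {i \<in> I. x \<in> E i})} \<in> events" (is "?S \<in> _")
    and "prob {x \<in> space M. c \<le> real (card {i \<in> I. x \<in> E i})} \<le> (\<Sum>i\<in>I. prob (E i)) / c"
proof -
  have eq: "real (card {i \<in> I. x \<in> E i}) = (\<Sum>i\<in>I. indicator (E i) x)" for x
    using assms(1) by (simp add: indicator_def sum.If_cases Int_def)
  have meas: "(\<lambda>x. \<Sum>i\<in>I. indicator (E i) x :: real) \<in> borel_measurable M"
    using E by (intro borel_measurable_sum borel_measurable_indicator) auto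
  show "?S \<in> events" unfolding eq using meas by measurable
  have int: "integrable M (\<lambda>x. \<Sum>i\<in>I. indicator (E i) x :: real)"
    using E by (intro Bochner_Integration.integrable_sum)
       (auto simp: integrable_indicator_iff emeasure_eq_measure)
  have "prob ?S \<le> (\<integral>x. (\<Sum>i\<in>I. indicator (E i) x) \<partial>M) / c"
    unfolding eq
    by (rule integral_Markov_inequality_measure[OF int sets.empty_sets])
       (use c in \<open>auto intro: sum_nonneg\<close>)
  also have "(\<integral>x. (\<Sum>i\<in>I. indicator (E i) x) \<partial>M) = (\<Sum>i\<in>I. prob (E i))"
    using E by (subst Bochner_Integration.integral_sum)
       (auto simp: integrable_indicator_iff emeasure_eq_measure intro!: sum.cong)
  finally show "prob ?S \<le> (\<Sum>i\<in>I. prob (E i)) / c" .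
qed

text \<open>Markov's inequality is applied twice: for fixed \<open>q\<close>, and to the number of exceptional \<open>q\<close>.\<close>

lemma (in prob_space) few_exceptional:
  fixes N :: "nat \<Rightarrow> 'p set" and E :: "nat \<Rightarrow> 'p \<Rightarrow> 'p \<Rightarrow> 'a set" and a \<epsilon> :: real and m :: nat
  assumes N: "\<And>\<kappa>. finite (N \<kappa>)" "\<And>\<kappa>. card (N \<kappa>) \<le> 2 ^ (\<kappa> + 1)"
    and E: "\<And>r q p. E r q p \<in> events" and \<epsilon>: "0 < \<epsilon>"
  shows "AE V in M. \<forall>\<^sub>F r in sequentially. \<forall>\<kappa>\<le>m * r.
    real (card {q \<in> N \<kappa>. (\<Sum>p\<in>N \<kappa>. prob (E r q p)) \<le> 2 powr (\<kappa> - a * r) \<and>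
      2 powr (\<kappa> - (a - 4 * \<epsilon>) * r) \<le> real (card {p \<in> N \<kappa>. V \<in> E r q p})}) < 2 powr (\<kappa> - 2 * \<epsilon> * r)"
proof -
  define reg where "reg r \<kappa> = {q \<in> N \<kappa>. (\<Sum>p\<in>N \<kappa>. prob (E r q p)) \<le> 2 powr (\<kappa> - a * r)}" for r \<kappa> :: nat
  define H where "H r \<kappa> q = {V \<in> space M. 2 powr (\<kappa> - (a - 4 * \<epsilon>) * r) \<le>
      real (card {p \<in> N \<kappa>. V \<in> E r q p})}" for r \<kappa> :: nat and q
  define W where "W r \<kappa> = {V \<in> space M. 2 powr (\<kappa> - 2 * \<epsilon> * r) \<le>
      real (card {q \<in> reg r \<kappa>. V \<in> H r \<kappa> q})}" for r \<kappa> :: nat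
  have H: "H r \<kappa> q \<in> events" for r \<kappa> q
    unfolding H_def by (rule prob_card_ge) (simp_all add: N E)
  have probH: "prob (H r \<kappa> q) \<le> 2 powr (- 4 * \<epsilon> * r)" if "q \<in> reg r \<kappa>" for r \<kappa> q
  proof -
    have "prob (H r \<kappa> q) \<le> (\<Sum>p\<in>N \<kappa>. prob (E r q p)) / 2 powr (\<kappa> - (a - 4 * \<epsilon>) * r)"
      unfolding H_def by (rule prob_card_ge) (simp_all add: N E)
    also have "\<dots> \<le> 2 powr (\<kappa> - a * r) / 2 powr (\<kappa> - (a - 4 * \<epsilon>) * r)"
      using that by (intro divide_right_mono) (auto simp: reg_def)
    also have "\<dots> = 2 powr (- 4 * \<epsilon> * r)"
      by (simp add: powr_diff[symmetric]) (simp add: algebra_simps)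
    finally show ?thesis .
  qed
  have fin: "finite (reg r \<kappa>)" for r \<kappa> by (simp add: reg_def N)
  have W: "W r \<kappa> \<in> events" for r \<kappa>
    unfolding W_def by (rule prob_card_ge) (simp_all add: fin H)
  \<comment> \<open>The expected number of exceptional \<open>q\<close> is at most
    \<open>2 powr (\<kappa> + 1 - 4 * \<epsilon> * r)\<close>. The threshold
    \<open>2 powr (\<kappa> - 2 * \<epsilon> * r)\<close> spends half of this gain on the size of
    the exceptional set and leaves the other half for the probability.\<close>
  have probW: "prob (W r \<kappa>) \<le> 2 * 2 powr (- 2 * \<epsilon> * r)" for r \<kappa>
  proof -
    have "prob (W r \<kappa>) \<le> (\<Sum>q\<in>reg r \<kappa>. prob (H r \<kappa> q)) / 2 powr (\<kappa> - 2 * \<epsilon> * r)"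
      unfolding W_def by (rule prob_card_ge) (simp_all add: fin H)
    also have "(\<Sum>q\<in>reg r \<kappa>. prob (H r \<kappa> q)) \<le> (\<Sum>q\<in>reg r \<kappa>. 2 powr (- 4 * \<epsilon> * r))"
      by (intro sum_mono probH)
    also have "\<dots> = card (reg r \<kappa>) * 2 powr (- 4 * \<epsilon> * r)" by simp
    also have "\<dots> \<le> 2 powr (\<kappa> + 1) * 2 powr (- 4 * \<epsilon> * r)"
    proof (intro mult_right_mono)
      have "card (reg r \<kappa>) \<le> card (N \<kappa>)" by (intro card_mono N) (auto simp: reg_def)
      then have "card (reg r \<kappa>) \<le> 2 ^ (\<kappa> + 1)" using N(2) order_trans by blast
      then have "real (card (reg r \<kappa>)) \<le> real (2 ^ (\<kappa> + 1))" by (rule of_nat_mono)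
      also have "\<dots> = 2 powr (\<kappa> + 1)" by (simp add: powr_add powr_realpow)
      finally show "real (card (reg r \<kappa>)) \<le> 2 powr (\<kappa> + 1)" .
    qed simp
    also have "2 powr (\<kappa> + 1) * 2 powr (- 4 * \<epsilon> * r) / 2 powr (\<kappa> - 2 * \<epsilon> * r) = 2 powr (1 - 2 * \<epsilon> * r)"
      by (simp add: powr_add[symmetric] powr_diff[symmetric]) (simp add: algebra_simps)
    also have "\<dots> = 2 * 2 powr (- 2 * \<epsilon> * r)" by (simp add: powr_diff powr_minus divide_inverse)
    finally show ?thesis by (simp add: divide_right_mono)
  qed
  have "AE V in M. \<forall>\<^sub>F r in sequentially. V \<in> space M - (\<Union>\<kappa>\<le>m * r. W r \<kappa>)"
  proof (rule borel_cantelli_AE1)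
    show "(\<Union>\<kappa>\<le>m * r. W r \<kappa>) \<in> events" for r using W by blast
    show "emeasure M (\<Union>\<kappa>\<le>m * r. W r \<kappa>) < \<infinity>" for r by (simp add: emeasure_eq_measure)
    show "summable (\<lambda>r. prob (\<Union>\<kappa>\<le>m * r. W r \<kappa>))"
    proof (rule summable_comparison_test_ev)
      \<comment> \<open>The union over \<open>\<kappa>\<close> has only linearly many members, which
        half of the remaining exponent absorbs.\<close>
      have "\<forall>\<^sub>F r in sequentially. (real m * real r + 1) * (2 * 2 powr (- 2 * \<epsilon> * real r)) \<le>
          2 powr (- \<epsilon> * real r)"
        using \<epsilon> by real_asymp
      then show "\<forall>\<^sub>F r in sequentially. norm (prob (\<Union>\<kappa>\<le>m * r. W r \<kappa>)) \<le> (2 powr - \<epsilon>) ^ r"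
      proof eventually_elim
        case (elim r)
        have "prob (\<Union>\<kappa>\<le>m * r. W r \<kappa>) \<le> (\<Sum>\<kappa>\<le>m * r. prob (W r \<kappa>))"
          using W by (intro finite_measure_subadditive_finite) auto
        also have "\<dots> \<le> (\<Sum>\<kappa>\<le>m * r. 2 * 2 powr (- 2 * \<epsilon> * r))" by (intro sum_mono probW)
        also have "\<dots> = (real m * real r + 1) * (2 * 2 powr (- 2 * \<epsilon> * real r))"
          by (simp add: algebra_simps)
        also note elim
        also have "2 powr (- \<epsilon> * real r) = (2 powr - \<epsilon>) ^ r"
          by (simp add: powr_power mult.commute)
        finally show ?case by simp
      qed
      show "summable (\<lambda>r. (2 powr - \<epsilon>) ^ r)"
        using powr_less_mono[of "- \<epsilon>" 0 2] \<epsilon> by (intro summable_geometric) simp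
    qed
  qed
  then show ?thesis
  proof eventually_elim
    case (elim V)
    then show ?case
    proof eventually_elim
      case (elim r)
      then have "V \<in> space M" by simp
      then have "{q \<in> reg r \<kappa>. V \<in> H r \<kappa> q} = {q \<in> N \<kappa>. (\<Sum>p\<in>N \<kappa>. prob (E r q p)) \<le> 2 powr (\<kappa> - a * r) \<and>
        2 powr (\<kappa> - (a - 4 * \<epsilon>) * r) \<le> real (card {p \<in> N \<kappa>. V \<in> E r q p})}" for \<kappa>
        by (auto simp: reg_def H_def)
      then show ?case using elim by (auto simp: W_def not_le)
    qed
  qed
qed

section \<open>Nets of rational points\<close>

lemma real_vec_dense: "0 < \<eta> \<Longrightarrow> \<exists>p :: rat ^ 'n. norm (x - real_vec p) < \<eta>"
proof -
  assume \<eta>: "0 < \<eta>"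
  have "\<exists>q :: rat. \<bar>x $ i - of_rat q\<bar> < \<eta> / CARD('n)" for i
  proof -
    obtain q where "x $ i - \<eta> / CARD('n) < of_rat q" "of_rat q < x $ i"
      using of_rat_dense[of "x $ i - \<eta> / CARD('n)" "x $ i"] \<eta> by auto
    then show ?thesis by (intro exI[of _ q]) (simp add: abs_less_iff)
  qed
  then obtain f where f: "\<And>i. \<bar>x $ i - of_rat (f i)\<bar> < \<eta> / CARD('n)" by metis
  have "norm (x - real_vec (\<chi> i. f i)) \<le> (\<Sum>i\<in>UNIV. \<bar>(x - real_vec (\<chi> i. f i)) $ i\<bar>)"
    by (rule norm_le_l1_cart)
  also have "\<dots> < (\<Sum>i\<in>(UNIV :: 'n set). \<eta> / CARD('n))"
    by (intro sum_strict_mono) (use f in \<open>auto simp: real_vec_def\<close>)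
  also have "\<dots> = \<eta>" by simp
  finally show ?thesis by blast
qed

text \<open>Rounding the scaled net of the unit ball to rational points costs less than
  \<open>\<rho> / N\<close>, which turns \<open>2 * n\<close> into \<open>2 * n + 1\<close> and
  makes the inequality strict.\<close>

lemma rational_net:
  fixes c :: "real ^ 'n" and N :: nat
  assumes \<rho>: "0 < \<rho>" and N: "0 < N"
  obtains Z :: "(rat ^ 'n) set" where "finite Z" "card Z \<le> N ^ CARD('n)"
    "\<And>x. norm (x - c) \<le> \<rho> \<Longrightarrow> \<exists>z\<in>Z. norm (x - real_vec z) < \<rho> * (2 * real CARD('n) + 1) / N"
proof -
  let ?n = "CARD('n)"
  obtain Z :: "(real ^ 'n) set" where Z: "finite Z" "card Z \<le> N ^ ?n"
    "\<And>x. norm x \<le> 1 \<Longrightarrow> \<exists>z\<in>Z. norm (x - z) \<le> 2 * real ?n / N"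
    by (rule subspace_ball_cover[where S = "UNIV :: (real ^ 'n) set", OF subspace_UNIV N]) auto
  have "\<exists>p :: rat ^ 'n. norm (c + \<rho> *\<^sub>R z - real_vec p) < \<rho> / N" for z
    using real_vec_dense[of "\<rho> / N" "c + \<rho> *\<^sub>R z"] \<rho> N by simp
  then obtain g :: "real ^ 'n \<Rightarrow> rat ^ 'n" where g: "\<And>z. norm (c + \<rho> *\<^sub>R z - real_vec (g z)) < \<rho> / N"
    by metis
  show ?thesis
  proof (rule that[of "g ` Z"])
    show "finite (g ` Z)" using Z by simp
    show "card (g ` Z) \<le> N ^ ?n" using card_image_le[OF Z(1)] Z(2) order_trans by blast
    fix x assume "norm (x - c) \<le> \<rho>"
    then have "norm ((x - c) /\<^sub>R \<rho>) \<le> 1"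
      unfolding norm_scaleR using \<rho> by (simp add: field_simps)
    then obtain z where z: "z \<in> Z" "norm ((x - c) /\<^sub>R \<rho> - z) \<le> 2 * real ?n / N" using Z(3) by blast
    have "x - (c + \<rho> *\<^sub>R z) = \<rho> *\<^sub>R ((x - c) /\<^sub>R \<rho> - z)"
      using \<rho> by (simp add: scaleR_diff_right)
    then have "norm (x - (c + \<rho> *\<^sub>R z)) = \<rho> * norm ((x - c) /\<^sub>R \<rho> - z)" using \<rho> by simp
    also have "\<dots> \<le> \<rho> * (2 * real ?n / N)" using z(2) \<rho> by (intro mult_left_mono) auto
    finally have "norm (x - (c + \<rho> *\<^sub>R z)) \<le> \<rho> * (2 * real ?n / N)" .
    moreover have "norm (x - real_vec (g z)) \<le>
        norm (x - (c + \<rho> *\<^sub>R z)) + norm (c + \<rho> *\<^sub>R z - real_vec (g z))"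
      using norm_triangle_ineq[of "x - (c + \<rho> *\<^sub>R z)" "c + \<rho> *\<^sub>R z - real_vec (g z)"] by simp
    ultimately have "norm (x - real_vec (g z)) < \<rho> * (2 * real ?n / N) + \<rho> / N" using g[of z] by simp
    also have "\<dots> = \<rho> * (2 * real ?n + 1) / N"
      by (simp add: distrib_left add_divide_distrib)
    finally show "\<exists>z\<in>g ` Z. norm (x - real_vec z) < \<rho> * (2 * real ?n + 1) / N" using z(1) by blast
  qed
qed

text \<open>
  Take a maximal set of points having \<open>2 ^ l\<close> elements of \<open>N\<close> within \<open>2 * d\<close>, pairwise not sharing any.
  All other such points are within \<open>4 * d\<close> of this set.
\<close>

lemma dense_points_net:
  fixes N :: "(rat ^ 'n) set" and d :: real and l :: nat
  assumes N: "finite N" and d: "0 < d"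
  obtains Z :: "(rat ^ 'n) set" where "finite Z"
    "card Z * 2 ^ l \<le> card N * (4 * (2 * CARD('n) + 1)) ^ CARD('n)"
    "\<And>x. 2 ^ l \<le> card {p \<in> N. norm (x - real_vec p) \<le> 2 * d} \<Longrightarrow>
      \<exists>z\<in>Z. norm (x - real_vec z) < d"
proof -
  let ?n = "CARD('n)" and ?b = "(4 * (2 * CARD('n) + 1)) ^ CARD('n)"
  let ?Y = "\<lambda>x. {p \<in> N. norm (x - real_vec p) \<le> 2 * d}"
  define packed where "packed S \<longleftrightarrow> finite S \<and> (\<forall>x\<in>S. 2 ^ l \<le> card (?Y x)) \<and>
      (\<forall>x\<in>S. \<forall>y\<in>S. x \<noteq> y \<longrightarrow> ?Y x \<inter> ?Y y = {})" for S :: "(real ^ 'n) set"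
  have bound: "card S * 2 ^ l \<le> card N" if "packed S" for S
  proof -
    have "card S * 2 ^ l = (\<Sum>x\<in>S. 2 ^ l)" by simp
    also have "\<dots> \<le> (\<Sum>x\<in>S. card (?Y x))" using that by (intro sum_mono) (auto simp: packed_def)
    also have "\<dots> = card (\<Union>x\<in>S. ?Y x)"
      using that N by (intro card_UN_disjoint[symmetric]) (auto simp: packed_def)
    also have "\<dots> \<le> card N" using N by (intro card_mono) auto
    finally show ?thesis .
  qed
  have "card S \<le> card N" if "packed S" for S
    using bound[OF that] by (metis le_trans mult_le_mono2 mult_numeral_1_right numeral_One one_le_numeral one_le_power)
  moreover have "packed {}" by (simp add: packed_def)
  ultimately obtain S where S: "packed S" "\<And>S'. packed S' \<Longrightarrow> card S' \<le> card S"
    using ex_has_greatest_nat[of packed "{}" card "Suc (card N)"] by (auto simp: less_Suc_eq_le)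
  have cover: "\<exists>y\<in>S. norm (x - y) \<le> 4 * d" if x: "2 ^ l \<le> card (?Y x)" for x
  proof (cases "x \<in> S")
    case False
    have "finite S" using S(1) by (simp add: packed_def)
    then have "\<not> packed (insert x S)" using S(2)[of "insert x S"] False by auto
    have "\<exists>y\<in>S. ?Y x \<inter> ?Y y \<noteq> {}"
    proof (rule ccontr)
      assume "\<not> (\<exists>y\<in>S. ?Y x \<inter> ?Y y \<noteq> {})"
      then have "?Y x \<inter> ?Y y = {}" "?Y y \<inter> ?Y x = {}" if "y \<in> S" for y using that by blast+
      then have "packed (insert x S)" using S(1) x unfolding packed_def by simp
      with \<open>\<not> packed (insert x S)\<close> show False ..
    qed
    then obtain y p where y: "y \<in> S" "p \<in> ?Y x" "p \<in> ?Y y" by blast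
    have "norm (x - y) \<le> norm (x - real_vec p) + norm (y - real_vec p)"
      using norm_triangle_ineq4[of "x - real_vec p" "y - real_vec p"] by simp
    then show ?thesis using y by (intro bexI[of _ y]) auto
  next
    case True
    then show ?thesis using d by (intro bexI[of _ x]) auto
  qed
  have "\<exists>Z :: (rat ^ 'n) set. finite Z \<and> card Z \<le> ?b \<and>
      (\<forall>x. norm (x - y) \<le> 4 * d \<longrightarrow> (\<exists>z\<in>Z. norm (x - real_vec z) < d))" for y
  proof -
    \<comment> \<open>With \<open>4 * (2 * n + 1)\<close> grid points per axis, the radius
      \<open>4 * d\<close> shrinks to exactly \<open>d\<close>, so that a net point approximates at
      the original scale. The number of net points per ball depends on the dimension only.\<close>
    obtain Z :: "(rat ^ 'n) set" where "finite Z" "card Z \<le> ?b"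
      "\<And>x. norm (x - y) \<le> 4 * d \<Longrightarrow>
        \<exists>z\<in>Z. norm (x - real_vec z) < 4 * d * (2 * real ?n + 1) / real (4 * (2 * ?n + 1))"
      by (rule rational_net[of "4 * d" "4 * (2 * ?n + 1)" y]) (use d in auto)
    moreover have "4 * d * (2 * real ?n + 1) / real (4 * (2 * ?n + 1)) = d"
    proof -
      have "real (4 * (2 * ?n + 1)) = 4 * (2 * real ?n + 1)" by simp
      then show ?thesis by (simp only:) (simp add: divide_simps add_nonneg_eq_0_iff)
    qed
    ultimately show ?thesis by auto
  qed
  then obtain g :: "real ^ 'n \<Rightarrow> (rat ^ 'n) set" where g: "\<And>y. finite (g y)" "\<And>y. card (g y) \<le> ?b"
    "\<And>x y. norm (x - y) \<le> 4 * d \<Longrightarrow> \<exists>z\<in>g y. norm (x - real_vec z) < d"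
    by metis
  show ?thesis
  proof (rule that[of "\<Union>y\<in>S. g y"])
    show "finite (\<Union>y\<in>S. g y)" using S(1) g(1) by (auto simp: packed_def)
    have "card (\<Union>y\<in>S. g y) \<le> (\<Sum>y\<in>S. card (g y))"
      using S(1) by (intro card_UN_le) (simp add: packed_def)
    also have "\<dots> \<le> card S * ?b" using g(2) sum_bounded_above[of S "\<lambda>y. card (g y)" ?b] by simp
    finally have "card (\<Union>y\<in>S. g y) * 2 ^ l \<le> card S * 2 ^ l * ?b" by simp
    also have "\<dots> \<le> card N * ?b" using bound[OF S(1)] by (rule mult_le_mono1)
    finally show "card (\<Union>y\<in>S. g y) * 2 ^ l \<le> card N * ?b" .
    show "\<exists>z\<in>\<Union>y\<in>S. g y. norm (x - real_vec z) < d" if "2 ^ l \<le> card (?Y x)" for x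
      using cover[OF that] g(3) by blast
  qed
qed

section \<open>Complexity at a given precision, and energy sums\<close>

lemma real_vec_inj: "real_vec p = real_vec q \<longleftrightarrow> p = q"
  by (auto simp: real_vec_def vec_eq_iff)

lemma complexity_at_le:
  "norm (x - real_vec p) < (1/2) ^ r \<Longrightarrow> complexity_at U B r x \<le> complexity U B (vec_code p)"
  unfolding complexity_at_def by (rule Least_le) (auto simp: dist_norm)

lemma complexity_at_witness:
  "\<exists>p. norm (x - real_vec p) < (1/2) ^ r \<and> complexity U B (vec_code p) = complexity_at U B r x"
proof -
  obtain p where "norm (x - real_vec p) < (1/2) ^ r" using real_vec_dense[of "(1/2) ^ r" x] by auto
  then have "\<exists>l. \<exists>p. real_vec p \<in> ball x ((1/2) ^ r) \<and> complexity U B (vec_code p) = l"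
    by (auto simp: dist_norm)
  from LeastI_ex[OF this] show ?thesis unfolding complexity_at_def by (simp add: dist_norm)
qed

text \<open>Dyadic decomposition by the distance \<open>D\<close> of \<open>p\<close> from
  \<open>q\<close>. If \<open>D\<close> lies between \<open>(1/2) ^ Suc t\<close> and
  \<open>(1/2) ^ t\<close>, then \<open>p\<close> is near \<open>x\<close> at scale \<open>t\<close>
  and \<open>4 * (1/2) ^ r / D\<close> is at most \<open>8 * (1/2) ^ (r - t)\<close>, whence the
  constant 8. Points within \<open>(1/2) ^ r\<close> are handled by \<open>\<phi> p \<le> 1\<close>,
  whence the summand 1 in the constant, and points farther than 1 by the last term.\<close>

lemma energy_sum_le:
  fixes N :: "(rat ^ 'n) set" and \<phi> :: "rat ^ 'n \<Rightarrow> real"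
  assumes N: "finite N" and C: "0 < C"
    and \<phi>1: "\<And>p. \<phi> p \<le> 1"
    and \<phi>: "\<And>p. p \<noteq> q \<Longrightarrow> \<phi> p \<le> C * (4 * (1/2) ^ r / norm (real_vec p - real_vec q)) ^ k"
    and q: "norm (x - real_vec q) < (1/2) ^ r"
    and Y: "\<And>t. t \<le> r \<Longrightarrow> real (card {p \<in> N. norm (x - real_vec p) \<le> 2 * (1/2) ^ t}) \<le> Y t"
  shows "(\<Sum>p\<in>N. \<phi> p) \<le>
    (C * 8 ^ k + 1) * ((\<Sum>t\<le>r. Y t * (1/2) ^ (k * (r - t))) + card N * (1/2) ^ (k * r))"
proof -
  let ?C = "C * 8 ^ k + 1"
  let ?near = "\<lambda>t p. norm (x - real_vec p) \<le> 2 * (1/2) ^ t"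
  let ?I = "\<lambda>t p. if ?near t p then (1/2 :: real) ^ (k * (r - t)) else 0"
  have pt: "\<phi> p \<le> ?C * ((\<Sum>t\<le>r. ?I t p) + (1/2) ^ (k * r))" for p
  proof -
    define D where "D = norm (real_vec p - real_vec q)"
    have tri: "norm (x - real_vec p) \<le> norm (x - real_vec q) + D"
      using norm_triangle_ineq4[of "x - real_vec q" "real_vec p - real_vec q"] by (simp add: D_def)
    have at_scale: ?thesis if t: "t \<le> r" "?near t p" "\<phi> p \<le> ?C * (1/2) ^ (k * (r - t))" for t
    proof -
      have "(1/2 :: real) ^ (k * (r - t)) = ?I t p" using t by simp
      also have "\<dots> \<le> (\<Sum>t\<le>r. ?I t p)" using t by (intro member_le_sum) auto
      finally have "(1/2 :: real) ^ (k * (r - t)) \<le> (\<Sum>t\<le>r. ?I t p) + (1/2) ^ (k * r)"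
        by (simp add: add_increasing2)
      then have "?C * (1/2) ^ (k * (r - t)) \<le> ?C * ((\<Sum>t\<le>r. ?I t p) + (1/2) ^ (k * r))"
        using C by (intro mult_left_mono) auto
      with t(3) show ?thesis by linarith
    qed
    consider "D \<le> (1/2) ^ r" | "1 < D" | "(1/2) ^ r < D" "D \<le> 1" by linarith
    then show ?thesis
    proof cases
      case 1
      have "1 \<le> ?C" using C by simp
      then show ?thesis using tri q 1 \<phi>1[of p] by (intro at_scale[of r]) auto
    next
      case 2
      then have "p \<noteq> q" by (auto simp: D_def)
      then have "\<phi> p \<le> C * (4 * (1/2) ^ r / D) ^ k" using \<phi> by (simp add: D_def)
      also have "\<dots> \<le> C * (8 * (1/2) ^ r) ^ k"
      proof (intro mult_left_mono power_mono)
        have "4 * (1/2) ^ r / D \<le> 4 * (1/2) ^ r / 1" using 2 by (intro divide_left_mono) auto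
        also have "\<dots> \<le> 8 * (1/2) ^ r" by simp
        finally show "4 * (1/2) ^ r / D \<le> 8 * (1/2) ^ r" .
      qed (use 2 C in auto)
      also have "\<dots> = C * 8 ^ k * (1/2) ^ (k * r)"
        by (simp add: power_mult_distrib power_mult[symmetric] mult.commute[of k])
      also have "\<dots> \<le> ?C * ((\<Sum>t\<le>r. ?I t p) + (1/2) ^ (k * r))"
      proof (intro mult_mono)
        show "(1/2) ^ (k * r) \<le> (\<Sum>t\<le>r. ?I t p) + (1/2) ^ (k * r)" by (simp add: sum_nonneg)
      qed (use C in auto)
      finally show ?thesis .
    next
      case 3
      define j where "j = (LEAST j. (1/2) ^ j < D)"
      have j: "(1/2) ^ j < D" "j \<le> r"
        unfolding j_def using 3(1) by (rule LeastI, rule Least_le)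
      then have "j \<noteq> 0" using 3(2) by (intro notI) simp
      then obtain t where t: "j = Suc t" using not0_implies_Suc by blast
      have D: "D \<le> (1/2) ^ t" using not_less_Least[of t "\<lambda>j. (1/2) ^ j < D"] t by (simp add: j_def)
      have tr: "t \<le> r" using j t by simp
      have pow: "(1/2 :: real) ^ r \<le> (1/2) ^ t" using tr by (intro power_decreasing) auto
      show ?thesis
      proof (rule at_scale[OF tr])
        show "?near t p" using tri q D pow by linarith
        have "p \<noteq> q" using 3(1) by (auto simp: D_def)
        then have "\<phi> p \<le> C * (4 * (1/2) ^ r / D) ^ k" using \<phi> by (simp add: D_def)
        also have "\<dots> \<le> C * (8 * (1/2) ^ (r - t)) ^ k"
        proof (intro mult_left_mono power_mono)
          have "4 * (1/2) ^ r / D \<le> 4 * (1/2) ^ r / (1/2) ^ Suc t"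
            using j(1) t 3 by (intro divide_left_mono) (auto intro!: mult_pos_pos order.strict_trans[of 0 "(1/2) ^ r" D])
          also have "\<dots> = 8 * ((1/2) ^ r / (1/2) ^ t)" by simp
          also have "(1/2 :: real) ^ r / (1/2) ^ t = (1/2) ^ (r - t)" using tr by (simp add: power_diff)
          finally show "4 * (1/2) ^ r / D \<le> 8 * (1/2) ^ (r - t)" .
        qed (use 3 C order.strict_trans[of 0 "(1/2) ^ r" D] in auto)
        also have "\<dots> = C * 8 ^ k * (1/2) ^ (k * (r - t))"
          by (simp add: power_mult_distrib power_mult[symmetric] mult.commute[of k])
        also have "\<dots> \<le> ?C * (1/2) ^ (k * (r - t))" by (intro mult_right_mono) auto
        finally show "\<phi> p \<le> ?C * (1/2) ^ (k * (r - t))" .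
      qed
    qed
  qed
  have "(\<Sum>p\<in>N. \<phi> p) \<le> (\<Sum>p\<in>N. ?C * ((\<Sum>t\<le>r. ?I t p) + (1/2) ^ (k * r)))"
    by (intro sum_mono pt)
  also have "\<dots> = ?C * ((\<Sum>t\<le>r. \<Sum>p\<in>N. ?I t p) + card N * (1/2) ^ (k * r))"
    by (simp add: sum_distrib_left[symmetric] sum.distrib sum.swap[of _ N])
  also have "\<dots> \<le> ?C * ((\<Sum>t\<le>r. Y t * (1/2) ^ (k * (r - t))) + card N * (1/2) ^ (k * r))"
  proof (intro mult_left_mono add_right_mono sum_mono)
    fix t assume "t \<in> {..r}"
    then have "real (card {p \<in> N. ?near t p}) * (1/2) ^ (k * (r - t)) \<le> Y t * (1/2) ^ (k * (r - t))"
      by (intro mult_right_mono Y) auto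
    also have "real (card {p \<in> N. ?near t p}) * (1/2) ^ (k * (r - t)) = (\<Sum>p\<in>N. ?I t p)"
      using N by (simp add: sum.If_cases Int_def)
    finally show "(\<Sum>p\<in>N. ?I t p) \<le> Y t * (1/2) ^ (k * (r - t))" .
  qed (use C in auto)
  finally show ?thesis .
qed

text \<open>Because \<open>h \<le> k\<close>, the bound is largest at the finest scale
  \<open>t = r\<close>. The \<open>r + 1\<close> scales and the far points, which count for two
  more, give the factor \<open>r + 3\<close>, absorbed by a second \<open>e\<close>.\<close>

lemma energy_sum_powr_le:
  fixes N :: "(rat ^ 'n) set" and \<phi> :: "rat ^ 'n \<Rightarrow> real" and \<kappa> :: nat and h e :: real
  assumes N: "finite N" "card N \<le> 2 ^ (\<kappa> + 1)" and C: "0 < C" and e: "0 \<le> e"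
    and h: "0 \<le> h" "h \<le> k"
    and \<phi>1: "\<And>p. \<phi> p \<le> 1"
    and \<phi>: "\<And>p. p \<noteq> q \<Longrightarrow> \<phi> p \<le> C * (4 * (1/2) ^ r / norm (real_vec p - real_vec q)) ^ k"
    and q: "norm (x - real_vec q) < (1/2) ^ r"
    and Y: "\<And>t. t \<le> r \<Longrightarrow> real (card {p \<in> N. norm (x - real_vec p) \<le> 2 * (1/2) ^ t}) \<le>
        2 powr (\<kappa> - h * t + e)"
    and r: "(C * 8 ^ k + 1) * (real r + 3) \<le> 2 powr e"
  shows "(\<Sum>p\<in>N. \<phi> p) \<le> 2 powr (\<kappa> - h * r + 2 * e)"
proof -
  let ?C = "C * 8 ^ k + 1" and ?M = "2 powr (\<kappa> - h * r + e)"
  have t: "2 powr (\<kappa> - h * t + e) * (1/2) ^ (k * (r - t)) \<le> ?M" if "t \<le> r" for t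
  proof -
    have "h * real (r - t) \<le> real k * real (r - t)" using h by (intro mult_right_mono) auto
    then have "\<kappa> - h * t + e - real k * real (r - t) \<le> \<kappa> - h * r + e"
      using that by (simp add: of_nat_diff algebra_simps)
    then have "2 powr (\<kappa> - h * t + e - real k * real (r - t)) \<le> ?M" by (intro powr_mono) auto
    then show ?thesis unfolding half_power powr_add[symmetric] by simp
  qed
  have "real (card N) * (1/2) ^ (k * r) \<le> 2 powr (\<kappa> + 1) * 2 powr (- real (k * r))"
    unfolding half_power
  proof (intro mult_right_mono)
    have "real (card N) \<le> real (2 ^ (\<kappa> + 1))" using N(2) by (rule of_nat_mono)
    also have "\<dots> = 2 powr (\<kappa> + 1)" by (simp add: powr_add powr_realpow)
    finally show "real (card N) \<le> 2 powr (\<kappa> + 1)" .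
  qed simp
  also have "\<dots> = 2 * 2 powr (\<kappa> - real (k * r))" by (simp add: powr_add powr_diff powr_minus divide_inverse)
  also have "\<dots> \<le> 2 * ?M"
  proof -
    have "h * real r \<le> real k * real r" using h by (intro mult_right_mono) auto
    then have "2 powr (\<kappa> - real (k * r)) \<le> ?M" using e by (intro powr_mono) auto
    then show ?thesis by simp
  qed
  finally have card: "real (card N) * (1/2) ^ (k * r) \<le> 2 * ?M" .
  have "(\<Sum>t\<le>r. 2 powr (\<kappa> - h * t + e) * (1/2) ^ (k * (r - t))) \<le> (\<Sum>t\<le>r. ?M)"
    by (intro sum_mono t) simp
  then have S: "(\<Sum>t\<le>r. 2 powr (\<kappa> - h * t + e) * (1/2) ^ (k * (r - t))) + card N * (1/2) ^ (k * r) \<le>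
      (real r + 3) * ?M"
    using card by (simp add: algebra_simps)
  have "(\<Sum>p\<in>N. \<phi> p) \<le> ?C * ((\<Sum>t\<le>r. 2 powr (\<kappa> - h * t + e) * (1/2) ^ (k * (r - t))) +
      card N * (1/2) ^ (k * r))"
    by (rule energy_sum_le[OF N(1) C \<phi>1 \<phi> q Y])
  also have "\<dots> \<le> ?C * ((real r + 3) * ?M)" using S C by (intro mult_left_mono) auto
  also have "\<dots> \<le> 2 powr e * ?M" unfolding mult.assoc[symmetric] using r by (intro mult_right_mono) auto
  also have "\<dots> = 2 powr (\<kappa> - h * r + 2 * e)" by (simp add: powr_add[symmetric] algebra_simps)
  finally show ?thesis .
qed

section \<open>The projection theorem\<close>

text \<open>The ball of radius \<open>2 ^ r\<close> eventually contains any given point. Refining it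
  to precision \<open>(1/2) ^ r\<close> takes the factor \<open>4 ^ r\<close> per axis, hence about
  \<open>2 * n * r\<close> bits.\<close>

lemma rational_grid:
  obtains G :: "(rat ^ 'n) set" where "finite G"
    "card G \<le> ((2 * CARD('n) + 1) * 4 ^ r) ^ CARD('n)"
    "\<And>x. norm x \<le> 2 ^ r \<Longrightarrow> \<exists>p\<in>G. norm (x - real_vec p) < (1/2) ^ r"
proof -
  let ?n = "CARD('n)"
  let ?N = "(2 * ?n + 1) * 4 ^ r"
  obtain G :: "(rat ^ 'n) set" where G: "finite G" "card G \<le> ?N ^ ?n"
    "\<And>x. norm (x - 0) \<le> 2 ^ r \<Longrightarrow> \<exists>p\<in>G. norm (x - real_vec p) < 2 ^ r * (2 * real ?n + 1) / real ?N"
    by (rule rational_net[of "2 ^ r" ?N 0]) auto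
  define d where "d = 2 * real ?n + 1"
  have d: "d \<noteq> 0" by (simp add: d_def add_nonneg_eq_0_iff)
  have "(4 :: real) ^ r = 2 ^ r * 2 ^ r" by (simp add: power_mult_distrib[symmetric])
  then have "real ?N = d * (2 ^ r * 2 ^ r)" by (simp add: d_def distrib_right)
  then have "2 ^ r * d / real ?N = (1/2) ^ r" using d by (simp add: power_one_over)
  then have "2 ^ r * (2 * real ?n + 1) / real ?N = (1/2) ^ r" unfolding d_def .
  with G show ?thesis by (intro that[of G]) auto
qed

lemma eventually_log_le:
  fixes \<epsilon> c :: real and a :: nat
  assumes "0 < \<epsilon>"
  shows "\<forall>\<^sub>F r in sequentially. 92 * log 2 (real (a * r + 3) + 2) + c \<le> \<epsilon> * real r"
proof (cases "a = 0")
  case True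
  have "\<forall>\<^sub>F r in sequentially. 92 * log 2 5 + c \<le> \<epsilon> * real r" using assms by real_asymp
  then show ?thesis using True by simp
next
  case False
  then have "0 < real a" by simp
  then have "\<forall>\<^sub>F r in sequentially. 92 * log 2 (real a * real r + 3 + 2) + c \<le> \<epsilon> * real r"
    using assms by real_asymp
  then show ?thesis by simp
qed

lemma card_complexity_vec_le:
  assumes "universal_prefix_free U"
  shows "finite {p :: rat ^ 'n. complexity U A (vec_code p) \<le> \<kappa>}" (is "finite ?N")
    and "card {p :: rat ^ 'n. complexity U A (vec_code p) \<le> \<kappa>} \<le> 2 ^ (\<kappa> + 1)"
proof -
  have eq: "?N = vec_code -` {\<sigma>. complexity U A \<sigma> \<le> \<kappa>}" by auto
  note fin = card_complexity_le[OF assms, of A \<kappa>]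
  show "finite ?N" unfolding eq using fin by (intro finite_vimageI vec_code_inj) blast
  have "card ?N \<le> card {\<sigma>. complexity U A \<sigma> \<le> \<kappa>}"
    using fin by (intro card_inj_on_le[of vec_code]) (auto intro: inj_on_subset[OF vec_code_inj])
  then show "card ?N \<le> 2 ^ (\<kappa> + 1)" using fin by linarith
qed

text \<open>
  The oracle \<open>B\<close> tabulates four families of finite sets: rational grids \<open>G\<close>, nets \<open>Z\<close> of the points near
  which \<open>N\<close> is dense, the exceptional sets \<open>Bad\<close>, and the fibres \<open>L3\<close> over a cover of the projection.
  For a point \<open>x\<close> that is optimal for \<open>B\<close>, the grids bound the complexity \<open>\<kappa>\<close> linearly, the nets show that
  the best approximation \<open>q\<close> has small energy, the exceptional sets then show that few points of \<open>N\<close> project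
  near \<open>q\<close>, and the fibres give a description of \<open>q\<close> that is too short.
\<close>

lemma projection_dim_not_less:
  fixes U :: otm and A :: "nat set" and F :: "(real ^ 'n) set" and V :: "(real ^ 'n) set" and s h \<epsilon> C :: real and k :: nat
    and \<phi> :: "nat \<Rightarrow> rat ^ 'n \<Rightarrow> rat ^ 'n \<Rightarrow> real"
  defines "N \<equiv> \<lambda>\<kappa>. {p :: rat ^ 'n. complexity U A (vec_code p) \<le> \<kappa>}"
  assumes U: "universal_prefix_free U" and V: "subspace V"
    and \<epsilon>: "0 < \<epsilon>" "\<epsilon> \<le> 1" and s: "0 < s" "s + 18 * \<epsilon> \<le> h" and hk: "h \<le> k"
    and C: "0 < C" and \<phi>1: "\<And>r q p. \<phi> r q p \<le> 1"
    and \<phi>: "\<And>r q p. p \<noteq> q \<Longrightarrow> \<phi> r q p \<le> C * (4 * (1/2) ^ r / norm (real_vec p - real_vec q)) ^ k"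
    and opt: "\<And>B. \<exists>x\<in>F.
      (\<forall>\<^sub>F r in sequentially. h * real r \<le> complexity_at U (oracle_join A B) r x) \<and>
      (\<forall>\<^sub>F r in sequentially. complexity_at U (oracle_join A B) r x \<ge> complexity_at U A r x - \<epsilon> * real r)"
    and few: "\<forall>\<^sub>F r in sequentially. \<forall>\<kappa>\<le>(2 * CARD('n) + 2) * r.
      real (card {q \<in> N \<kappa>. (\<Sum>p\<in>N \<kappa>. \<phi> r q p) \<le> 2 powr (\<kappa> - (h - 2 * \<epsilon>) * real r) \<and>
        2 powr (\<kappa> - (h - 2 * \<epsilon> - 4 * \<epsilon>) * real r) \<le>
          real (card {p \<in> N \<kappa>. norm (orth_proj V (real_vec p - real_vec q)) \<le> 4 * (1/2) ^ r})})
      < 2 powr (\<kappa> - 2 * \<epsilon> * real r)"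
  shows "\<not> hausdorff_dim (orth_proj V ` F) < ennreal s"
proof
  assume dim: "hausdorff_dim (orth_proj V ` F) < ennreal s"
  let ?n = "CARD('n)" and ?P = "orth_proj V"
  have finN: "finite (N \<kappa>)" and cardN: "card (N \<kappa>) \<le> 2 ^ (\<kappa> + 1)" for \<kappa>
    unfolding N_def by (rule card_complexity_vec_le[OF U])+
  define X where "X r \<kappa> q = {p \<in> N \<kappa>. norm (?P (real_vec p - real_vec q)) \<le> 4 * (1/2) ^ r}" for r \<kappa> q
  \<comment> \<open>The loss \<open>6 * \<epsilon>\<close> consists of \<open>2 * \<epsilon>\<close>
    from the energy bound and \<open>4 * \<epsilon>\<close> from Markov's inequality.\<close>
  define \<theta> where "\<theta> r \<kappa> = 2 powr (real \<kappa> - (h - 6 * \<epsilon>) * real r)" for r \<kappa> :: nat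
  define Bad where "Bad r \<kappa> = {q \<in> N \<kappa>. (\<Sum>p\<in>N \<kappa>. \<phi> r q p) \<le> 2 powr (real \<kappa> - (h - 2 * \<epsilon>) * real r) \<and>
      \<theta> r \<kappa> \<le> real (card (X r \<kappa> q))}" for r \<kappa>
  have few': "\<forall>\<^sub>F r in sequentially. \<forall>\<kappa>\<le>(2 * ?n + 2) * r. real (card (Bad r \<kappa>)) < 2 powr (\<kappa> - 2 * \<epsilon> * real r)"
  proof -
    have "h - 2 * \<epsilon> - 4 * \<epsilon> = h - 6 * \<epsilon>" by simp
    then show ?thesis using few unfolding Bad_def \<theta>_def X_def by simp
  qed
  obtain G :: "nat \<Rightarrow> (rat ^ 'n) set" where G: "\<And>r. finite (G r)"
    "\<And>r. card (G r) \<le> ((2 * ?n + 1) * 4 ^ r) ^ ?n"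
    "\<And>r x. norm x \<le> 2 ^ r \<Longrightarrow> \<exists>p\<in>G r. norm (x - real_vec p) < (1/2) ^ r"
    using rational_grid by metis
  define netP where "netP \<kappa> t l Z \<longleftrightarrow> finite Z \<and>
      card Z * 2 ^ l \<le> card (N \<kappa>) * (4 * (2 * ?n + 1)) ^ ?n \<and>
      (\<forall>x. 2 ^ l \<le> card {p \<in> N \<kappa>. norm (x - real_vec p) \<le> 2 * (1/2) ^ t} \<longrightarrow>
        (\<exists>z\<in>Z. norm (x - real_vec z) < (1/2) ^ t))" for \<kappa> t l :: nat and Z :: "(rat ^ 'n) set"
  have "\<exists>Z. netP \<kappa> t l Z" for \<kappa> t l
    unfolding netP_def by (rule dense_points_net[OF finN, of "(1/2) ^ t" l \<kappa>]) auto
  then obtain Z where "\<And>\<kappa> t l. netP \<kappa> t l (Z \<kappa> t l)" by metis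
  then have Z: "finite (Z \<kappa> t l)"
    "card (Z \<kappa> t l) * 2 ^ l \<le> card (N \<kappa>) * (4 * (2 * ?n + 1)) ^ ?n"
    "2 ^ l \<le> card {p \<in> N \<kappa>. norm (x - real_vec p) \<le> 2 * (1/2) ^ t} \<Longrightarrow>
      \<exists>z\<in>Z \<kappa> t l. norm (x - real_vec z) < (1/2) ^ t" for \<kappa> t l x
    unfolding netP_def by blast+
  define coverP where "coverP T D \<tau> \<longleftrightarrow> ?P ` F \<subseteq> (\<Union>i. D i) \<and> (\<forall>i. bounded (D i)) \<and>
      (\<forall>i. diameter (D i) \<le> (1/2) ^ \<tau> i) \<and> (\<forall>i. T \<le> \<tau> i) \<and> (\<forall>m. finite {i. \<tau> i = m}) \<and>
      (\<forall>m. real (card {i. \<tau> i = m}) \<le> 2 powr (s * (real m + 1)) + 1)"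
    for T :: nat and D :: "nat \<Rightarrow> (real ^ 'n) set" and \<tau> :: "nat \<Rightarrow> nat"
  \<comment> \<open>The scale \<open>R1\<close> from which all estimates hold depends on
    \<open>x\<close>, hence on \<open>B\<close>. So \<open>B\<close> has to store covers for every
    lower bound \<open>T\<close> on the scales.\<close>
  have "\<exists>D \<tau>. coverP T D \<tau>" for T
    unfolding coverP_def by (rule hausdorff_dim_less_dyadic_cover[OF dim s(1), of T]) blast
  then obtain D \<tau> where coverP: "\<And>T. coverP T (D T) (\<tau> T)" by metis
  have D: "?P ` F \<subseteq> (\<Union>i. D T i)" "bounded (D T i)" "diameter (D T i) \<le> (1/2) ^ \<tau> T i"
    "T \<le> \<tau> T i" "finite {i. \<tau> T i = m}"
    "real (card {i. \<tau> T i = m}) \<le> 2 powr (s * (real m + 1)) + 1" for T i m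
    using coverP[of T] by (simp_all add: coverP_def)
  define fib where "fib T i \<kappa> = {p \<in> N \<kappa>. \<exists>y\<in>D T i. norm (?P (real_vec p) - y) \<le> (1/2) ^ \<tau> T i}" for T i \<kappa>
  \<comment> \<open>Only small fibres are tabulated, which keeps the lists short; the fibre relevant
    to \<open>x\<close> will turn out to be small.\<close>
  define L3 where "L3 T t \<kappa> = (\<Union>i\<in>{i. \<tau> T i = t \<and> real (card (fib T i \<kappa>)) \<le> \<theta> t \<kappa>}. fib T i \<kappa>)" for T t \<kappa>
  have finfib: "finite (fib T i \<kappa>)" for T i \<kappa> using finN by (simp add: fib_def)
  have finI: "finite {i. \<tau> T i = t \<and> Q i}" for T t Q using D(5)[of T t] by (rule rev_finite_subset) auto
  have finL3: "finite (L3 T t \<kappa>)" for T t \<kappa> unfolding L3_def by (intro finite_UN_I finI finfib)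
  have cardL3: "real (card (L3 T t \<kappa>)) \<le> 2 powr (s * (real t + 1) + 1) * \<theta> t \<kappa>" for T t \<kappa>
  proof -
    let ?I = "{i. \<tau> T i = t \<and> real (card (fib T i \<kappa>)) \<le> \<theta> t \<kappa>}"
    have "card (L3 T t \<kappa>) \<le> (\<Sum>i\<in>?I. card (fib T i \<kappa>))"
      unfolding L3_def using finI by (rule card_UN_le)
    then have "real (card (L3 T t \<kappa>)) \<le> real (\<Sum>i\<in>?I. card (fib T i \<kappa>))" by (rule of_nat_mono)
    also have "\<dots> = (\<Sum>i\<in>?I. real (card (fib T i \<kappa>)))" by (rule of_nat_sum)
    also have "\<dots> \<le> (\<Sum>i\<in>?I. \<theta> t \<kappa>)" by (rule sum_mono) simp
    also have "\<dots> = card ?I * \<theta> t \<kappa>" by simp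
    also have "\<dots> \<le> 2 powr (s * (real t + 1) + 1) * \<theta> t \<kappa>"
    proof (intro mult_right_mono)
      have "card ?I \<le> card {i. \<tau> T i = t}" using D(5) by (intro card_mono) auto
      then have "real (card ?I) \<le> 2 powr (s * (real t + 1)) + 1" using D(6)[of T t] by linarith
      moreover have "1 \<le> 2 powr (s * (real t + 1))" using s(1) by (simp add: ge_one_powr_ge_zero)
      ultimately show "real (card ?I) \<le> 2 powr (s * (real t + 1) + 1)" by (simp add: powr_add)
    qed (simp add: \<theta>_def)
    finally show ?thesis .
  qed
  define L where "L f a b d e = (if f = 0 then G a else if f = 1 then Z a b d
      else if f = 2 then Bad a b else L3 a b d)" for f a b d e :: nat
  have finL: "finite (L f a b d e)" for f a b d e
    using G(1) Z(1) finN finL3 by (simp add: L_def Bad_def)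
  obtain B c where Bc: "\<And>f a b d e M p. p \<in> L f a b d e \<Longrightarrow> f \<le> M \<Longrightarrow> a \<le> M \<Longrightarrow> b \<le> M \<Longrightarrow>
      d \<le> M \<Longrightarrow> e \<le> M \<Longrightarrow> real (complexity U (oracle_join A B) (vec_code p)) \<le>
      log 2 (real (card (L f a b d e))) + 92 * log 2 (real M + 2) + c"
    by (rule table_oracle_vec[where L = L and A = A, OF U finL]) blast
  define K where "K r x = real (complexity_at U (oracle_join A B) r x)" for r and x :: "real ^ 'n"
  define \<kappa> where "\<kappa> r x = complexity_at U A r x" for r and x :: "real ^ 'n"
  obtain x where x: "x \<in> F" "\<forall>\<^sub>F r in sequentially. h * real r \<le> K r x"
    "\<forall>\<^sub>F r in sequentially. K r x \<ge> real (\<kappa> r x) - \<epsilon> * real r"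
    using opt[of B] unfolding K_def \<kappa>_def by blast
  \<comment> \<open>\<open>(2 * n + 3) * r + 3\<close> dominates every index used at scale
    \<open>r\<close>: the family number is at most 3, scales are at most \<open>r\<close>,
    complexities at most \<open>(2 * n + 2) * r\<close>, and \<open>l\<close> at most one more. So
    \<open>err r\<close> is logarithmic in \<open>r\<close>.\<close>
  define err where "err r = 92 * log 2 (real ((2 * ?n + 3) * r + 3) + 2) + c" for r
  have look: "K t y \<le> log 2 w + err r"
    if "p \<in> L f a b d e" "norm (y - real_vec p) < (1/2) ^ t" "real (card (L f a b d e)) \<le> w"
      "f \<le> 3" "a \<le> (2 * ?n + 3) * r + 3" "b \<le> (2 * ?n + 3) * r + 3" "d \<le> (2 * ?n + 3) * r + 3"
      "e \<le> (2 * ?n + 3) * r + 3" for p f a b d e y t w r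
  proof -
    have "K t y \<le> complexity U (oracle_join A B) (vec_code p)"
      unfolding K_def using complexity_at_le[OF that(2)] by (intro of_nat_mono)
    also have "\<dots> \<le> log 2 (real (card (L f a b d e))) + err r"
      using Bc[OF that(1), of "(2 * ?n + 3) * r + 3"] that by (simp add: err_def)
    also have "log 2 (real (card (L f a b d e))) \<le> log 2 w"
    proof -
      have "0 < card (L f a b d e)" using that(1) finL by (auto simp: card_gt_0_iff)
      then show ?thesis using that(3) by simp
    qed
    finally show ?thesis by simp
  qed
  define b where "b = log 2 (real ((4 * (2 * ?n + 1)) ^ ?n))"
  obtain R0 where R0: "\<And>r. R0 \<le> r \<Longrightarrow> h * real r \<le> K r x"
    using x(2) unfolding eventually_sequentially by blast
  have h0: "0 < h" using s \<epsilon> by linarith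
  have e1: "\<forall>\<^sub>F r in sequentially. err r + (real ?n * log 2 (2 * real ?n + 1) + 2 + \<bar>b\<bar> + s) \<le> \<epsilon> * real r"
    using eventually_log_le[OF \<epsilon>(1), of "2 * ?n + 3" "c + (real ?n * log 2 (2 * real ?n + 1) + 2 + \<bar>b\<bar> + s)"]
    by (simp add: err_def add.assoc)
  have e2: "\<forall>\<^sub>F r in sequentially. h * R0 + 1 \<le> \<epsilon> * real r" using \<epsilon>(1) by real_asymp
  have C8: "0 < C * 8 ^ k + 1" using C by (simp add: add_pos_pos)
  have e3: "\<forall>\<^sub>F r in sequentially. (C * 8 ^ k + 1) * (real r + 3) \<le> 2 powr (\<epsilon> * real r)"
  proof -
    define c' where "c' = C * 8 ^ k + 1"
    have "0 < c'" using C8 by (simp add: c'_def)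
    then have "\<forall>\<^sub>F r in sequentially. c' * (real r + 3) \<le> 2 powr (\<epsilon> * real r)"
      using \<epsilon>(1) by real_asymp
    then show ?thesis by (simp add: c'_def)
  qed
  have e4: "\<forall>\<^sub>F r in sequentially. norm x \<le> 2 ^ r" by real_asymp
  have e5: "\<forall>\<^sub>F r in sequentially. 1 \<le> r" by (rule eventually_ge_at_top)
  have "\<forall>\<^sub>F r in sequentially. 1 \<le> r \<and> \<kappa> r x \<le> (2 * ?n + 2) * r \<and>
      err r + (2 + s) \<le> \<epsilon> * real r \<and> K r x \<ge> real (\<kappa> r x) - \<epsilon> * real r \<and>
      (\<forall>q\<in>N (\<kappa> r x). norm (x - real_vec q) < (1/2) ^ r \<longrightarrow> real (card (X r (\<kappa> r x) q)) < \<theta> r (\<kappa> r x))"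
    using few' x(3) e1 e2 e3 e4 e5
  proof eventually_elim
    case (elim r)
    let ?\<kappa> = "\<kappa> r x"
    have n0: "0 \<le> log 2 (2 * real ?n + 1)" by simp
    have abs: "0 \<le> \<bar>b\<bar>" by simp
    have err: "err r + (2 + s) \<le> \<epsilon> * real r" "err r + (2 + b) \<le> \<epsilon> * real r"
        "err r + (real ?n * log 2 (2 * real ?n + 1)) \<le> \<epsilon> * real r" "err r < \<epsilon> * real r"
      using elim(3) n0 s(1) by (auto simp: algebra_simps) (smt (verit) n0 mult_nonneg_nonneg of_nat_0_le_iff)+
    have rr: "r \<le> (2 * ?n + 3) * r + 3" by (simp add: algebra_simps)
    \<comment> \<open>The grid bounds the complexity relative to the join by
      \<open>2 * n * r\<close> up to \<open>\<epsilon> * r\<close>; optimality transfers this to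
      \<open>\<kappa>\<close> at the cost of another \<open>\<epsilon> * r\<close>.\<close>
    obtain p where p: "p \<in> G r" "norm (x - real_vec p) < (1/2) ^ r" using G(3) elim(6) by blast
    have "K r x \<le> log 2 (real (((2 * ?n + 1) * 4 ^ r) ^ ?n)) + err r"
      using G(2)[of r] p rr by (intro look[of p 0 r 0 0 0]) (auto simp: L_def simp del: of_nat_power of_nat_mult)
    also have "log 2 (real (((2 * ?n + 1) * 4 ^ r) ^ ?n)) = real ?n * (log 2 (2 * real ?n + 1) + 2 * r)"
    proof -
      have "log 2 (4 ^ r) = 2 * real r"
        using log_nat_power[of 2 2 "2 * r"] by (simp add: power_mult)
      then have "log 2 ((2 * real ?n + 1) * 4 ^ r) = log 2 (2 * real ?n + 1) + 2 * r"
        by (subst log_mult) (auto simp: add_nonneg_eq_0_iff add_nonneg_pos)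
      moreover have "log 2 (real (((2 * ?n + 1) * 4 ^ r) ^ ?n)) = real ?n * log 2 ((2 * real ?n + 1) * 4 ^ r)"
      proof -
        have "real (((2 * ?n + 1) * 4 ^ r) ^ ?n) = ((2 * real ?n + 1) * 4 ^ r) ^ ?n"
          by (simp add: distrib_right add.commute)
        moreover have "0 < (2 * real ?n + 1) * 4 ^ r" by (simp add: add_nonneg_pos)
        ultimately show ?thesis by (simp only: log_nat_power)
      qed
      ultimately show ?thesis by simp
    qed
    finally have "real ?\<kappa> \<le> 2 * real ?n * r + 2 * (\<epsilon> * real r)"
      using elim(2) err(3) by (simp add: algebra_simps)
    also have "\<dots> \<le> 2 * real ?n * r + 2 * (1 * r)" 
      using mult_right_mono[of \<epsilon> 1 "real r"] \<epsilon> by simp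
    also have "\<dots> = real ((2 * ?n + 2) * r)" by (simp add: algebra_simps)
    finally have \<kappa>r: "?\<kappa> \<le> (2 * ?n + 2) * r" by (simp only: of_nat_le_iff)
    then have \<kappa>r': "?\<kappa> \<le> (2 * ?n + 3) * r + 3" by (simp add: algebra_simps)
    \<comment> \<open>If \<open>2 ^ l\<close> points of \<open>N\<close> are near \<open>x\<close>
      at scale \<open>t\<close>, a net point describes \<open>x\<close> at that scale by about
      \<open>\<kappa> - l\<close> bits. Comparison with the lower bound \<open>h * t\<close> bounds
      \<open>l\<close>.\<close>
    have Y: "real (card {p \<in> N ?\<kappa>. norm (x - real_vec p) \<le> 2 * (1/2) ^ t}) \<le>
        2 powr (?\<kappa> - h * t + \<epsilon> * real r)" if t: "t \<le> r" for t
    proof -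
      let ?Y = "{p \<in> N ?\<kappa>. norm (x - real_vec p) \<le> 2 * (1/2) ^ t}"
      have "card ?Y \<le> card (N ?\<kappa>)" using finN by (intro card_mono) auto
      then have le: "card ?Y \<le> 2 ^ (?\<kappa> + 1)" using cardN order_trans by blast
      show ?thesis
      proof (cases "card ?Y = 0 \<or> t < R0")
        case True
        then show ?thesis
        proof
          assume "t < R0"
          then have "h * t \<le> h * R0" using h0 by simp
          then have "real ?\<kappa> + 1 \<le> ?\<kappa> - h * t + \<epsilon> * real r" using elim(4) by linarith
          then have "2 powr (real ?\<kappa> + 1) \<le> 2 powr (?\<kappa> - h * t + \<epsilon> * real r)" by simp
          moreover have "real (card ?Y) \<le> real (2 ^ (?\<kappa> + 1))" using le by (rule of_nat_mono)
          moreover have "real (2 ^ (?\<kappa> + 1)) = 2 powr (real ?\<kappa> + 1)" by (simp add: powr_add powr_realpow)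
          ultimately show ?thesis by linarith
        qed simp
      next
        case False
        then obtain l where l: "2 ^ l \<le> card ?Y" "card ?Y < 2 ^ (l + 1)"
          using ex_power_ivl1[of 2 "card ?Y"] by (auto simp: Suc_le_eq)
        have "(2::nat) ^ l \<le> 2 ^ (?\<kappa> + 1)" using l(1) le by linarith
        then have l\<kappa>: "l \<le> ?\<kappa> + 1" by (simp only: power_increasing_iff one_less_numeral_iff semiring_norm)
        obtain z where z: "z \<in> Z ?\<kappa> t l" "norm (x - real_vec z) < (1/2) ^ t" using Z(3)[OF l(1)] by blast
        have "real (card (Z ?\<kappa> t l) * 2 ^ l) \<le> real (2 ^ (?\<kappa> + 1) * (4 * (2 * ?n + 1)) ^ ?n)"
          using Z(2)[where \<kappa> = ?\<kappa> and t = t and l = l] cardN[of ?\<kappa>]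
          by (intro of_nat_mono) (meson le_trans mult_le_mono1)
        then have "real (card (Z ?\<kappa> t l)) \<le> 2 powr (real ?\<kappa> + 1 - l + b)"
          by (simp add: b_def powr_add powr_diff powr_realpow field_simps)
        moreover have "l \<le> (2 * ?n + 3) * r + 3" using l\<kappa> \<kappa>r by (simp add: algebra_simps)
        ultimately have "K t x \<le> log 2 (2 powr (real ?\<kappa> + 1 - l + b)) + err r"
          using z \<kappa>r' t rr
          by (intro look[of z 1 ?\<kappa> t l 0]) (auto simp: L_def intro: order_trans)
        then have "K t x \<le> real ?\<kappa> + 1 - l + b + err r" by simp
        moreover have "h * t \<le> K t x" using R0 False by simp
        ultimately have "real l + 1 \<le> ?\<kappa> - h * t + \<epsilon> * real r" using err(2) by linarith
        then have "2 powr (real l + 1) \<le> 2 powr (?\<kappa> - h * t + \<epsilon> * real r)" by simp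
        moreover have "real (card ?Y) \<le> real (2 ^ (l + 1))" using l(2) by (intro of_nat_mono) simp
        moreover have "real (2 ^ (l + 1)) = 2 powr (real l + 1)" by (simp add: powr_add powr_realpow)
        ultimately show ?thesis by linarith
      qed
    qed
    \<comment> \<open>A bad \<open>q\<close> would be described by
      \<open>\<kappa> - 2 * \<epsilon> * r + err r\<close> bits, contrary to the lower bound
      \<open>\<kappa> - \<epsilon> * r\<close>.\<close>
    have notbad: "real (card (X r ?\<kappa> q)) < \<theta> r ?\<kappa>"
      if q: "q \<in> N ?\<kappa>" "norm (x - real_vec q) < (1/2) ^ r" for q
    proof (rule ccontr)
      assume "\<not> real (card (X r ?\<kappa> q)) < \<theta> r ?\<kappa>"
      moreover have "(\<Sum>p\<in>N ?\<kappa>. \<phi> r q p) \<le> 2 powr (?\<kappa> - h * real r + 2 * (\<epsilon> * real r))"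
        by (rule energy_sum_powr_le[OF finN cardN C _ _ hk \<phi>1 \<phi> q(2) Y elim(5)]) (use h0 \<epsilon> in auto)
      moreover have "?\<kappa> - h * real r + 2 * (\<epsilon> * real r) = ?\<kappa> - (h - 2 * \<epsilon>) * real r" by (simp add: algebra_simps)
      ultimately have "q \<in> Bad r ?\<kappa>" using q(1) by (simp add: Bad_def)
      moreover have "real (card (Bad r ?\<kappa>)) \<le> 2 powr (?\<kappa> - 2 * \<epsilon> * real r)" using elim(1) \<kappa>r by (auto intro: less_imp_le)
      ultimately have "K r x \<le> log 2 (2 powr (?\<kappa> - 2 * \<epsilon> * real r)) + err r"
        using q(2) \<kappa>r' rr by (intro look[of q 2 r ?\<kappa> 0 0]) (auto simp: L_def)
      then have "K r x \<le> ?\<kappa> - 2 * \<epsilon> * real r + err r" by simp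
      then show False using elim(2) err(4) by linarith
    qed
    show ?case using elim(7) \<kappa>r err(1) elim(2) notbad by blast
  qed
  then obtain R1 where R1: "\<And>r. R1 \<le> r \<Longrightarrow> 1 \<le> r \<and> \<kappa> r x \<le> (2 * ?n + 2) * r \<and>
      err r + (2 + s) \<le> \<epsilon> * real r \<and> K r x \<ge> real (\<kappa> r x) - \<epsilon> * real r \<and>
      (\<forall>q\<in>N (\<kappa> r x). norm (x - real_vec q) < (1/2) ^ r \<longrightarrow> real (card (X r (\<kappa> r x) q)) < \<theta> r (\<kappa> r x))"
    unfolding eventually_sequentially by blast
  \<comment> \<open>From here on the scale is dictated by the member of the cover that contains the
    projection of \<open>x\<close>. All members of the cover number \<open>R1\<close> have scale at
    least \<open>R1\<close>, so the estimates apply, and the index \<open>R1\<close> is cheap to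
    name.\<close>
  obtain i where i: "?P x \<in> D R1 i" using D(1)[of R1] x(1) by blast
  define t where "t = \<tau> R1 i"
  have Rt: "R1 \<le> t" unfolding t_def by (rule D(4))
  note t = R1[OF Rt]
  let ?\<kappa> = "\<kappa> t x"
  obtain q where q: "norm (x - real_vec q) < (1/2) ^ t" "complexity U A (vec_code q) = ?\<kappa>"
    unfolding \<kappa>_def using complexity_at_witness by blast
  have qN: "q \<in> N ?\<kappa>" using q(2) by (simp add: N_def)
  have Pq: "norm (?P (real_vec q) - ?P x) \<le> (1/2) ^ t"
    using dist_orth_proj_le[OF V, of "real_vec q" x] q(1) by (simp add: dist_norm norm_minus_commute)
  \<comment> \<open>The distance to the cover set, its diameter and the distance between the
    projections of \<open>x\<close> and \<open>q\<close> contribute \<open>(1/2) ^ t\<close> each,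
    within the radius \<open>4 * (1/2) ^ t\<close> used for \<open>X\<close>.\<close>
  have "fib R1 i ?\<kappa> \<subseteq> X t ?\<kappa> q"
  proof
    fix p assume "p \<in> fib R1 i ?\<kappa>"
    then obtain y where p: "p \<in> N ?\<kappa>" and y: "y \<in> D R1 i" "norm (?P (real_vec p) - y) \<le> (1/2) ^ t"
      unfolding fib_def t_def by blast
    have "norm (y - ?P x) \<le> (1/2) ^ t"
      using diameter_bounded_bound[OF D(2) y(1) i] D(3)[of R1 i] unfolding t_def dist_norm by linarith
    then have "norm (?P (real_vec p) - ?P (real_vec q)) \<le> 3 * (1/2) ^ t"
      using y(2) Pq norm_triangle_ineq[of "?P (real_vec p) - y" "y - ?P x"]
        norm_triangle_ineq4[of "?P (real_vec p) - ?P x" "?P (real_vec q) - ?P x"] by simp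
    then have "norm (?P (real_vec p - real_vec q)) \<le> 4 * (1/2) ^ t"
      unfolding linear_diff[OF linear_orth_proj[OF V]] by (rule order_trans) simp
    then show "p \<in> X t ?\<kappa> q" using p by (simp add: X_def)
  qed
  then have "card (fib R1 i ?\<kappa>) \<le> card (X t ?\<kappa> q)" using finN by (intro card_mono) (auto simp: X_def)
  then have "real (card (fib R1 i ?\<kappa>)) \<le> \<theta> t ?\<kappa>" using t qN q(1) by (auto intro: less_imp_le order_trans)
  moreover have "q \<in> fib R1 i ?\<kappa>"
    unfolding fib_def using qN Pq i by (auto simp: t_def intro!: bexI[of _ "?P x"])
  ultimately have "q \<in> L 3 R1 t ?\<kappa> 0" by (auto simp: L_def L3_def t_def)
  moreover have "real (card (L 3 R1 t ?\<kappa> 0)) \<le> 2 powr (s * (real t + 1) + 1) * \<theta> t ?\<kappa>"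
    using cardL3 by (simp add: L_def)
  moreover have "m \<le> t \<Longrightarrow> m \<le> (2 * ?n + 3) * t + 3" for m by (simp add: algebra_simps)
  moreover have "?\<kappa> \<le> (2 * ?n + 3) * t + 3" using t by (simp add: algebra_simps)
  ultimately have "K t x \<le> log 2 (2 powr (s * (real t + 1) + 1) * \<theta> t ?\<kappa>) + err t"
    using q(1) Rt by (intro look[of q 3 R1 t ?\<kappa> 0]) auto
  also have "\<dots> = s * (real t + 1) + 1 + (?\<kappa> - (h - 6 * \<epsilon>) * t) + err t"
    by (simp add: \<theta>_def powr_add[symmetric])
  \<comment> \<open>Cancelling \<open>\<kappa>\<close>, the gain \<open>(h - s) * t\<close> is less
    than \<open>8 * \<epsilon> * t\<close>: six from \<open>\<theta>\<close>, one from optimality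
    and one from \<open>err t\<close> and the constants. The gap \<open>18 * \<epsilon>\<close>
    rules this out.\<close>
  finally have "real ?\<kappa> - \<epsilon> * t \<le> s * (real t + 1) + 1 + (?\<kappa> - (h - 6 * \<epsilon>) * t) + err t"
    using t by linarith
  moreover have "(s + 18 * \<epsilon>) * t \<le> h * t" using s(2) by (rule mult_right_mono) simp
  moreover have "0 < \<epsilon> * t" using \<epsilon>(1) t by simp
  moreover have "err t + (2 + s) \<le> \<epsilon> * t" using t by simp
  ultimately show False by (simp add: algebra_simps)
qed

theorem theorem1:
  fixes U :: otm
    and k :: nat
    and F :: "(real ^ 'n) set"
    and \<gamma> :: "(real ^ 'n) set measure"
  assumes "universal_prefix_free U"
    and "1 \<le> k" and "k \<le> CARD('n)"
    and "rotation_invariant_measure k \<gamma>"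
    and "has_optimal_oracles U F"
  shows "AE V in \<gamma>. hausdorff_dim (orth_proj V ` F) = min (hausdorff_dim F) (of_nat k)"
proof -
  note U = assms(1) and k = assms(2) and \<gamma> = assms(4)
  interpret prob_space \<gamma> by (rule rotation_invariantD(1)[OF \<gamma>])
  let ?n = "CARD('n)" and ?M = "min (hausdorff_dim F) (of_nat k :: ennreal)"
  obtain A where A: "hausdorff_optimal U A F" using assms(5) by (auto simp: has_optimal_oracles_def)
  obtain C where C: "0 < C" "\<And>y \<delta>. y \<noteq> 0 \<Longrightarrow> 0 < \<delta> \<Longrightarrow>
      measure \<gamma> {V \<in> space \<gamma>. norm (orth_proj V y) \<le> \<delta>} \<le> C * (\<delta> / norm y) ^ k"
    using transversality[OF \<gamma> k] by blast
  have lower: "AE V in \<gamma>. \<not> hausdorff_dim (orth_proj V ` F) < ennreal s"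
    if s: "0 < s" "ennreal s < ?M" for s
  proof -
    define m where "m = enn2real ?M"
    have M: "ennreal m = ?M" unfolding m_def
      by (rule ennreal_enn2real) (simp add: min_less_iff_disj of_nat_less_top)
    then have "ennreal s < ennreal m" using s(2) by simp
    then have sm: "s < m" using s(1) by (simp add: ennreal_less_iff)
    have "ennreal m \<le> ennreal (real k)" using M by (simp add: ennreal_of_nat_eq_real_of_nat)
    then have mk: "m \<le> k" by simp
    \<comment> \<open>Of \<open>20 * \<epsilon>\<close>, two go into \<open>h\<close>: one is lost
      in the optimality condition, the other makes the inequality with the \<open>liminf\<close>
      strict, so that it holds eventually.\<close>
    define \<epsilon> where "\<epsilon> = min 1 ((m - s) / 20)"
    define h where "h = m - 2 * \<epsilon>"
    have \<epsilon>: "0 < \<epsilon>" "\<epsilon> \<le> 1" "20 * \<epsilon> \<le> m - s" using sm by (auto simp: \<epsilon>_def min_def)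
    have h: "s + 18 * \<epsilon> \<le> h" "h \<le> k" "0 \<le> h" using \<epsilon> mk s(1) by (auto simp: h_def)
    have opt: "\<exists>x\<in>F.
        (\<forall>\<^sub>F r in sequentially. h * real r \<le> complexity_at U (oracle_join A B) r x) \<and>
        (\<forall>\<^sub>F r in sequentially. complexity_at U (oracle_join A B) r x \<ge> complexity_at U A r x - \<epsilon> * real r)"
      for B
    proof -
      obtain x where x: "x \<in> F" "effective_dim U (oracle_join A B) x \<ge> hausdorff_dim F - ennreal \<epsilon>"
        "\<forall>\<^sub>F r in sequentially. real (complexity_at U (oracle_join A B) r x) \<ge>
          real (complexity_at U A r x) - \<epsilon> * real r"
        using A \<epsilon>(1) unfolding hausdorff_optimal_def by blast
      have "ennreal h < ennreal (m - \<epsilon>)" using \<epsilon> h by (simp add: h_def ennreal_less_iff)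
      also have "\<dots> = ennreal m - ennreal \<epsilon>" using \<epsilon> by (simp add: ennreal_minus)
      also have "\<dots> \<le> hausdorff_dim F - ennreal \<epsilon>" using M by (intro ennreal_minus_mono) auto
      also note x(2)
      finally have "\<forall>\<^sub>F r in sequentially. ennreal h < ennreal (real (complexity_at U (oracle_join A B) r x) / real r)"
        unfolding effective_dim_def by (rule less_LiminfD)
      then have "\<forall>\<^sub>F r in sequentially. h * real r \<le> complexity_at U (oracle_join A B) r x"
        using eventually_ge_at_top[of 1]
      proof eventually_elim
        case (elim r)
        then have "h < real (complexity_at U (oracle_join A B) r x) / real r"
          using h by (simp add: ennreal_less_iff)
        then show ?case using elim(2) by (simp add: field_simps)
      qed
      then show ?thesis using x by blast
    qed
    define E where "E r q p = {V \<in> space \<gamma>. norm (orth_proj V (real_vec p - real_vec q)) \<le> 4 * (1/2) ^ r}"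
      for r and q p :: "rat ^ 'n"
    have E: "E r q p \<in> events" for r q p unfolding E_def by (rule orth_proj_measurable[OF \<gamma>])
    have \<phi>: "prob (E r q p) \<le> C * (4 * (1/2) ^ r / norm (real_vec p - real_vec q)) ^ k" if "p \<noteq> q" for r q p
      unfolding E_def using that by (intro C(2)) (auto simp: real_vec_inj)
    \<comment> \<open>\<open>h - 2 * \<epsilon>\<close> is the exponent that the energy bound
      achieves, and \<open>(2 * n + 2) * r\<close> is the bound on \<open>\<kappa>\<close> given by
      the rational grids. No oracle other than \<open>A\<close> occurs, so the null set is
      independent of \<open>B\<close>.\<close>
    have "AE V in \<gamma>. \<forall>\<^sub>F r in sequentially. \<forall>\<kappa>\<le>(2 * ?n + 2) * r.
      real (card {q \<in> {p. complexity U A (vec_code p) \<le> \<kappa>}.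
        (\<Sum>p\<in>{p. complexity U A (vec_code p) \<le> \<kappa>}. prob (E r q p)) \<le> 2 powr (\<kappa> - (h - 2 * \<epsilon>) * r) \<and>
        2 powr (\<kappa> - (h - 2 * \<epsilon> - 4 * \<epsilon>) * r) \<le>
          real (card {p \<in> {p. complexity U A (vec_code p) \<le> \<kappa>}. V \<in> E r q p})})
      < 2 powr (\<kappa> - 2 * \<epsilon> * r)"
      by (rule few_exceptional[OF card_complexity_vec_le[OF U] E \<epsilon>(1)])
    then show ?thesis
      using AE_space
    proof eventually_elim
      case (elim V)
      have V: "subspace V"
        using elim(2) rotation_invariantD(2)[OF \<gamma>] grassmannianD(1) by blast
      have "V \<in> E r q p \<longleftrightarrow> norm (orth_proj V (real_vec p - real_vec q)) \<le> 4 * (1/2) ^ r" for r q p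
        using elim(2) by (simp add: E_def)
      note few = elim(1)[unfolded this]
      show ?case
        by (rule projection_dim_not_less[where \<phi> = "\<lambda>r q p. prob (E r q p)",
              OF U V \<epsilon>(1,2) s(1) h(1,2) C(1) prob_le_1 \<phi> opt few])
    qed
  qed
  \<comment> \<open>The null set depends on \<open>s\<close>; rational values suffice to detect a
    dimension below the minimum, and they keep the union countable.\<close>
  have "AE V in \<gamma>. \<forall>q :: rat. 0 < real_of_rat q \<longrightarrow> ennreal (real_of_rat q) < ?M \<longrightarrow>
      \<not> hausdorff_dim (orth_proj V ` F) < ennreal (real_of_rat q)"
    unfolding AE_all_countable
  proof
    fix q :: rat
    show "AE V in \<gamma>. 0 < real_of_rat q \<longrightarrow> ennreal (real_of_rat q) < ?M \<longrightarrow>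
        \<not> hausdorff_dim (orth_proj V ` F) < ennreal (real_of_rat q)"
    proof (cases "0 < real_of_rat q \<and> ennreal (real_of_rat q) < ?M")
      case True
      then show ?thesis using lower[of "real_of_rat q"] by (auto elim: eventually_mono)
    qed auto
  qed
  then show ?thesis
    using AE_space
  proof eventually_elim
    case (elim V)
    have V: "subspace V" "dim V = k"
      using elim(2) rotation_invariantD(2)[OF \<gamma>] grassmannianD by blast+
    have "hausdorff_dim (orth_proj V ` F) \<le> hausdorff_dim F"
      by (rule hausdorff_dim_image_le) (rule dist_orth_proj_le[OF V(1)])
    moreover have "hausdorff_dim (orth_proj V ` F) \<le> of_nat k"
      using hausdorff_dim_subspace_le[OF V(1)] orth_proj_in[OF V(1)] V(2) by blast
    moreover have "\<not> hausdorff_dim (orth_proj V ` F) < ?M"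
    proof
      assume "hausdorff_dim (orth_proj V ` F) < ?M"
      then obtain q :: rat where q: "hausdorff_dim (orth_proj V ` F) < ennreal (real_of_rat q)"
        "ennreal (real_of_rat q) < ?M"
        using ennreal_rat_dense by blast
      have "0 < ennreal (real_of_rat q)" using q(1) by (rule le_less_trans[OF zero_le])
      then have "0 < real_of_rat q" by (simp only: ennreal_less_zero_iff)
      then show False using elim(1) q by blast
    qed
    ultimately show ?case by (intro antisym) (auto simp: not_less)
  qed
qed

end
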